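(* Let $\mathscr{M}=(M_t)_{t\in\mathbb{R}}$ be an invariant set for the set-valued semigroup $\Phi$ (with respect to $\mathcal{U}$) induced by $\dot x\in\overline{B_\rho}(f(t,x))$. Let $[\tau_1,\tau_2]\subset\mathbb{R}$, $\tau_1<t_0<\tau_2$, $x_0\in\partial M_{t_0}$, and let $\xi^*\in L^\infty([\tau_1,\tau_2],\mathbb{R}^d)$ with $\|\xi^*\|_\infty\le 1$ be such that $x^*(t):=x(t,t_0,x_0,\xi^* )\in\partial M_t$ for all $t\in[\tau_1,\tau_2]$. Then $\xi^*$ minimises, among all $\xi\in L^\infty([\tau_1,\tau_2],\mathbb{R}^d)$ with $\|\xi\|_\infty\le1$, the cost function $$C(\xi,\tau_1,\tau_2)=\int_{\tau_1}^{\tau_2}f_0\big(t,x(t,t_0,x_0,\xi)\big)\,dt,\qquad f_0(t,x):=\inf_{p\in\partial M_t}|x-p|^2 .$$ Moreover, $(x^*(t),\xi^*(t))$ (with $\xi^*$ suitably modified on a null set) solves on $[\tau_1,\tau_2]$ the system of differential equations $$\begin{cases}\dot x=f(t,x)+\rho\,u,\\ \dot u=-D_xf(t,x)^\top u+\langle u,D_xf(t,x)^\top u\rangle\,u.\end{cases}$$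
   Context: Setting. Let $d\ge 2$, $\rho>0$; $|\cdot|$ and $\langle\cdot,\cdot\rangle$ are the Euclidean norm and scalar product, $\overline{B_\rho}(y)$ is the closed ball. The function $f:\mathbb{R}\times\mathbb{R}^d\to\mathbb{R}^d$ is a Carathéodory function (measurable in $t$) such that for every compact $K\subset\mathbb{R}^d$ there are $m,l\in L^1_{loc}(\mathbb{R})$ with, for a.e. $t$: $|f(t,x)|\le m(t)$ and $|f(t,x)-f(t,y)|\le l(t)|x-y|$ for all $x,y\in K$; moreover $f(t,\cdot)$ is continuously differentiable for a.e. $t$, with Jacobian $D_xf$ satisfying $\|D_xf(t,x)\|\le m(t)$ for all $x\in K$ and a.e. $t$. Let $\mathcal{U}=\{\xi\in L^\infty(\mathbb{R},\mathbb{R}^d): \|\xi\|_\infty\le 1\}$. For a control $\xi$, $x(\cdot,t_0,x_0,\xi)$ is the Carathéodory (locally absolutely continuous) solution of $\dot x=f(t,x)+\rho\xi(t)$, $x(t_0)=x_0$; solutions are assumed to be globally defined. Set $\Phi^{t,t_0}(x_0)=\{x(t,t_0,x_0,\xi):\xi\in\mathcal{U}\}$ and, for nonempty compact $M\subset\mathbb{R}^d$ and $t>t_0$, $\Phi^{t,t_0}(M)=\bigcup_{x\in M}\Phi^{t,t_0}(x)$. An invariant set for $\Phi$ is a family $\mathscr{M}=(M_t)_{t\in\mathbb{R}}$ of nonempty compact subsets of $\mathbb{R}^d$ with $\Phi^{t,t_0}(M_{t_0})=M_t$ for all $t>t_0$. $\partial M_t$ is the topological boundary of $M_t$. Solutions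 of differential equations are understood in the Carathéodory sense. *)

theory Defs
  imports "HOL-Analysis.Analysis" "HOL-Probability.Essential_Supremum"
begin

definition locally_integrable :: "(real \<Rightarrow> real) \<Rightarrow> bool" where
  "locally_integrable m \<longleftrightarrow> (\<forall>K. compact K \<longrightarrow> set_integrable lebesgue K m)"

definition caratheodory_function :: "(real \<Rightarrow> real ^ 'n \<Rightarrow> real ^ 'n) \<Rightarrow> bool" where
  "caratheodory_function f \<longleftrightarrow>
     (\<forall>x. (\<lambda>t. f t x) \<in> borel_measurable lebesgue) \<and>
     (AE t in lebesgue. continuous_on UNIV (f t))"

text \<open>Matrices of type \<^typ>\<open>real ^ 'n ^ 'n\<close> carry the Frobenius norm as \<^const>\<open>norm\<close>; the
  operator norm has to be taken through \<^const>\<open>onorm\<close>.\<close>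

definition admissible_rhs :: "(real \<Rightarrow> real ^ 'n \<Rightarrow> real ^ 'n) \<Rightarrow> bool" where
  "admissible_rhs f \<longleftrightarrow>
     caratheodory_function f \<and>
     (AE t in lebesgue. (\<forall>x. f t differentiable (at x)) \<and>
        continuous_on UNIV (\<lambda>x. jacobian (f t) (at x))) \<and>
     (\<forall>K. compact K \<longrightarrow>
        (\<exists>m l. locally_integrable m \<and> locally_integrable l \<and>
           (AE t in lebesgue.
              (\<forall>x\<in>K. norm (f t x) \<le> m t) \<and>
              (\<forall>x\<in>K. \<forall>y\<in>K. norm (f t x - f t y) \<le> l t * norm (x - y)) \<and>
              (\<forall>x\<in>K. onorm ((*v) (jacobian (f t) (at x))) \<le> m t))))"

text \<open>The closed unit ball of \<open>L\<^sup>\<infinity>(I, \<real>\<^sup>n)\<close>, as a set of functions rather than of equivalence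
  classes; the values of a control outside \<open>I\<close> are irrelevant.\<close>

definition controls :: "real set \<Rightarrow> (real \<Rightarrow> real ^ 'n) set" where
  "controls I = {\<xi> \<in> borel_measurable (lebesgue_on I).
     esssup (lebesgue_on I) (\<lambda>t. ereal (norm (\<xi> t))) \<le> 1}"

text \<open>Absolute continuity on a compact interval. A \<^const>\<open>division_of\<close> its own union is an arbitrary
  finite family of nonoverlapping compact intervals.\<close>

definition abs_continuous_on_interval ::
    "real \<Rightarrow> real \<Rightarrow> (real \<Rightarrow> 'a::real_normed_vector) \<Rightarrow> bool" where
  "abs_continuous_on_interval a b x \<longleftrightarrow>
     (\<forall>\<epsilon>>0. \<exists>\<delta>>0. \<forall>D. D division_of \<Union>D \<and> \<Union>D \<subseteq> {a..b} \<and> (\<Sum>k\<in>D. Sup k - Inf k) < \<delta> \<longrightarrow>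
        (\<Sum>k\<in>D. norm (x (Sup k) - x (Inf k))) < \<epsilon>)"

definition locally_abs_continuous_on :: "real set \<Rightarrow> (real \<Rightarrow> 'a::real_normed_vector) \<Rightarrow> bool" where
  "locally_abs_continuous_on I x \<longleftrightarrow>
     (\<forall>a b. a \<le> b \<and> {a..b} \<subseteq> I \<longrightarrow> abs_continuous_on_interval a b x)"

definition caratheodory_solution ::
    "real set \<Rightarrow> (real \<Rightarrow> 'a::real_normed_vector \<Rightarrow> 'a) \<Rightarrow> (real \<Rightarrow> 'a) \<Rightarrow> bool" where
  "caratheodory_solution I g x \<longleftrightarrow>
     locally_abs_continuous_on I x \<and>
     (AE t in lebesgue_on I. (x has_vector_derivative g t (x t)) (at t within I))"

definition is_trajectory ::
    "(real \<Rightarrow> real ^ 'n \<Rightarrow> real ^ 'n) \<Rightarrow> real \<Rightarrow> real set \<Rightarrow> real \<Rightarrow> real ^ 'n \<Rightarrow>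
     (real \<Rightarrow> real ^ 'n) \<Rightarrow> (real \<Rightarrow> real ^ 'n) \<Rightarrow> bool" where
  "is_trajectory f \<rho> I t0 x0 \<xi> x \<longleftrightarrow>
     caratheodory_solution I (\<lambda>t y. f t y + \<rho> *\<^sub>R \<xi> t) x \<and> x t0 = x0"

text \<open>The value \<open>x(t, t0, x0, \<xi>)\<close> of the solution on \<open>I\<close>. The definite description is over the value
  at \<open>t \<in> I\<close> because the solution, as a function on all of \<open>\<real>\<close>, is only determined on \<open>I\<close>.\<close>

definition trajectory ::
    "(real \<Rightarrow> real ^ 'n \<Rightarrow> real ^ 'n) \<Rightarrow> real \<Rightarrow> real set \<Rightarrow> real \<Rightarrow> real ^ 'n \<Rightarrow>
     (real \<Rightarrow> real ^ 'n) \<Rightarrow> real \<Rightarrow> real ^ 'n" where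
  "trajectory f \<rho> I t0 x0 \<xi> t = (THE y. \<exists>x. is_trajectory f \<rho> I t0 x0 \<xi> x \<and> x t = y)"

definition globally_solvable :: "(real \<Rightarrow> real ^ 'n \<Rightarrow> real ^ 'n) \<Rightarrow> real \<Rightarrow> bool" where
  "globally_solvable f \<rho> \<longleftrightarrow>
     (\<forall>t0 x0. \<forall>\<xi>\<in>controls UNIV. \<exists>x. is_trajectory f \<rho> UNIV t0 x0 \<xi> x)"

definition reach ::
    "(real \<Rightarrow> real ^ 'n \<Rightarrow> real ^ 'n) \<Rightarrow> real \<Rightarrow> real \<Rightarrow> real \<Rightarrow> real ^ 'n \<Rightarrow> (real ^ 'n) set" where
  "reach f \<rho> t t0 x0 = {trajectory f \<rho> UNIV t0 x0 \<xi> t | \<xi>. \<xi> \<in> controls UNIV}"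

definition invariant_set ::
    "(real \<Rightarrow> real ^ 'n \<Rightarrow> real ^ 'n) \<Rightarrow> real \<Rightarrow> (real \<Rightarrow> (real ^ 'n) set) \<Rightarrow> bool" where
  "invariant_set f \<rho> M \<longleftrightarrow>
     (\<forall>t. compact (M t) \<and> M t \<noteq> {}) \<and>
     (\<forall>t0 t. t0 < t \<longrightarrow> (\<Union>x\<in>M t0. reach f \<rho> t t0 x) = M t)"

definition running_cost :: "(real \<Rightarrow> (real ^ 'n) set) \<Rightarrow> real \<Rightarrow> real ^ 'n \<Rightarrow> real" where
  "running_cost M t x = (INF p\<in>frontier (M t). (norm (x - p))\<^sup>2)"

text \<open>The integrand is nonnegative, so the cost is the Lebesgue integral with values in \<open>[0, \<infinity>]\<close>.
  Unlike \<^const>\<open>lebesgue_integral\<close>, it does not collapse to 0 on nonintegrable integrands.\<close>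

definition cost ::
    "(real \<Rightarrow> real ^ 'n \<Rightarrow> real ^ 'n) \<Rightarrow> real \<Rightarrow> (real \<Rightarrow> (real ^ 'n) set) \<Rightarrow>
     real \<Rightarrow> real ^ 'n \<Rightarrow> (real \<Rightarrow> real ^ 'n) \<Rightarrow> real \<Rightarrow> real \<Rightarrow> ennreal" where
  "cost f \<rho> M t0 x0 \<xi> \<tau>1 \<tau>2 =
     (\<integral>\<^sup>+ t. ennreal (running_cost M t (trajectory f \<rho> {\<tau>1..\<tau>2} t0 x0 \<xi> t)) \<partial>lebesgue_on {\<tau>1..\<tau>2})"

definition extremal_field ::
    "(real \<Rightarrow> real ^ 'n \<Rightarrow> real ^ 'n) \<Rightarrow> real \<Rightarrow> real \<Rightarrow> (real ^ 'n) \<times> (real ^ 'n) \<Rightarrow>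
     (real ^ 'n) \<times> (real ^ 'n)" where
  "extremal_field f \<rho> t = (\<lambda>(x, u).
     let w = transpose (jacobian (f t) (at x)) *v u
     in (f t x + \<rho> *\<^sub>R u, - w + (u \<bullet> w) *\<^sub>R u))"

end

theory Submission
  imports Defs
begin

text \<open>The first claim holds because the running cost vanishes on the boundary. For the second, the end
  point \<open>x\<^sup>*(\<tau>2)\<close> lies on the boundary of \<open>M \<tau>2\<close>, hence not in the interior of the set reachable from
  \<open>x\<^sup>*(\<tau>1)\<close>. If the convex set of end points of the linearised control system were a neighbourhood of 0,
  Sussmann's open mapping theorem (a form of Brouwer's) would put \<open>x\<^sup>*(\<tau>2)\<close> in that interior; so a
  nonzero \<open>q\<close> separates. The solution \<open>p\<close> of the adjoint equation \<open>p' = - A\<^sup>T p\<close>, \<open>A(t) = D\<^sub>x f(t, x\<^sup>*(t))\<close>,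
  with \<open>p(\<tau>2) = q\<close> then never vanishes and \<open>\<xi>\<^sup>*\<close> maximises \<open>\<langle>p, \<xi>\<rangle>\<close> pointwise, that is \<open>\<xi>\<^sup>* = p / |p|\<close>, which solves the
  equation for \<open>u\<close>.\<close>

section \<open>Null sets and divisions of intervals\<close>

text \<open>Because \<open>f\<close> is merely measurable in \<open>t\<close>, derivatives exist
  only almost everywhere, and an increment can be recovered from such a derivative only for
  absolutely continuous functions. Every comparison below rests on that fundamental theorem,
  obtained with gauge integrals. The variational equation is never solved: for an adjoint solution
  \<open>p\<close>, the derivative of \<open>p t \<bullet> (y t - x t)\<close> contains no term
  linear in \<open>y - x\<close>, since the two Jacobian contributions cancel. What remains is
  \<rho> times the pairing of \<open>p\<close> with the change of control, plus a Taylor remainder.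
  Letting \<open>p\<close> end in each unit vector yields the end point coordinate by coordinate. As
  the unit ball is convex, finitely many controls can be averaged with small weights, so no needle
  variations occur. The weights are not differentiable at 0, and the end-point map is known to be
  differentiable only there; hence an open mapping theorem that asks for continuity and a derivative
  at a single point. Strict convexity of the ball makes the pointwise maximiser unique.\<close>

lemma AE_lebesgue_on_iff_negligible:
  fixes S :: "'a::euclidean_space set"
  assumes "S \<in> sets lebesgue"
  shows "(AE t in lebesgue_on S. P t) \<longleftrightarrow> (\<exists>N. negligible N \<and> (\<forall>t\<in>S - N. P t))"
proof -
  have "(AE t in lebesgue_on S. P t) \<longleftrightarrow> (AE t in lebesgue. t \<in> S \<longrightarrow> P t)"
    using assms by (simp add: AE_restrict_space_iff)
  also have "\<dots> \<longleftrightarrow> (\<exists>N. negligible N \<and> (\<forall>t\<in>S - N. P t))"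
    unfolding eventually_ae_filter_negligible by blast
  finally show ?thesis .
qed

lemmas AE_interval_iff_negligible =
  AE_lebesgue_on_iff_negligible[OF lmeasurable_interval(1)[THEN fmeasurableD], simplified]

lemma AE_lebesgueE:
  assumes "AE t in lebesgue. P t"
  obtains N where "negligible N" "\<And>t. t \<notin> N \<Longrightarrow> P t"
  using assms unfolding eventually_ae_filter_negligible by blast

lemma AE_lebesgue_imp_on:
  assumes "AE t in lebesgue. P t"
  shows "AE t in lebesgue_on {a..b::real}. P t"
  using assms unfolding eventually_ae_filter_negligible AE_interval_iff_negligible by blast

lemma AE_subinterval:
  assumes "AE t in lebesgue_on {a..b::real}. P t" "a \<le> c" "d \<le> b"
  shows "AE t in lebesgue_on {c..d}. P t"
  using assms unfolding AE_interval_iff_negligible by fastforce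

lemma division_of_interval_elem:
  assumes "D division_of \<Union>D" "\<Union>D \<subseteq> {a..b::real}" "k \<in> D"
  shows "k = {Inf k..Sup k}" "Inf k \<le> Sup k" "Inf k \<in> {a..b}" "Sup k \<in> {a..b}"
proof -
  obtain u v where k: "k = {u..v}" and "k \<noteq> {}"
    using assms by (metis box_real(2) division_ofD(3,4))
  moreover have "k \<subseteq> {a..b}" using assms by blast
  ultimately show "k = {Inf k..Sup k}" "Inf k \<le> Sup k" "Inf k \<in> {a..b}" "Sup k \<in> {a..b}"
    by auto
qed

lemma has_integral_Union_division:
  fixes m :: "real \<Rightarrow> 'a::banach"
  assumes "D division_of \<Union>D" "\<Union>D \<subseteq> {a..b}" "m integrable_on {a..b}"
  shows "(m has_integral (\<Sum>k\<in>D. integral {Inf k..Sup k} m)) (\<Union>D)"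
proof (rule has_integral_combine_division[OF assms(1)])
  fix k assume k: "k \<in> D"
  note e = division_of_interval_elem[OF assms(1,2) k]
  have "m integrable_on {Inf k..Sup k}"
    using e(3,4) by (intro integrable_on_subinterval[OF assms(3)]) (simp del: subset_iff)
  then show "(m has_integral integral {Inf k..Sup k} m) k"
    using e(1) by (metis integrable_integral)
qed

text \<open>The total length is the integral of the constant 1 over the union, and this integral
  grows with the domain. It is applied to an open set \<open>T\<close> of small measure around a
  null set.\<close>

lemma sum_lengths_division_le_measure:
  assumes "D division_of \<Union>D" "\<Union>D \<subseteq> {a..b::real}" "\<Union>D \<subseteq> T" "T \<in> lmeasurable"
  shows "(\<Sum>k\<in>D. Sup k - Inf k) \<le> measure lebesgue T"
proof -
  have "((\<lambda>x. 1::real) has_integral (\<Sum>k\<in>D. integral {Inf k..Sup k} (\<lambda>x. 1::real))) (\<Union>D)"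
    by (rule has_integral_Union_division[OF assms(1,2)]) auto
  moreover have "(\<Sum>k\<in>D. integral {Inf k..Sup k} (\<lambda>x. 1::real)) = (\<Sum>k\<in>D. Sup k - Inf k)"
    using division_of_interval_elem(2)[OF assms(1,2)] by (intro sum.cong) auto
  moreover have "((\<lambda>x. 1::real) has_integral measure lebesgue T) T"
    using assms(4) lmeasurable_iff_has_integral by (simp add: has_integral_iff lmeasure_integral lmeasurable_iff_integrable_on)
  ultimately show ?thesis
    using has_integral_subset_le[OF assms(3)] by fastforce
qed

section \<open>Absolutely continuous functions\<close>

lemma abs_continuous_on_intervalE:
  assumes "abs_continuous_on_interval a b x" "0 < \<epsilon>"
  obtains \<delta> where "\<delta> > 0" "\<And>D. D division_of \<Union>D \<Longrightarrow> \<Union>D \<subseteq> {a..b} \<Longrightarrow>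
    (\<Sum>k\<in>D. Sup k - Inf k) < \<delta> \<Longrightarrow> (\<Sum>k\<in>D. norm (x (Sup k) - x (Inf k))) < \<epsilon>"
proof -
  obtain \<delta> where "\<delta> > 0" and d: "\<forall>D. D division_of \<Union>D \<and> \<Union>D \<subseteq> {a..b} \<and>
      (\<Sum>k\<in>D. Sup k - Inf k) < \<delta> \<longrightarrow> (\<Sum>k\<in>D. norm (x (Sup k) - x (Inf k))) < \<epsilon>"
    using assms(1)[unfolded abs_continuous_on_interval_def, rule_format, OF assms(2)] by (elim exE conjE) (rule that)
  show ?thesis by (rule that[OF \<open>\<delta> > 0\<close>]) (use d in simp)
qed

lemma abs_continuous_on_subinterval:
  assumes "abs_continuous_on_interval a b x" "a \<le> c" "d \<le> b"
  shows "abs_continuous_on_interval c d x"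
proof -
  have "{c..d} \<subseteq> {a..b}" using assms by auto
  then show ?thesis
    using assms(1) unfolding abs_continuous_on_interval_def
    by (meson order_trans)
qed

text \<open>Absolute continuity only sees increments, so an increment bound transfers it. Taking the
  bound from two functions at once covers products, differences, pairs and linear combinations; the
  same function twice gives Lipschitz images.\<close>

lemma abs_continuous_on_interval_dominated:
  assumes x: "abs_continuous_on_interval a b x" and y: "abs_continuous_on_interval a b y"
    and le: "\<And>u v. u \<in> {a..b} \<Longrightarrow> v \<in> {a..b} \<Longrightarrow>
      norm (z v - z u) \<le> L * (norm (x v - x u) + norm (y v - y u))"
  shows "abs_continuous_on_interval a b z"
  unfolding abs_continuous_on_interval_def
proof (intro allI impI)
  fix \<epsilon> :: real assume "0 < \<epsilon>"
  \<comment> \<open>\<open>L\<close> may be zero or negative, whereas the tolerance is divided by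
    the constant.\<close>
  define M where "M = \<bar>L\<bar> + 1"
  have M: "0 < M" "L \<le> M" by (auto simp: M_def)
  then have "0 < \<epsilon> / (2 * M)" using \<open>0 < \<epsilon>\<close> by simp
  note pos = this
  obtain d1 where "d1 > 0"
    and d1: "\<And>D. D division_of \<Union>D \<Longrightarrow> \<Union>D \<subseteq> {a..b} \<Longrightarrow> (\<Sum>k\<in>D. Sup k - Inf k) < d1 \<Longrightarrow>
        (\<Sum>k\<in>D. norm (x (Sup k) - x (Inf k))) < \<epsilon> / (2 * M)"
    by (rule abs_continuous_on_intervalE[OF x pos], rule that)
  obtain d2 where "d2 > 0" and d2: "\<And>D. D division_of \<Union>D \<Longrightarrow> \<Union>D \<subseteq> {a..b} \<Longrightarrow> (\<Sum>k\<in>D. Sup k - Inf k) < d2 \<Longrightarrow>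
        (\<Sum>k\<in>D. norm (y (Sup k) - y (Inf k))) < \<epsilon> / (2 * M)"
    by (rule abs_continuous_on_intervalE[OF y pos], rule that)
  note d = \<open>d1 > 0\<close> \<open>d2 > 0\<close>
  show "\<exists>\<delta>>0. \<forall>D. D division_of \<Union>D \<and> \<Union>D \<subseteq> {a..b} \<and> (\<Sum>k\<in>D. Sup k - Inf k) < \<delta> \<longrightarrow>
        (\<Sum>k\<in>D. norm (z (Sup k) - z (Inf k))) < \<epsilon>"
  proof (intro exI[of _ "min d1 d2"] conjI allI impI, goal_cases)
    case 1 show ?case using d by simp
  next
    case (2 D)
    then have D: "D division_of \<Union>D" "\<Union>D \<subseteq> {a..b}" and len: "(\<Sum>k\<in>D. Sup k - Inf k) < min d1 d2"
      by blast+
    have "(\<Sum>k\<in>D. norm (z (Sup k) - z (Inf k)))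
       \<le> (\<Sum>k\<in>D. M * (norm (x (Sup k) - x (Inf k)) + norm (y (Sup k) - y (Inf k))))"
    proof (rule sum_mono)
      fix k assume "k \<in> D"
      then have "norm (z (Sup k) - z (Inf k)) \<le> L * (norm (x (Sup k) - x (Inf k)) + norm (y (Sup k) - y (Inf k)))"
        by (intro le division_of_interval_elem(3,4)[OF D])
      also have "\<dots> \<le> M * (norm (x (Sup k) - x (Inf k)) + norm (y (Sup k) - y (Inf k)))"
        using M by (intro mult_right_mono) auto
      finally show "norm (z (Sup k) - z (Inf k)) \<le> \<dots>" .
    qed
    also have "\<dots> = M * ((\<Sum>k\<in>D. norm (x (Sup k) - x (Inf k))) + (\<Sum>k\<in>D. norm (y (Sup k) - y (Inf k))))"
      by (simp only: sum_distrib_left sum.distrib distrib_left)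
    also have "\<dots> < M * (\<epsilon> / (2 * M) + \<epsilon> / (2 * M))"
      using M len by (intro mult_strict_left_mono add_strict_mono d1 d2 D) simp_all
    also have "\<dots> = \<epsilon>" using M by (simp add: field_simps)
    finally show ?case .
  qed
qed

lemma abs_continuous_on_interval_imp_continuous_on:
  assumes "abs_continuous_on_interval a b x"
  shows "continuous_on {a..b} x"
  unfolding continuous_on_iff
proof (intro ballI allI impI)
  fix t \<epsilon> :: real assume t: "t \<in> {a..b}" and "0 < \<epsilon>"
  obtain d where "d > 0"
    and d: "\<And>D. D division_of \<Union>D \<Longrightarrow> \<Union>D \<subseteq> {a..b} \<Longrightarrow> (\<Sum>k\<in>D. Sup k - Inf k) < d \<Longrightarrow>
        (\<Sum>k\<in>D. norm (x (Sup k) - x (Inf k))) < \<epsilon>"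
    by (rule abs_continuous_on_intervalE[OF assms \<open>0 < \<epsilon>\<close>]) (rule that)
  have *: "norm (x v - x u) < \<epsilon>" if "u \<in> {a..b}" "v \<in> {a..b}" "u \<le> v" "v - u < d" for u v
  proof -
    have "{{u..v}} division_of \<Union>{{u..v}}"
      using that division_of_self[of u v] by simp
    from d[OF this] show ?thesis using that by auto
  qed
  have "dist (x s) (x t) < \<epsilon>" if "s \<in> {a..b}" "dist s t < d" for s
    using *[of s t] *[of t s] t that by (cases "s \<le> t") (auto simp: dist_norm norm_minus_commute)
  then show "\<exists>d>0. \<forall>s\<in>{a..b}. dist s t < d \<longrightarrow> dist (x s) (x t) < \<epsilon>"
    using \<open>d > 0\<close> by blast
qed

text \<open>On the tags in the exceptional null set the Riemann sum is zero and absolute continuity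
  controls the increments; on the others the straddle estimate applies.\<close>

theorem abs_continuous_has_integral:
  fixes x :: "real \<Rightarrow> 'a::banach"
  assumes x: "abs_continuous_on_interval a b x" and "a \<le> b"
    and D: "AE t in lebesgue_on {a..b}. (x has_vector_derivative g t) (at t within {a..b})"
  shows "(g has_integral (x b - x a)) {a..b}"
proof (cases "a = b")
  case True
  then show ?thesis using has_integral_refl(2)[of g a] by simp
next
  case False
  with \<open>a \<le> b\<close> have ab: "a < b" by simp
  obtain N where N: "negligible N"
    and DN: "\<And>t. t \<in> {a..b} - N \<Longrightarrow> (x has_vector_derivative g t) (at t within {a..b})"
    using D unfolding AE_interval_iff_negligible by blast
  define g' where "g' t = (if t \<in> N then 0 else g t)" for t
  have "(g' has_integral (x b - x a)) (cbox a b)"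
    unfolding box_real has_integral_factor_content_real
  proof (intro allI impI)
    fix e :: real assume "0 < e"
    \<comment> \<open>Half of the admissible error \<open>e * (b - a)\<close> is reserved for the
      tags in \<open>N\<close>, half for all other tags.\<close>
    then have "0 < e * (b - a) / 2" using ab by simp
    then obtain d where "d > 0"
      and d: "\<And>D. D division_of \<Union>D \<Longrightarrow> \<Union>D \<subseteq> {a..b} \<Longrightarrow> (\<Sum>k\<in>D. Sup k - Inf k) < d \<Longrightarrow>
        (\<Sum>k\<in>D. norm (x (Sup k) - x (Inf k))) < e * (b - a) / 2"
      by (rule abs_continuous_on_intervalE[OF x]) (rule that)
    \<comment> \<open>An open set of measure below \<open>d\<close> around \<open>N\<close>: a gauge
      that stays inside \<open>T\<close> at the tags in \<open>N\<close> keeps the total length of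
      their intervals below \<open>d\<close>.\<close>
    obtain T where T: "open T" "N \<subseteq> T" "T \<in> lmeasurable" "measure lebesgue T < d"
    proof -
      obtain T where T: "open T" "N \<subseteq> T" "T - N \<in> lmeasurable" "emeasure lebesgue (T - N) < ennreal d"
        using sets_lebesgue_outer_open[OF negligible_imp_sets[OF N] \<open>d > 0\<close>] by metis
      have "T = (T - N) \<union> N" using T by blast
      moreover have "N \<in> lmeasurable" using N by (rule negligible_imp_measurable)
      ultimately have Tm: "T \<in> lmeasurable" using T by (metis fmeasurable.Un)
      have "measure lebesgue T = measure lebesgue (T - N)"
        using N T Tm by (metis fmeasurableD measure_Diff_null_set negligible_iff_null_sets)
      also have "\<dots> < d" using T \<open>d > 0\<close> by (simp add: emeasure_eq_measure2 ennreal_less_iff)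
      finally show ?thesis using that T Tm by blast
    qed
    have "\<exists>G. open G \<and> t \<in> G \<and> (t \<in> N \<longrightarrow> G \<subseteq> T) \<and> (t \<in> {a..b} - N \<longrightarrow>
        (\<forall>s\<in>{a..b} \<inter> G. norm (x s - x t - (s - t) *\<^sub>R g t) \<le> e / 2 * \<bar>s - t\<bar>))" for t
    proof (cases "t \<in> {a..b} - N")
      case True
      from DN[OF this] have "(x has_derivative (\<lambda>h. h *\<^sub>R g t)) (at t within {a..b})"
        by (simp add: has_vector_derivative_def)
      then obtain r where r: "r > 0"
        "\<And>s. s \<in> {a..b} \<Longrightarrow> norm (s - t) < r \<Longrightarrow> norm (x s - x t - (s - t) *\<^sub>R g t) \<le> e / 2 * norm (s - t)"
        unfolding has_derivative_within_alt using \<open>0 < e\<close> by (meson half_gt_zero)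
      show ?thesis
        using r True by (intro exI[of _ "ball t r"]) (auto simp: dist_norm norm_minus_commute)
    next
      case False
      show ?thesis
        by (rule exI[of _ "if t \<in> N then T else UNIV"]) (use False T in auto)
    qed
    then obtain \<gamma> where \<gamma>: "\<And>t. open (\<gamma> t)" "\<And>t. t \<in> \<gamma> t" "\<And>t. t \<in> N \<Longrightarrow> \<gamma> t \<subseteq> T"
       "\<And>t s. t \<in> {a..b} - N \<Longrightarrow> s \<in> {a..b} \<inter> \<gamma> t \<Longrightarrow> norm (x s - x t - (s - t) *\<^sub>R g t) \<le> e / 2 * \<bar>s - t\<bar>"
      by metis
    show "\<exists>\<gamma>. gauge \<gamma> \<and> (\<forall>p. p tagged_division_of {a..b} \<and> \<gamma> fine p \<longrightarrow>
        norm ((\<Sum>(t,k)\<in>p. measure lborel k *\<^sub>R g' t) - (x b - x a)) \<le> e * measure lborel {a..b})"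
    proof (intro exI[of _ \<gamma>] conjI allI impI)
      show "gauge \<gamma>" using \<gamma> by (simp add: gauge_def)
    next
      fix p assume "p tagged_division_of {a..b} \<and> \<gamma> fine p"
      then have p: "p tagged_division_of {a..b}" and fine: "\<gamma> fine p" by auto
      note pD = tagged_division_ofD[OF p]
      define pN where "pN = {q\<in>p. fst q \<in> N}"
      \<comment> \<open>The empty set needs a value because the sum over tagged pairs is later
        reindexed by intervals, where degenerate boxes, empty ones included, must contribute
        0.\<close>
      define inc where "inc = (\<lambda>k. if k = {} then 0 else x (Sup k) - x (Inf k))"
      have fin: "finite p" "finite pN" using pD(1) by (auto simp: pN_def)
      have K: "k = {Inf k..Sup k}" "Inf k \<le> t" "t \<le> Sup k" "Inf k \<in> {a..b}" "Sup k \<in> {a..b}"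
          "measure lborel k = Sup k - Inf k" "Inf k \<in> \<gamma> t" "Sup k \<in> \<gamma> t" if tk: "(t, k) \<in> p" for t k
      proof -
        obtain u v where k: "k = {u..v}" using pD(4)[OF tk] by auto
        have t: "t \<in> {u..v}" using pD(2)[OF tk] k by simp
        then have uv: "u \<le> v" by simp
        show "k = {Inf k..Sup k}" "Inf k \<le> t" "t \<le> Sup k" "Inf k \<in> {a..b}" "Sup k \<in> {a..b}"
          "measure lborel k = Sup k - Inf k"
          using t uv k pD(3)[OF tk] by auto
        have "k \<subseteq> \<gamma> t" using fine tk by (auto simp: fine_def)
        then show "Inf k \<in> \<gamma> t" "Sup k \<in> \<gamma> t" using k uv by auto
      qed
      have "(\<Sum>(t,k)\<in>p. measure lborel k *\<^sub>R g' t) - (x b - x a) = (\<Sum>(t,k)\<in>p. measure lborel k *\<^sub>R g' t - inc k)"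
      proof -
        have "(\<Sum>(t,k)\<in>p. x (Sup k) - x (Inf k)) = (\<Sum>(t,k)\<in>p. inc k)"
          by (intro sum.cong) (auto simp: inc_def dest: pD(2))
        then show ?thesis
          unfolding additive_tagged_division_1[OF \<open>a \<le> b\<close> p, symmetric]
          by (simp add: sum_subtractf[symmetric] split_def)
      qed
      also have "norm \<dots> \<le> (\<Sum>(t,k)\<in>p. norm (measure lborel k *\<^sub>R g' t - inc k))"
        by (rule order_trans[OF norm_sum]) (simp add: split_def)
      also have "\<dots> = (\<Sum>(t,k)\<in>pN. norm (measure lborel k *\<^sub>R g' t - inc k)) + (\<Sum>(t,k)\<in>p - pN. norm (measure lborel k *\<^sub>R g' t - inc k))"
        using fin by (metis (no_types, lifting) add.commute pN_def mem_Collect_eq subsetI sum.subset_diff)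
      also have "(\<Sum>(t,k)\<in>pN. norm (measure lborel k *\<^sub>R g' t - inc k)) = (\<Sum>(t,k)\<in>pN. norm (inc k))"
        by (intro sum.cong) (auto simp: pN_def g'_def)
      \<comment> \<open>Two tagged pairs can share an interval only if it has empty interior, and
        then \<open>inc\<close> is 0 on it, so the tags may be forgotten.\<close>
      also have "\<dots> = (\<Sum>k\<in>snd ` pN. norm (inc k))"
      proof (rule sum.over_tagged_division_lemma)
        have "pN tagged_partial_division_of {a..b}"
          using p unfolding tagged_division_of_def
          by (auto simp: pN_def intro: tagged_partial_division_subset)
        then show "pN tagged_division_of \<Union>(snd ` pN)"
          by (rule tagged_partial_division_of_Union_self)
        fix u v :: real assume "box u v = {}"
        then show "norm (inc (cbox u v)) = 0"
          by (cases "u = v") (auto simp: inc_def)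
      qed
      also have "\<dots> \<le> e * (b - a) / 2"
      proof -
        have div: "snd ` pN division_of \<Union>(snd ` pN)"
        proof -
          have "pN tagged_partial_division_of {a..b}"
            using p unfolding tagged_division_of_def
            by (auto simp: pN_def intro: tagged_partial_division_subset)
          then show ?thesis
            using tagged_partial_division_of_Union_self division_of_tagged_division by blast
        qed
        have sub: "\<Union>(snd ` pN) \<subseteq> {a..b}" using pD(3) by (force simp: pN_def)
        have subT: "\<Union>(snd ` pN) \<subseteq> T"
        proof -
          have "k \<subseteq> T" if "(t, k) \<in> p" "t \<in> N" for t k
            using fine that \<gamma>(3)[OF that(2)] by (fastforce simp: fine_def)
          then show ?thesis by (fastforce simp: pN_def)
        qed
        have "(\<Sum>k\<in>snd ` pN. Sup k - Inf k) < d"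
          using sum_lengths_division_le_measure[OF div sub subT T(3)] T(4) by simp
        from d[OF div sub this] have "(\<Sum>k\<in>snd ` pN. norm (x (Sup k) - x (Inf k))) < e * (b - a) / 2" .
        moreover have "(\<Sum>k\<in>snd ` pN. norm (inc k)) = (\<Sum>k\<in>snd ` pN. norm (x (Sup k) - x (Inf k)))"
          by (intro sum.cong) (auto simp: inc_def pN_def dest: pD(2))
        ultimately show ?thesis by simp
      qed
      also have "(\<Sum>(t,k)\<in>p - pN. norm (measure lborel k *\<^sub>R g' t - inc k)) \<le> (\<Sum>(t,k)\<in>p - pN. e / 2 * measure lborel k)"
      proof (rule sum_mono, clarify)
        fix t k assume tk: "(t, k) \<in> p" "(t, k) \<notin> pN"
        then have t: "t \<in> {a..b} - N" using pD(2,3)[OF tk(1)] by (auto simp: pN_def)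
        note k = K[OF tk(1)]
        have 1: "norm (x (Sup k) - x t - (Sup k - t) *\<^sub>R g t) \<le> e / 2 * (Sup k - t)"
          using \<gamma>(4)[OF t, of "Sup k"] k by auto
        have 2: "norm (x (Inf k) - x t - (Inf k - t) *\<^sub>R g t) \<le> e / 2 * (t - Inf k)"
          using \<gamma>(4)[OF t, of "Inf k"] k by auto
        have "measure lborel k *\<^sub>R g' t - inc k = (x (Inf k) - x t - (Inf k - t) *\<^sub>R g t) - (x (Sup k) - x t - (Sup k - t) *\<^sub>R g t)"
          unfolding k(6) using t pD(2)[OF tk(1)] by (auto simp: g'_def inc_def algebra_simps)
        also have "norm \<dots> \<le> e / 2 * (t - Inf k) + e / 2 * (Sup k - t)"
          using 1 2 by (meson add_mono norm_triangle_ineq4 order_trans)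
        also have "\<dots> = e / 2 * measure lborel k" unfolding k(6) by (simp add: field_simps)
        finally show "norm (measure lborel k *\<^sub>R g' t - inc k) \<le> e / 2 * measure lborel k" .
      qed
      also have "\<dots> \<le> (\<Sum>(t,k)\<in>p. e / 2 * measure lborel k)"
        using fin \<open>0 < e\<close> by (intro sum_mono2) auto
      also have "\<dots> = e / 2 * (\<Sum>(t,k)\<in>p. measure lborel k)"
        by (simp add: sum_distrib_left split_def)
      also have "(\<Sum>(t,k)\<in>p. measure lborel k) = b - a"
        using additive_content_tagged_division[of p a b] p ab by simp
      finally show "norm ((\<Sum>(t,k)\<in>p. measure lborel k *\<^sub>R g' t) - (x b - x a)) \<le> e * measure lborel {a..b}"
        using ab by (simp add: field_simps)
    qed
  qed
  then have "(g' has_integral (x b - x a)) {a..b}" by simp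
  then show ?thesis
    by (rule has_integral_spike[OF N, rotated]) (auto simp: g'_def)
qed

section \<open>Indefinite integrals: absolute continuity and differentiation\<close>

lemma integral_diff_eq:
  fixes g :: "real \<Rightarrow> 'a::banach"
  assumes "g integrable_on {a..b}" "u \<in> {a..b}" "v \<in> {a..b}" "u \<le> v"
  shows "integral {a..v} g - integral {a..u} g = integral {u..v} g"
proof -
  have "g integrable_on {a..v}"
    using assms by (intro integrable_on_subinterval[OF assms(1)]) auto
  from Henstock_Kurzweil_Integration.integral_combine[OF _ assms(4) this] assms show ?thesis
    by (simp add: algebra_simps)
qed

text \<open>Split \<open>norm (g t)\<close> at height \<open>n\<close>. The part above
  \<open>n\<close> has integral below \<epsilon>/2 by dominated convergence, whatever the intervals;
  the part below contributes at most \<open>n\<close> times their total length.\<close>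

theorem abs_continuous_integral:
  fixes g :: "real \<Rightarrow> 'a::euclidean_space"
  assumes g: "g absolutely_integrable_on {a..b}"
  shows "abs_continuous_on_interval a b (\<lambda>t. integral {a..t} g)"
  unfolding abs_continuous_on_interval_def
proof (intro allI impI)
  fix \<epsilon> :: real assume "0 < \<epsilon>"
  define m where "m t = norm (g t)" for t
  define mn where "mn n t = min (m t) (real n)" for n t
  have gi: "g integrable_on {a..b}" and mi: "m integrable_on {a..b}"
    using g by (auto simp: absolutely_integrable_on_def m_def[abs_def])
  have ma: "m absolutely_integrable_on {a..b}"
    using mi by (intro nonnegative_absolutely_integrable_1) (auto simp: m_def)
  have mni: "mn n integrable_on {a..b}" for n
    unfolding mn_def
    by (intro set_lebesgue_integral_eq_integral(1) absolutely_integrable_min_1 ma) auto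
  have "(\<lambda>n. integral {a..b} (mn n)) \<longlonglongrightarrow> integral {a..b} m"
  proof (rule dominated_convergence(2)[OF mni mi])
    fix t assume "t \<in> {a..b}"
    have "eventually (\<lambda>n. mn n t = m t) sequentially"
    proof -
      obtain n0 where "m t \<le> real n0" using real_arch_simple by blast
      then have "\<forall>n\<ge>n0. mn n t = m t" by (auto simp: mn_def min_def)
      then show ?thesis unfolding eventually_sequentially by blast
    qed
    then show "(\<lambda>n. mn n t) \<longlonglongrightarrow> m t" by (rule tendsto_eventually)
  qed (auto simp: mn_def m_def)
  then have "eventually (\<lambda>n. dist (integral {a..b} (mn n)) (integral {a..b} m) < \<epsilon> / 2) sequentially"
    using \<open>0 < \<epsilon>\<close> by (intro tendstoD) auto
  then obtain n where "dist (integral {a..b} (mn n)) (integral {a..b} m) < \<epsilon> / 2"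
    using eventually_happens'[OF sequentially_bot] by blast
  then have small: "integral {a..b} (\<lambda>t. m t - mn n t) < \<epsilon> / 2"
    unfolding integral_diff[OF mi mni] dist_real_def by linarith
  \<comment> \<open>Chosen so that \<open>real n * \<delta> \<le> \<epsilon> / 2\<close>; the added
    1 covers \<open>n = 0\<close>.\<close>
  define \<delta> where "\<delta> = \<epsilon> / (2 * (real n + 1))"
  have "\<delta> > 0" using \<open>0 < \<epsilon>\<close> by (simp add: \<delta>_def)
  have n\<delta>: "real n * \<delta> \<le> \<epsilon> / 2"
  proof -
    have "real n * \<delta> \<le> (real n + 1) * \<delta>" using \<open>\<delta> > 0\<close> by simp
    also have "\<dots> = \<epsilon> / 2" by (simp add: \<delta>_def field_simps)
    finally show ?thesis .
  qed
  show "\<exists>\<delta>>0. \<forall>D. D division_of \<Union>D \<and> \<Union>D \<subseteq> {a..b} \<and> (\<Sum>k\<in>D. Sup k - Inf k) < \<delta> \<longrightarrow>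
        (\<Sum>k\<in>D. norm (integral {a..Sup k} g - integral {a..Inf k} g)) < \<epsilon>"
  proof (intro exI[of _ \<delta>] conjI allI impI, goal_cases)
    case 1 show ?case by (rule \<open>\<delta> > 0\<close>)
  next
    case (2 D)
    then have D: "D division_of \<Union>D" "\<Union>D \<subseteq> {a..b}" and len: "(\<Sum>k\<in>D. Sup k - Inf k) < \<delta>"
      by blast+
    have di: "(\<lambda>t. m t - mn n t) integrable_on {a..b}"
      by (intro integrable_diff mi mni)
    have "(\<Sum>k\<in>D. norm (integral {a..Sup k} g - integral {a..Inf k} g))
        \<le> (\<Sum>k\<in>D. integral {Inf k..Sup k} (\<lambda>t. m t - mn n t) + real n * (Sup k - Inf k))"
    proof (rule sum_mono)
      fix k assume k: "k \<in> D"
      note e = division_of_interval_elem(2-4)[OF D k]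
      have sub: "{Inf k..Sup k} \<subseteq> {a..b}" using e by simp
      have i: "g integrable_on {Inf k..Sup k}" "m integrable_on {Inf k..Sup k}"
          "mn n integrable_on {Inf k..Sup k}" "(\<lambda>t. m t - mn n t) integrable_on {Inf k..Sup k}"
        using gi mi mni di by (auto intro: integrable_on_subinterval[OF _ sub])
      have "norm (integral {a..Sup k} g - integral {a..Inf k} g) = norm (integral {Inf k..Sup k} g)"
        using integral_diff_eq[OF gi e(2,3,1)] by simp
      also have "\<dots> \<le> integral {Inf k..Sup k} m"
        by (intro integral_norm_bound_integral i) (simp add: m_def)
      also have "\<dots> \<le> integral {Inf k..Sup k} (\<lambda>t. (m t - mn n t) + real n)"
        by (intro integral_le i integrable_add integrable_const_ivl) (simp add: mn_def)
      also have "\<dots> = integral {Inf k..Sup k} (\<lambda>t. m t - mn n t) + real n * (Sup k - Inf k)"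
        using e by (subst integral_add) (auto intro: i)
      finally show "norm (integral {a..Sup k} g - integral {a..Inf k} g) \<le> \<dots>" .
    qed
    also have "\<dots> = (\<Sum>k\<in>D. integral {Inf k..Sup k} (\<lambda>t. m t - mn n t)) + real n * (\<Sum>k\<in>D. Sup k - Inf k)"
      by (simp only: sum.distrib sum_distrib_left)
    also have "(\<Sum>k\<in>D. integral {Inf k..Sup k} (\<lambda>t. m t - mn n t)) \<le> integral {a..b} (\<lambda>t. m t - mn n t)"
      by (rule has_integral_subset_le[OF D(2) has_integral_Union_division[OF D di] integrable_integral[OF di]])
        (simp add: mn_def)
    also have "integral {a..b} (\<lambda>t. m t - mn n t) + real n * (\<Sum>k\<in>D. Sup k - Inf k) < \<epsilon> / 2 + \<epsilon> / 2"
    proof (rule add_less_le_mono[OF small])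
      have "real n * (\<Sum>k\<in>D. Sup k - Inf k) \<le> real n * \<delta>" using len by (intro mult_left_mono) auto
      then show "real n * (\<Sum>k\<in>D. Sup k - Inf k) \<le> \<epsilon> / 2" using n\<delta> by simp
    qed
    finally show ?case by simp
  qed
qed

text \<open>Lebesgue differentiation over boxes with the point as lower corner, hence one-sided.
  Multiplying by \<open>h\<close> gives the form in which the remainder of a derivative is
  estimated.\<close>

lemma integral_right_derivative_negligible:
  fixes f :: "real \<Rightarrow> 'a::euclidean_space"
  assumes "\<And>a b. f integrable_on {a..b}"
  obtains N where "negligible N"
    "\<And>x e. x \<notin> N \<Longrightarrow> 0 < e \<Longrightarrow>
      \<exists>d>0. \<forall>h. 0 < h \<and> h < d \<longrightarrow> norm (integral {x..x + h} f - h *\<^sub>R f x) \<le> e * h"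
proof -
  obtain N where N: "negligible N"
    "\<And>x e. x \<notin> N \<Longrightarrow> 0 < e \<Longrightarrow>
      \<exists>d>0. \<forall>h. 0 < h \<and> h < d \<longrightarrow> norm (integral {x..x + h} f /\<^sub>R h - f x) < e"
    using integrable_ccontinuous_explicit[of f] assms by auto
  have "norm (integral {x..x + h} f - h *\<^sub>R f x) \<le> e * h"
    if "0 < h" "norm (integral {x..x + h} f /\<^sub>R h - f x) < e" for x h e
  proof -
    have "integral {x..x + h} f - h *\<^sub>R f x = h *\<^sub>R (integral {x..x + h} f /\<^sub>R h - f x)"
      using that by (simp add: algebra_simps)
    then have "norm (integral {x..x + h} f - h *\<^sub>R f x) = h * norm (integral {x..x + h} f /\<^sub>R h - f x)"
      using that by simp
    then show ?thesis using that by (simp add: mult.commute)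
  qed
  then show ?thesis using N by (intro that[OF N(1)]) meson
qed

text \<open>The left derivative is the right derivative of the reflected function, so the
  exceptional set is the union of one null set and the mirror image of another. Extension by 0 makes
  \<open>f\<close> integrable over every interval, as the differentiation theorem asks.\<close>

theorem AE_has_vector_derivative_integral:
  fixes g :: "real \<Rightarrow> 'a::euclidean_space"
  assumes "g integrable_on {a..b}"
  shows "AE t in lebesgue_on {a..b}.
    ((\<lambda>t. integral {a..t} g) has_vector_derivative g t) (at t within {a..b})"
proof -
  define f where "f t = (if t \<in> {a..b} then g t else 0)" for t
  have fi: "f integrable_on {c..d}" for c d
  proof -
    have "f integrable_on UNIV" unfolding f_def[abs_def] using assms by (subst integrable_restrict_UNIV)
    then show ?thesis by (metis box_real(2) integrable_on_subcbox top_greatest)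
  qed
  have fri: "(\<lambda>t. f (- t)) integrable_on {c..d}" for c d
    using fi[of "-d" "-c"] Henstock_Kurzweil_Integration.integrable_reflect_real[where f=f and a="-d" and b="-c"] by simp
  obtain N1 where N1: "negligible N1"
    "\<And>x e. x \<notin> N1 \<Longrightarrow> 0 < e \<Longrightarrow>
      \<exists>d>0. \<forall>h. 0 < h \<and> h < d \<longrightarrow> norm (integral {x..x + h} f - h *\<^sub>R f x) \<le> e * h"
    using integral_right_derivative_negligible[of f] fi by blast
  obtain N2 where N2: "negligible N2"
    "\<And>x e. x \<notin> N2 \<Longrightarrow> 0 < e \<Longrightarrow>
      \<exists>d>0. \<forall>h. 0 < h \<and> h < d \<longrightarrow> norm (integral {x..x + h} (\<lambda>t. f (- t)) - h *\<^sub>R f (- x)) \<le> e * h"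
    using integral_right_derivative_negligible[of "\<lambda>t. f (- t)"] fri by blast
  have "((\<lambda>t. integral {a..t} g) has_vector_derivative g t) (at t within {a..b})"
    if t: "t \<in> {a..b} - (N1 \<union> uminus ` N2)" for t
    unfolding has_vector_derivative_def has_derivative_within_alt
  proof (intro conjI allI impI)
    show "bounded_linear (\<lambda>h. h *\<^sub>R g t)" by (rule bounded_linear_scaleR_left)
    fix e :: real assume "0 < e"
    have "t \<notin> N1" "- t \<notin> N2" using t by force+
    then obtain d1 d2 where "d1 > 0" "d2 > 0"
      and d1: "\<And>h. 0 < h \<Longrightarrow> h < d1 \<Longrightarrow> norm (integral {t..t + h} f - h *\<^sub>R f t) \<le> e * h"
      and d2: "\<And>h. 0 < h \<Longrightarrow> h < d2 \<Longrightarrow> norm (integral {- t..- t + h} (\<lambda>s. f (- s)) - h *\<^sub>R f t) \<le> e * h"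
      using N1(2)[of t e] N2(2)[of "- t" e] \<open>0 < e\<close> by fastforce
    have ft: "f t = g t" using t by (simp add: f_def)
    have eq: "integral {u..v} f = integral {u..v} g" if "u \<in> {a..b}" "v \<in> {a..b}" for u v
      using that by (intro integral_cong) (auto simp: f_def)
    show "\<exists>d>0. \<forall>y\<in>{a..b}. norm (y - t) < d \<longrightarrow>
        norm (integral {a..y} g - integral {a..t} g - (y - t) *\<^sub>R g t) \<le> e * norm (y - t)"
    proof (intro exI[of _ "min d1 d2"] conjI ballI impI)
      fix y assume y: "y \<in> {a..b}" "norm (y - t) < min d1 d2"
      consider "y = t" | "t < y" | "y < t" by linarith
      then show "norm (integral {a..y} g - integral {a..t} g - (y - t) *\<^sub>R g t) \<le> e * norm (y - t)"
      proof cases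
        case 2
        with integral_diff_eq[OF assms, of t y] y t eq[of t y] d1[of "y - t"] ft show ?thesis by simp
      next
        case 3
        have "integral {- t..- y} (\<lambda>s. f (- s)) = integral {y..t} g"
          using Henstock_Kurzweil_Integration.integral_reflect_real[where f=f and b=t and a=y] eq[of y t] y t by simp
        then have "norm (integral {y..t} g - (t - y) *\<^sub>R g t) \<le> e * (t - y)"
          using d2[of "t - y"] 3 y ft by simp
        moreover have "integral {a..y} g - integral {a..t} g - (y - t) *\<^sub>R g t
            = - (integral {y..t} g - (t - y) *\<^sub>R g t)"
          using integral_diff_eq[OF assms, of y t] 3 y t by (simp add: algebra_simps)
        ultimately show ?thesis using 3 by (simp add: norm_minus_commute)
      qed simp
    qed (use \<open>d1 > 0\<close> \<open>d2 > 0\<close> in simp)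
  qed
  moreover have "negligible (N1 \<union> uminus ` N2)"
    using N1(1) N2(1) by (intro negligible_Un negligible_differentiable_image_negligible) auto
  ultimately show ?thesis unfolding AE_interval_iff_negligible by blast
qed

section \<open>Calculus of absolutely continuous functions\<close>

lemma abs_continuous_bounded:
  assumes "abs_continuous_on_interval a b x"
  obtains K where "K > 0" "\<And>t. t \<in> {a..b} \<Longrightarrow> norm (x t) \<le> K"
proof -
  have "bounded (x ` {a..b})"
    by (intro compact_imp_bounded compact_continuous_image
        abs_continuous_on_interval_imp_continuous_on[OF assms] compact_Icc)
  then show ?thesis using that unfolding bounded_pos by auto
qed

lemma abs_continuous_bilinear:
  assumes h: "bounded_bilinear h"
    and x: "abs_continuous_on_interval a b x" and y: "abs_continuous_on_interval a b y"
  shows "abs_continuous_on_interval a b (\<lambda>t. h (x t) (y t))"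
proof -
  interpret bounded_bilinear h by (rule h)
  obtain Kx where Kx: "Kx > 0" "\<And>t. t \<in> {a..b} \<Longrightarrow> norm (x t) \<le> Kx"
    by (rule abs_continuous_bounded[OF x]) (rule that)
  obtain Ky where Ky: "Ky > 0" "\<And>t. t \<in> {a..b} \<Longrightarrow> norm (y t) \<le> Ky"
    by (rule abs_continuous_bounded[OF y]) (rule that)
  obtain K where K: "0 < K" "\<And>u v. norm (h u v) \<le> norm u * norm v * K"
    using pos_bounded by blast
  show ?thesis
  proof (rule abs_continuous_on_interval_dominated[OF x y, where L = "(Kx + Ky) * K"])
    fix u v assume uv: "u \<in> {a..b}" "v \<in> {a..b}"
    have "h (x v) (y v) - h (x u) (y u) = h (x v - x u) (y v) + h (x u) (y v - y u)"
      by (simp add: diff_left diff_right)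
    also have "norm \<dots> \<le> norm (x v - x u) * norm (y v) * K + norm (x u) * norm (y v - y u) * K"
      using K(2)[of "x v - x u" "y v"] K(2)[of "x u" "y v - y u"]
      by (intro order_trans[OF norm_triangle_ineq] add_mono)
    also have "\<dots> \<le> norm (x v - x u) * (Kx + Ky) * K + (Kx + Ky) * norm (y v - y u) * K"
      using Kx(1) Ky(1) Kx(2)[OF uv(1)] Ky(2)[OF uv(2)] K(1)
      by (intro add_mono mult_right_mono mult_left_mono) auto
    also have "\<dots> = (Kx + Ky) * K * (norm (x v - x u) + norm (y v - y u))"
      by (simp add: algebra_simps)
    finally show "norm (h (x v) (y v) - h (x u) (y u)) \<le> \<dots>" .
  qed
qed

lemmas abs_continuous_mult = abs_continuous_bilinear[OF bounded_bilinear_mult]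
  and abs_continuous_inner = abs_continuous_bilinear[OF bounded_bilinear_inner]

lemma abs_continuous_diff:
  assumes "abs_continuous_on_interval a b x" "abs_continuous_on_interval a b y"
  shows "abs_continuous_on_interval a b (\<lambda>t. x t - y t)"
proof (rule abs_continuous_on_interval_dominated[OF assms, where L = 1])
  fix u v
  have "norm ((x v - x u) - (y v - y u)) \<le> norm (x v - x u) + norm (y v - y u)"
    by (rule norm_triangle_ineq4)
  then show "norm (x v - y v - (x u - y u)) \<le> 1 * (norm (x v - x u) + norm (y v - y u))"
    by (simp add: algebra_simps)
qed

lemma abs_continuous_Pair:
  assumes "abs_continuous_on_interval a b x" "abs_continuous_on_interval a b y"
  shows "abs_continuous_on_interval a b (\<lambda>t. (x t, y t))"
  by (rule abs_continuous_on_interval_dominated[OF assms, where L = 1])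
    (simp add: norm_Pair sqrt_sum_squares_le_sum)

lemma abs_continuous_lipschitz_compose:
  assumes x: "abs_continuous_on_interval a b x"
    and le: "\<And>u v. u \<in> {a..b} \<Longrightarrow> v \<in> {a..b} \<Longrightarrow> norm (z v - z u) \<le> L * norm (x v - x u)"
  shows "abs_continuous_on_interval a b z"
  by (rule abs_continuous_on_interval_dominated[OF x x, where L = "L / 2"]) (use le in auto)

text \<open>A bounded range turns \<open>exp\<close> into a Lipschitz function; the constant comes
  from the tangent inequality 1 + x \<le> exp x.\<close>

lemma abs_continuous_exp:
  fixes x :: "real \<Rightarrow> real"
  assumes x: "abs_continuous_on_interval a b x"
  shows "abs_continuous_on_interval a b (\<lambda>t. exp (x t))"
proof -
  obtain K where K: "K > 0" "\<And>t. t \<in> {a..b} \<Longrightarrow> norm (x t) \<le> K"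
    by (rule abs_continuous_bounded[OF x]) (rule that)
  have *: "exp p - exp q \<le> exp K * \<bar>p - q\<bar>" if "p \<le> K" for p q :: real
  proof -
    have "exp p - exp q = exp p * (1 - exp (q - p))" by (simp add: exp_diff algebra_simps)
    also have "\<dots> \<le> exp p * (p - q)"
      using exp_ge_add_one_self[of "q - p"] by (intro mult_left_mono) (simp_all add: algebra_simps)
    also have "\<dots> \<le> exp p * \<bar>p - q\<bar>" by (intro mult_left_mono) auto
    also have "\<dots> \<le> exp K * \<bar>p - q\<bar>" using that by (intro mult_right_mono) auto
    finally show ?thesis .
  qed
  show ?thesis
  proof (rule abs_continuous_lipschitz_compose[OF x])
    fix u v assume "u \<in> {a..b}" "v \<in> {a..b}"
    then have "x u \<le> K" "x v \<le> K" using K(2) by (auto simp: abs_le_iff)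
    then show "norm (exp (x v) - exp (x u)) \<le> exp K * norm (x v - x u)"
      using *[of "x v" "x u"] *[of "x u" "x v"] by (auto simp: abs_le_iff abs_minus_commute)
  qed
qed

text \<open>A mean value inequality with almost everywhere derivatives: integrate the bound.
  Continuity in place of absolute continuity would not do, as the Cantor function shows.\<close>

lemma abs_continuous_le:
  fixes \<phi> :: "real \<Rightarrow> real"
  assumes "abs_continuous_on_interval a b \<phi>" "a \<le> b"
    and D: "AE t in lebesgue_on {a..b}. \<exists>d\<le>c. (\<phi> has_vector_derivative d) (at t within {a..b})"
  shows "\<phi> b \<le> \<phi> a + c * (b - a)"
proof -
  obtain N where N: "negligible N"
    "\<And>t. t \<in> {a..b} - N \<Longrightarrow> \<exists>d\<le>c. (\<phi> has_vector_derivative d) (at t within {a..b})"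
    using D unfolding AE_interval_iff_negligible by blast
  then obtain d where d: "\<And>t. t \<in> {a..b} - N \<Longrightarrow> d t \<le> c"
    "\<And>t. t \<in> {a..b} - N \<Longrightarrow> (\<phi> has_vector_derivative d t) (at t within {a..b})"
    by metis
  \<comment> \<open>The value \<open>c\<close> on the exceptional set keeps the bound valid at every
    point.\<close>
  define d' where "d' t = (if t \<in> {a..b} - N then d t else c)" for t
  have "AE t in lebesgue_on {a..b}. (\<phi> has_vector_derivative d' t) (at t within {a..b})"
    unfolding AE_interval_iff_negligible using N(1) d(2) by (auto simp: d'_def)
  then have "(d' has_integral (\<phi> b - \<phi> a)) {a..b}"
    by (rule abs_continuous_has_integral[OF assms(1,2)])
  moreover have "((\<lambda>t. c) has_integral (b - a) * c) {a..b}"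
    using has_integral_const_real[of c a b] assms(2) by simp
  ultimately have "\<phi> b - \<phi> a \<le> (b - a) * c"
    by (rule has_integral_le) (use d(1) in \<open>auto simp: d'_def\<close>)
  then show ?thesis by (simp add: algebra_simps)
qed

section \<open>Gronwall estimates\<close>

text \<open>The square \<open>z t \<bullet> z t\<close> is used in place of the norm because it is
  differentiable also where \<open>z\<close> vanishes. The integrating factor takes
  \<open>k = -2\<close> for estimates forward in time and \<open>k = 2\<close> for those backward in
  time.\<close>

lemma abs_continuous_energy:
  fixes z :: "real \<Rightarrow> 'a::euclidean_space"
  assumes z: "abs_continuous_on_interval a b z" and l: "l absolutely_integrable_on {a..b}"
  shows "abs_continuous_on_interval a b (\<lambda>t. exp (k * integral {a..t} l) * (z t \<bullet> z t))"
    and "AE t in lebesgue_on {a..b}. \<forall>d. (z has_vector_derivative d) (at t within {a..b}) \<longrightarrow>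
      ((\<lambda>t. exp (k * integral {a..t} l) * (z t \<bullet> z t)) has_vector_derivative
        exp (k * integral {a..t} l) * (k * l t * (z t \<bullet> z t) + 2 * (z t \<bullet> d))) (at t within {a..b})"
proof -
  have E: "abs_continuous_on_interval a b (\<lambda>t. k * integral {a..t} l)"
    by (rule abs_continuous_lipschitz_compose[OF abs_continuous_integral[OF l], where L = "\<bar>k\<bar>"])
      (simp add: right_diff_distrib[symmetric] abs_mult)
  show "abs_continuous_on_interval a b (\<lambda>t. exp (k * integral {a..t} l) * (z t \<bullet> z t))"
    by (rule abs_continuous_mult[OF abs_continuous_exp[OF E] abs_continuous_inner[OF z z]])
  have "l integrable_on {a..b}" using l by (rule set_lebesgue_integral_eq_integral(1))
  from AE_has_vector_derivative_integral[OF this]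
  show "AE t in lebesgue_on {a..b}. \<forall>d. (z has_vector_derivative d) (at t within {a..b}) \<longrightarrow>
      ((\<lambda>t. exp (k * integral {a..t} l) * (z t \<bullet> z t)) has_vector_derivative
        exp (k * integral {a..t} l) * (k * l t * (z t \<bullet> z t) + 2 * (z t \<bullet> d))) (at t within {a..b})"
  proof (eventually_elim, intro allI impI)
    fix t d
    assume L: "((\<lambda>t. integral {a..t} l) has_vector_derivative l t) (at t within {a..b})"
      and d: "(z has_vector_derivative d) (at t within {a..b})"
    have 1: "((\<lambda>t. exp (k * integral {a..t} l)) has_vector_derivative exp (k * integral {a..t} l) * (k * l t)) (at t within {a..b})"
      using L unfolding has_real_derivative_iff_has_vector_derivative[symmetric]
      by (auto intro!: derivative_eq_intros)
    have 2: "((\<lambda>t. z t \<bullet> z t) has_vector_derivative z t \<bullet> d + d \<bullet> z t) (at t within {a..b})"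
      by (rule bounded_bilinear.has_vector_derivative[OF bounded_bilinear_inner d d])
    show "((\<lambda>t. exp (k * integral {a..t} l) * (z t \<bullet> z t)) has_vector_derivative
        exp (k * integral {a..t} l) * (k * l t * (z t \<bullet> z t) + 2 * (z t \<bullet> d))) (at t within {a..b})"
      using has_vector_derivative_mult[OF 1 2] by (simp add: inner_commute algebra_simps)
  qed
qed

lemma gronwall_forward:
  fixes z :: "real \<Rightarrow> 'a::euclidean_space"
  assumes z: "abs_continuous_on_interval a b z" and "a \<le> b"
    and l: "l absolutely_integrable_on {a..b}" "\<And>t. t \<in> {a..b} \<Longrightarrow> 0 \<le> l t"
    and D: "AE t in lebesgue_on {a..b}. \<exists>d. (z has_vector_derivative d) (at t within {a..b}) \<and>
      norm d \<le> l t * norm (z t) + c"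
  shows "(norm (z b))\<^sup>2 \<le> exp (2 * (integral {a..b} l + (b - a))) * ((norm (z a))\<^sup>2 + c\<^sup>2 * (b - a))"
proof -
  \<comment> \<open>The surplus 1 in the exponent absorbs the cross term \<open>2 * c * r\<close>
    through 2 c r \<le> c^2 + r^2, so the forcing enters the estimate only as
    \<open>c\<^sup>2\<close>.\<close>
  define l1 where "l1 t = l t + 1" for t
  have l1: "l1 absolutely_integrable_on {a..b}"
    unfolding l1_def using l(1) by (intro set_integral_add(1)) auto
  define \<Lambda> where "\<Lambda> t = integral {a..t} l1" for t
  define \<phi> where "\<phi> t = exp (-2 * \<Lambda> t) * (z t \<bullet> z t)" for t
  note e = abs_continuous_energy[OF z l1, of "-2", folded \<Lambda>_def, folded \<phi>_def]
  have \<Lambda>0: "0 \<le> \<Lambda> t" if "t \<in> {a..b}" for t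
  proof -
    have "l1 integrable_on {a..t}"
      using that by (intro integrable_on_subinterval[OF set_lebesgue_integral_eq_integral(1)[OF l1]]) auto
    then show ?thesis
      unfolding \<Lambda>_def using l(2) that by (intro integral_nonneg) (auto simp: l1_def add_nonneg_nonneg)
  qed
  have "\<phi> b \<le> \<phi> a + c\<^sup>2 * (b - a)"
  proof (rule abs_continuous_le)
    show "abs_continuous_on_interval a b \<phi>" using e(1) by (simp add: \<phi>_def[abs_def])
    have "AE t in lebesgue_on {a..b}. t \<in> {a..b}"
      using AE_space[of "lebesgue_on {a..b}"] by simp
    with e(2) D show "AE t in lebesgue_on {a..b}. \<exists>d\<le>c\<^sup>2. (\<phi> has_vector_derivative d) (at t within {a..b})"
    proof eventually_elim
      case (elim t)
      then obtain d where d: "(z has_vector_derivative d) (at t within {a..b})"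
          "norm d \<le> l t * norm (z t) + c" by blast
      define r where "r = norm (z t)"
      have r: "z t \<bullet> z t = r * r" "0 \<le> r" by (simp_all add: r_def dot_square_norm power2_eq_square)
      have "z t \<bullet> d \<le> r * (l t * r + c)"
        using norm_cauchy_schwarz[of "z t" d] mult_left_mono[OF d(2), of r] by (simp add: r_def)
      then have "-2 * l1 t * (z t \<bullet> z t) + 2 * (z t \<bullet> d) \<le> -2 * (l t + 1) * (r * r) + 2 * (r * (l t * r + c))"
        by (simp add: r(1) l1_def)
      also have "\<dots> = 2 * c * r - 2 * (r * r)" by (simp add: algebra_simps)
      also have "\<dots> \<le> c\<^sup>2"
        using sum_squares_bound[of c r] zero_le_square[of r] unfolding power2_eq_square by linarith
      finally have 1: "-2 * l1 t * (z t \<bullet> z t) + 2 * (z t \<bullet> d) \<le> c\<^sup>2" .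
      have "exp (-2 * \<Lambda> t) * (-2 * l1 t * (z t \<bullet> z t) + 2 * (z t \<bullet> d)) \<le> exp (-2 * \<Lambda> t) * c\<^sup>2"
        using 1 by (rule mult_left_mono) simp
      \<comment> \<open>Since \<open>\<Lambda>\<close> is nonnegative the weight is at most 1; here
        the sign of \<open>l\<close> enters.\<close>
      also have "\<dots> \<le> 1 * c\<^sup>2"
        using \<Lambda>0 elim by (intro mult_right_mono) auto
      finally show ?case using elim(1) d(1) by (auto simp: \<phi>_def[abs_def])
    qed
  qed (use \<open>a \<le> b\<close> in simp)
  moreover have "\<phi> a = (norm (z a))\<^sup>2" by (simp add: \<phi>_def \<Lambda>_def dot_square_norm)
  moreover have "\<phi> b = exp (-2 * \<Lambda> b) * (norm (z b))\<^sup>2" by (simp add: \<phi>_def dot_square_norm)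
  moreover have "\<Lambda> b = integral {a..b} l + (b - a)"
    unfolding \<Lambda>_def l1_def
    using set_lebesgue_integral_eq_integral(1)[OF l(1)] \<open>a \<le> b\<close> by (subst integral_add) auto
  ultimately have le: "exp (- 2 * \<Lambda> b) * (norm (z b))\<^sup>2 \<le> (norm (z a))\<^sup>2 + c\<^sup>2 * (b - a)"
    and \<Lambda>b: "\<Lambda> b = integral {a..b} l + (b - a)"
    by simp_all
  have "(norm (z b))\<^sup>2 = exp (2 * \<Lambda> b) * (exp (- 2 * \<Lambda> b) * (norm (z b))\<^sup>2)"
    by (simp add: mult.assoc[symmetric] exp_add[symmetric])
  also have "\<dots> \<le> exp (2 * \<Lambda> b) * ((norm (z a))\<^sup>2 + c\<^sup>2 * (b - a))"
    by (rule mult_left_mono[OF le]) simp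
  finally show ?thesis unfolding \<Lambda>b .
qed

text \<open>With the opposite sign in the exponent the weighted square is nondecreasing, so its
  value at \<open>b\<close> bounds the one at \<open>a\<close>. There is no forcing term to absorb,
  and the exponent carries no surplus.\<close>

lemma gronwall_backward:
  fixes z :: "real \<Rightarrow> 'a::euclidean_space"
  assumes z: "abs_continuous_on_interval a b z" and "a \<le> b"
    and l: "l absolutely_integrable_on {a..b}"
    and D: "AE t in lebesgue_on {a..b}. \<exists>d. (z has_vector_derivative d) (at t within {a..b}) \<and>
      norm d \<le> l t * norm (z t)"
  shows "(norm (z a))\<^sup>2 \<le> exp (2 * integral {a..b} l) * (norm (z b))\<^sup>2"
proof -
  define \<Lambda> where "\<Lambda> t = integral {a..t} l" for t
  define \<phi> where "\<phi> t = exp (2 * \<Lambda> t) * (z t \<bullet> z t)" for t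
  note e = abs_continuous_energy[OF z l, of 2, folded \<Lambda>_def, folded \<phi>_def]
  have "- \<phi> b \<le> - \<phi> a + 0 * (b - a)"
  proof (rule abs_continuous_le)
    show "abs_continuous_on_interval a b (\<lambda>t. - \<phi> t)"
      by (rule abs_continuous_lipschitz_compose[OF e(1), where L = 1]) (simp add: \<phi>_def[abs_def])
    from e(2) D show "AE t in lebesgue_on {a..b}. \<exists>d\<le>0. ((\<lambda>t. - \<phi> t) has_vector_derivative d) (at t within {a..b})"
    proof eventually_elim
      case (elim t)
      then obtain d where d: "(z has_vector_derivative d) (at t within {a..b})"
          "norm d \<le> l t * norm (z t)" by blast
      have "\<bar>z t \<bullet> d\<bar> \<le> norm (z t) * (l t * norm (z t))"
        using Cauchy_Schwarz_ineq2[of "z t" d] mult_left_mono[OF d(2), of "norm (z t)"] by simp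
      also have "\<dots> = l t * (z t \<bullet> z t)" by (simp add: dot_square_norm power2_eq_square)
      finally have "0 \<le> 2 * l t * (z t \<bullet> z t) + 2 * (z t \<bullet> d)" by linarith
      then have "- (exp (2 * \<Lambda> t) * (2 * l t * (z t \<bullet> z t) + 2 * (z t \<bullet> d))) \<le> 0" by simp
      moreover have "((\<lambda>t. - \<phi> t) has_vector_derivative - (exp (2 * \<Lambda> t) * (2 * l t * (z t \<bullet> z t) + 2 * (z t \<bullet> d)))) (at t within {a..b})"
        using elim(1) d(1) by (intro has_vector_derivative_minus) (simp add: \<phi>_def[abs_def])
      ultimately show ?case by blast
    qed
  qed (use \<open>a \<le> b\<close> in simp)
  moreover have "\<phi> a = (norm (z a))\<^sup>2" by (simp add: \<phi>_def \<Lambda>_def dot_square_norm)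
  moreover have "\<phi> b = exp (2 * integral {a..b} l) * (norm (z b))\<^sup>2" by (simp add: \<phi>_def \<Lambda>_def dot_square_norm)
  ultimately show ?thesis by simp
qed

lemma AE_vector_derivative_subinterval:
  assumes "AE t in lebesgue_on {a..b}. \<exists>d. (z has_vector_derivative d) (at t within {a..b}) \<and> P t d"
    and "a \<le> c" "d \<le> b"
  shows "AE t in lebesgue_on {c..d}. \<exists>d'. (z has_vector_derivative d') (at t within {c..d}) \<and> P t d'"
  using AE_subinterval[OF assms]
proof eventually_elim
  case (elim t)
  have "{c..d} \<subseteq> {a..b}" using assms by auto
  with elim show ?case by (meson has_vector_derivative_within_subset)
qed

text \<open>Gronwall from \<open>s\<close> in both time directions. Uniqueness of trajectories and
  nonvanishing of the adjoint are both instances.\<close>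

lemma abs_continuous_zero:
  fixes z :: "real \<Rightarrow> 'a::euclidean_space"
  assumes z: "abs_continuous_on_interval a b z"
    and l: "l absolutely_integrable_on {a..b}" "\<And>t. t \<in> {a..b} \<Longrightarrow> 0 \<le> l t"
    and D: "AE t in lebesgue_on {a..b}. \<exists>d. (z has_vector_derivative d) (at t within {a..b}) \<and>
      norm d \<le> l t * norm (z t)"
    and s: "s \<in> {a..b}" "z s = 0" and t: "t \<in> {a..b}"
  shows "z t = 0"
proof (cases "s \<le> t")
  case True
  have "l absolutely_integrable_on {s..t}"
    using s t by (intro absolutely_integrable_on_subinterval[OF l(1)]) auto
  moreover have "AE r in lebesgue_on {s..t}. \<exists>d. (z has_vector_derivative d) (at r within {s..t}) \<and>
      norm d \<le> l r * norm (z r) + 0"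
    unfolding add_0_right by (rule AE_vector_derivative_subinterval[OF D]) (use s t in auto)
  ultimately have "(norm (z t))\<^sup>2 \<le> exp (2 * (integral {s..t} l + (t - s))) * ((norm (z s))\<^sup>2 + 0\<^sup>2 * (t - s))"
    using True s t by (intro gronwall_forward abs_continuous_on_subinterval[OF z] l(2)) auto
  then show ?thesis using s by simp
next
  case False
  have "l absolutely_integrable_on {t..s}"
    using s t by (intro absolutely_integrable_on_subinterval[OF l(1)]) auto
  moreover have "AE r in lebesgue_on {t..s}. \<exists>d. (z has_vector_derivative d) (at r within {t..s}) \<and>
      norm d \<le> l r * norm (z r)"
    by (rule AE_vector_derivative_subinterval[OF D]) (use s t in auto)
  ultimately have "(norm (z t))\<^sup>2 \<le> exp (2 * integral {t..s} l) * (norm (z s))\<^sup>2"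
    using False s t by (intro gronwall_backward abs_continuous_on_subinterval[OF z]) auto
  then show ?thesis using s by simp
qed

section \<open>Linear Caratheodory equations\<close>

text \<open>Contraction in the weighted norm \<open>sup |exp (- W t) p t|\<close> with
  \<open>W t = 2 \<integral>\<^sub>t\<^sup>b m\<close>.\<close>

theorem linear_caratheodory_terminal_value:
  fixes B :: "real \<Rightarrow> 'a::euclidean_space \<Rightarrow> 'a"
  assumes ab: "a \<le> b" and m: "m absolutely_integrable_on {a..b}"
    and m0: "\<And>t. t \<in> {a..b} \<Longrightarrow> 0 \<le> m t"
    and lin: "\<And>t. t \<in> {a..b} \<Longrightarrow> linear (B t)"
    and bd: "\<And>t v. t \<in> {a..b} \<Longrightarrow> norm (B t v) \<le> m t * norm v"
    and meas: "\<And>q. continuous_on {a..b} q \<Longrightarrow> (\<lambda>t. B t (q t)) \<in> borel_measurable (lebesgue_on {a..b})"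
  obtains p where "abs_continuous_on_interval a b p" "p b = p0"
    "AE t in lebesgue_on {a..b}. (p has_vector_derivative B t (p t)) (at t within {a..b})"
proof -
  define \<Lambda> where "\<Lambda> t = integral {a..t} m" for t
  define E where "E t = exp (2 * (\<Lambda> b - \<Lambda> t))" for t
  have E0: "E t > 0" for t by (simp add: E_def)
  have mi: "m integrable_on {a..b}" using m by (rule set_lebesgue_integral_eq_integral(1))
  have \<Lambda>c: "abs_continuous_on_interval a b \<Lambda>"
    unfolding \<Lambda>_def by (rule abs_continuous_integral[OF m])
  have Eac: "abs_continuous_on_interval a b E"
    unfolding E_def
  proof (intro abs_continuous_exp abs_continuous_lipschitz_compose[OF \<Lambda>c, where L = 2])
    fix u v
    have "2 * (\<Lambda> b - \<Lambda> v) - 2 * (\<Lambda> b - \<Lambda> u) = 2 * (\<Lambda> u - \<Lambda> v)" by simp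
    then show "norm (2 * (\<Lambda> b - \<Lambda> v) - 2 * (\<Lambda> b - \<Lambda> u)) \<le> 2 * norm (\<Lambda> v - \<Lambda> u)"
      by (simp only: real_norm_def abs_mult abs_minus_commute)
  qed
  have Ec: "continuous_on {a..b} E"
    using Eac by (rule abs_continuous_on_interval_imp_continuous_on)
  \<comment> \<open>\<open>- E s / 2\<close> is a primitive of \<open>m s * E s\<close>. The factor
    1/2, due to the 2 in the exponent, becomes the contraction constant.\<close>
  have Eint: "((\<lambda>s. m s * E s) has_integral (E t - 1) / 2) {t..b}" if t: "t \<in> {a..b}" for t
  proof -
    have "AE s in lebesgue_on {a..b}. ((\<lambda>s. - E s / 2) has_vector_derivative m s * E s) (at s within {a..b})"
      using AE_has_vector_derivative_integral[OF mi, folded \<Lambda>_def]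
    proof eventually_elim
      case (elim s)
      then show ?case
        unfolding E_def has_real_derivative_iff_has_vector_derivative[symmetric]
        by (auto intro!: derivative_eq_intros)
    qed
    then have "AE s in lebesgue_on {t..b}. ((\<lambda>s. - E s / 2) has_vector_derivative m s * E s) (at s within {a..b})"
      by (rule AE_subinterval) (use t in auto)
    then have "AE s in lebesgue_on {t..b}. ((\<lambda>s. - E s / 2) has_vector_derivative m s * E s) (at s within {t..b})"
      by eventually_elim (rule has_vector_derivative_within_subset, use t in auto)
    moreover have "abs_continuous_on_interval t b (\<lambda>s. - E s / 2)"
    proof -
      have "abs_continuous_on_interval a b (\<lambda>s. - E s / 2)"
        by (rule abs_continuous_lipschitz_compose[OF Eac, where L = 1]) auto
      then show ?thesis by (rule abs_continuous_on_subinterval) (use t in auto)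
    qed
    ultimately have "((\<lambda>s. m s * E s) has_integral (- E b / 2 - (- E t / 2))) {t..b}"
      using t by (intro abs_continuous_has_integral) auto
    moreover have "E b = 1" by (simp add: E_def)
    ultimately show ?thesis by (simp add: diff_divide_distrib)
  qed
  have ai: "(\<lambda>s. B s (q s)) absolutely_integrable_on {a..b}" if q: "continuous_on {a..b} q" for q
  proof -
    have "bounded (q ` {a..b})" by (intro compact_imp_bounded compact_continuous_image q compact_Icc)
    then obtain K where K: "\<And>s. s \<in> {a..b} \<Longrightarrow> norm (q s) \<le> K" unfolding bounded_iff by blast
    show ?thesis
    proof (rule measurable_bounded_by_integrable_imp_absolutely_integrable[OF meas[OF q]])
      show "(\<lambda>s. m s * K) integrable_on {a..b}" using mi by (rule integrable_on_mult_left)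
      fix s assume s: "s \<in> {a..b}"
      show "norm (B s (q s)) \<le> m s * K"
        using bd[OF s, of "q s"] mult_left_mono[OF K[OF s] m0[OF s]] by linarith
    qed simp
  qed
  define J where "J q t = integral {t..b} (\<lambda>s. B s (q s))" for q t
  \<comment> \<open>The unknown is \<open>r = p / E\<close>: the ordinary sup norm of
    \<open>r\<close> is then the weighted norm of \<open>p\<close>, and \<open>F\<close> is the
    integral equation rewritten for \<open>r\<close>.\<close>
  define F where "F r t = (1 / E t) *\<^sub>R (p0 - J (\<lambda>s. E s *\<^sub>R apply_bcontfun r s) t)" for r :: "real \<Rightarrow>\<^sub>C 'a" and t
  have qc: "continuous_on {a..b} (\<lambda>s. E s *\<^sub>R apply_bcontfun r s)" for r :: "real \<Rightarrow>\<^sub>C 'a"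
    by (intro continuous_on_scaleR Ec continuous_on_apply_bcontfun)
  have Fc: "continuous_on (cbox a b) (F r)" for r
    unfolding F_def J_def box_real
    using E0 by (intro continuous_intros Ec indefinite_integral_continuous_1' set_lebesgue_integral_eq_integral(1)[OF ai] qc)
      (auto simp: less_imp_neq[THEN not_sym])
  \<comment> \<open>Composition with \<open>clamp\<close> extends \<open>F r\<close> by its
    end-point values to a bounded continuous function on the line, so that the Banach fixed point
    theorem applies in the complete space of such functions.\<close>
  have "\<exists>g :: real \<Rightarrow>\<^sub>C 'a. \<forall>t. g t = F r (clamp a b t)" for r
    using continuous_on_cbox_bcontfunE[OF Fc[of r]] by metis
  then obtain S :: "(real \<Rightarrow>\<^sub>C 'a) \<Rightarrow> (real \<Rightarrow>\<^sub>C 'a)" where S: "\<And>r t. S r t = F r (clamp a b t)"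
    by metis
  have contr: "dist (F r t) (F r' t) \<le> (1 / 2) * dist r r'" if t: "t \<in> {a..b}" for r r' t
  proof -
    define d where "d = dist r r'"
    have sub: "{t..b} \<subseteq> {a..b}" using t by auto
    note i = integrable_on_subinterval[OF set_lebesgue_integral_eq_integral(1)[OF ai[OF qc]] sub]
    have "F r t - F r' t = (1 / E t) *\<^sub>R (J (\<lambda>s. E s *\<^sub>R r' s) t - J (\<lambda>s. E s *\<^sub>R r s) t)"
      by (simp add: F_def algebra_simps)
    also have "J (\<lambda>s. E s *\<^sub>R r' s) t - J (\<lambda>s. E s *\<^sub>R r s) t
        = integral {t..b} (\<lambda>s. B s (E s *\<^sub>R r' s) - B s (E s *\<^sub>R r s))"
      unfolding J_def by (rule Henstock_Kurzweil_Integration.integral_diff[OF i i, symmetric])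
    finally have 1: "dist (F r t) (F r' t) = (1 / E t) * norm (integral {t..b} (\<lambda>s. B s (E s *\<^sub>R r' s) - B s (E s *\<^sub>R r s)))"
      using E0[of t] by (simp add: dist_norm)
    have "norm (integral {t..b} (\<lambda>s. B s (E s *\<^sub>R r' s) - B s (E s *\<^sub>R r s))) \<le> integral {t..b} (\<lambda>s. (m s * E s) * d)"
    proof (rule integral_norm_bound_integral)
      show "(\<lambda>s. B s (E s *\<^sub>R r' s) - B s (E s *\<^sub>R r s)) integrable_on {t..b}"
        by (intro integrable_diff i)
      show "(\<lambda>s. m s * E s * d) integrable_on {t..b}"
        using Eint[OF t] by (intro integrable_on_mult_left) blast
      fix s assume "s \<in> {t..b}"
      then have s: "s \<in> {a..b}" using sub by blast
      have "B s (E s *\<^sub>R r' s) - B s (E s *\<^sub>R r s) = B s (E s *\<^sub>R (r' s - r s))"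
        using lin[OF s] by (simp add: linear_diff linear_scale algebra_simps)
      also have "norm \<dots> \<le> m s * (E s * norm (r' s - r s))"
        using bd[OF s, of "E s *\<^sub>R (r' s - r s)"] E0[of s] by simp
      also have "\<dots> \<le> m s * (E s * d)"
        using m0[OF s] E0[of s] dist_bounded[of r' s r]
        by (intro mult_left_mono) (auto simp: d_def dist_norm norm_minus_commute)
      finally show "norm (B s (E s *\<^sub>R r' s) - B s (E s *\<^sub>R r s)) \<le> m s * E s * d" by (simp add: mult.assoc)
    qed
    also have "\<dots> = (E t - 1) / 2 * d"
      using integral_unique[OF Eint[OF t]] by simp
    also have "\<dots> \<le> E t * (1 / 2 * d)" by (simp add: d_def field_simps)
    finally show ?thesis unfolding 1 d_def using E0[of t] by (simp add: field_simps)
  qed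
  have "dist (S r) (S r') \<le> 1 / 2 * dist r r'" for r r'
  proof (rule dist_bound)
    fix t
    have "clamp a b t \<in> {a..b}" using clamp_in_interval[of a b t] ab by simp
    then show "dist (S r t) (S r' t) \<le> 1 / 2 * dist r r'" unfolding S by (rule contr)
  qed
  then obtain r where r: "S r = r"
    using banach_fix_type[of "1/2" S] by auto
  define p where "p t = E t *\<^sub>R r t" for t
  have pc: "continuous_on {a..b} p" unfolding p_def by (rule qc)
  define g where "g s = B s (p s)" for s
  have ga: "g absolutely_integrable_on {a..b}" unfolding g_def by (rule ai[OF pc])
  have gi: "g integrable_on {a..b}" using ga by (rule set_lebesgue_integral_eq_integral(1))
  have peq: "p t = p0 - integral {a..b} g + integral {a..t} g" if t: "t \<in> {a..b}" for t
  proof -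
    have "r t = F r t" using S[of r t] r t by (simp add: box_real[symmetric] del: box_real)
    then have "p t = p0 - integral {t..b} g"
      using E0[of t] unfolding p_def F_def J_def g_def by simp
    also have "integral {t..b} g = integral {a..b} g - integral {a..t} g"
      using integral_diff_eq[OF gi, of t b] t by simp
    finally show ?thesis by simp
  qed
  show ?thesis
  proof
    show "abs_continuous_on_interval a b p"
      by (rule abs_continuous_lipschitz_compose[OF abs_continuous_integral[OF ga], where L = 1])
        (simp add: peq)
    show "p b = p0" using peq[of b] ab by simp
    show "AE t in lebesgue_on {a..b}. (p has_vector_derivative B t (p t)) (at t within {a..b})"
    proof -
      have "AE t in lebesgue_on {a..b}. t \<in> {a..b}"
        using AE_space[of "lebesgue_on {a..b}"] by simp
      with AE_has_vector_derivative_integral[OF gi] show ?thesis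
      proof eventually_elim
        case (elim t)
        have "((\<lambda>t. p0 - integral {a..b} g + integral {a..t} g) has_vector_derivative g t) (at t within {a..b})"
          using has_vector_derivative_add[OF has_vector_derivative_const elim(1)] by simp
        then show ?case
          unfolding g_def[symmetric]
          by (rule has_vector_derivative_transform[OF elim(2), rotated]) (simp add: peq)
      qed
    qed
  qed
qed

section \<open>Measurability of superpositions\<close>

lemma borel_measurable_LIMSEQ_AE:
  fixes g :: "'a::euclidean_space \<Rightarrow> 'b::euclidean_space"
  assumes u: "\<And>i. u i \<in> borel_measurable lebesgue"
    and lim: "AE t in lebesgue. (\<lambda>i. u i t) \<longlonglongrightarrow> g t"
  shows "g \<in> borel_measurable lebesgue"
proof -
  obtain N where N: "negligible N" "\<And>t. t \<notin> N \<Longrightarrow> (\<lambda>i. u i t) \<longlonglongrightarrow> g t"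
    using lim unfolding eventually_ae_filter_negligible by blast
  have AEN: "AE t in lebesgue. t \<notin> N"
    unfolding eventually_ae_filter_negligible using N(1) by blast
  define u' where "u' i t = (if t \<in> N then 0 else u i t)" for i t
  define g' where "g' t = (if t \<in> N then 0 else g t)" for t
  have "u' i \<in> borel_measurable lebesgue" for i
    by (rule borel_measurable_AE[OF u[of i]]) (use AEN in \<open>eventually_elim, simp add: u'_def\<close>)
  then have "g' \<in> borel_measurable lebesgue"
    by (rule borel_measurable_LIMSEQ_metric) (use N(2) in \<open>auto simp: u'_def g'_def\<close>)
  then show ?thesis
    by (rule borel_measurable_AE) (use AEN in \<open>eventually_elim, simp add: g'_def\<close>)
qed

text \<open>For a simple function in place of \<open>y\<close> only finitely many measurable
  functions are glued together; continuity of \<open>f t\<close> carries measurability to the limit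
  for almost every \<open>t\<close>.\<close>

lemma borel_measurable_superposition:
  fixes f :: "real \<Rightarrow> 'a::euclidean_space \<Rightarrow> 'b::euclidean_space"
  assumes f: "\<And>x. (\<lambda>t. f t x) \<in> borel_measurable lebesgue"
    and cont: "AE t in lebesgue. continuous_on UNIV (f t)"
    and y: "y \<in> borel_measurable lebesgue"
  shows "(\<lambda>t. f t (y t)) \<in> borel_measurable lebesgue"
proof -
  obtain F where F: "\<And>i. simple_function lebesgue (F i)" "\<And>t. (\<lambda>i. F i t) \<longlonglongrightarrow> y t"
    using borel_measurable_implies_sequence_metric[OF y, of 0] by auto
  have "(\<lambda>t. f t (F i t)) \<in> borel_measurable lebesgue" for i
  proof (rule measurable_compose_countable'[where f = "\<lambda>x t. f t x" and g = "F i" and I = "range (F i)"])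
    have fin: "finite (range (F i))" using simple_functionD(1)[OF F(1)[of i]] by simp
    then show "countable (range (F i))" by (rule countable_finite)
    show "F i \<in> measurable lebesgue (count_space (range (F i)))"
      unfolding measurable_count_space_eq2[OF fin]
      using simple_functionD(2)[OF F(1)[of i]] by auto
  qed (rule f)
  moreover from cont have "AE t in lebesgue. (\<lambda>i. f t (F i t)) \<longlonglongrightarrow> f t (y t)"
  proof eventually_elim
    case (elim t)
    show ?case
      using continuous_on_tendsto_compose[OF elim F(2)[of t]] by simp
  qed
  ultimately show ?thesis by (rule borel_measurable_LIMSEQ_AE)
qed

lemma transpose_mult_inner:
  fixes A :: "real ^ 'n ^ 'm"
  shows "(transpose A *v v) \<bullet> w = v \<bullet> (A *v w)"
  by (simp add: dot_lmul_matrix transpose_matrix_vector)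

lemma inner_difference_quotient_tendsto:
  fixes g :: "'a::real_normed_vector \<Rightarrow> 'b::real_inner"
  assumes "(g has_derivative D) (at x)"
  shows "(\<lambda>n. (v \<bullet> g (x + inverse (real (Suc n)) *\<^sub>R e) - v \<bullet> g x) / inverse (real (Suc n)))
    \<longlonglongrightarrow> v \<bullet> D e"
proof -
  define \<phi> where "\<phi> s = v \<bullet> g (x + s *\<^sub>R e)" for s
  have "((\<lambda>s. x + s *\<^sub>R e) has_derivative (\<lambda>h. h *\<^sub>R e)) (at 0)"
    by (auto intro!: derivative_eq_intros)
  from has_derivative_compose[OF this, of g D] assms
  have "((\<lambda>s. g (x + s *\<^sub>R e)) has_derivative (\<lambda>h. D (h *\<^sub>R e))) (at 0)" by simp
  from has_derivative_inner_right[OF this, of v]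
  have "(\<phi> has_derivative (\<lambda>h. v \<bullet> D (h *\<^sub>R e))) (at 0)" by (simp add: \<phi>_def[abs_def])
  moreover have "(\<lambda>h. v \<bullet> D (h *\<^sub>R e)) = (\<lambda>h. h * (v \<bullet> D e))"
    using linear_scale[OF has_derivative_linear[OF assms]] by simp
  ultimately have "(\<phi> has_real_derivative v \<bullet> D e) (at 0)"
    by (simp add: has_field_derivative_def mult_commute_abs)
  then have "((\<lambda>h. (\<phi> (0 + h) - \<phi> 0) / h) \<longlongrightarrow> v \<bullet> D e) (at 0)"
    by (simp only: DERIV_def)
  moreover have "filterlim (\<lambda>n. inverse (real (Suc n))) (at 0) sequentially"
    unfolding filterlim_at using LIMSEQ_inverse_real_of_nat by auto
  ultimately have "(\<lambda>n. (\<phi> (0 + inverse (real (Suc n))) - \<phi> 0) / inverse (real (Suc n))) \<longlonglongrightarrow> v \<bullet> D e"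
    by (rule filterlim_compose)
  then show ?thesis by (simp only: \<phi>_def add_0 scaleR_zero_left add_0_right)
qed

text \<open>Tested against a vector \<open>e\<close>, the transposed Jacobian applied to
  \<open>q\<close> is the directional derivative of \<open>f t\<close> along \<open>e\<close> paired
  with \<open>q\<close>, a limit of difference quotients whose terms are measurable
  superpositions.\<close>

lemma borel_measurable_jacobian_transpose:
  fixes f :: "real \<Rightarrow> real ^ 'n \<Rightarrow> real ^ 'n"
  assumes f: "admissible_rhs f"
    and x: "x \<in> borel_measurable lebesgue" and q: "q \<in> borel_measurable lebesgue"
  shows "(\<lambda>t. transpose (jacobian (f t) (at (x t))) *v q t) \<in> borel_measurable lebesgue"
proof (rule borel_measurable_euclidean_space[THEN iffD2], rule ballI)
  fix e :: "real ^ 'n"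
  have fm: "\<And>y. (\<lambda>t. f t y) \<in> borel_measurable lebesgue"
    and fc: "AE t in lebesgue. continuous_on UNIV (f t)"
    and fd: "AE t in lebesgue. \<forall>x. f t differentiable (at x)"
    using f unfolding admissible_rhs_def caratheodory_function_def by auto
  define Q where "Q n t = (q t \<bullet> f t (x t + inverse (real (Suc n)) *\<^sub>R e) - q t \<bullet> f t (x t)) / inverse (real (Suc n))" for n t
  have 1: "(\<lambda>t. f t (x t + inverse (real (Suc n)) *\<^sub>R e)) \<in> borel_measurable lebesgue" for n
    using x by (intro borel_measurable_superposition[OF fm fc]) auto
  have 2: "(\<lambda>t. f t (x t)) \<in> borel_measurable lebesgue"
    by (rule borel_measurable_superposition[OF fm fc x])
  have "Q n \<in> borel_measurable lebesgue" for n
    unfolding Q_def[abs_def]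
    by (intro borel_measurable_divide borel_measurable_diff borel_measurable_inner q 1 2 borel_measurable_const)
  moreover have "AE t in lebesgue. (\<lambda>n. Q n t) \<longlonglongrightarrow> (transpose (jacobian (f t) (at (x t))) *v q t) \<bullet> e"
    using fd
  proof eventually_elim
    case (elim t)
    then have "(f t has_derivative (\<lambda>h. jacobian (f t) (at (x t)) *v h)) (at (x t))"
      using jacobian_works by blast
    from inner_difference_quotient_tendsto[OF this] show ?case
      unfolding Q_def transpose_mult_inner .
  qed
  ultimately show "(\<lambda>t. (transpose (jacobian (f t) (at (x t))) *v q t) \<bullet> e) \<in> borel_measurable lebesgue"
    by (rule borel_measurable_LIMSEQ_AE)
qed

section \<open>Controls and trajectories\<close>

text \<open>The bounds of the definition are merged into one nonnegative function: the Gronwall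
  estimates consume the Lipschitz bound, the adjoint equation the operator bound, and the expansion
  of the end point needs both at once.\<close>

lemma admissible_rhs_bounds:
  fixes f :: "real \<Rightarrow> real ^ 'n \<Rightarrow> real ^ 'n"
  assumes f: "admissible_rhs f" and K: "compact K"
  obtains l where "\<And>a b. l absolutely_integrable_on {a..b}" "\<And>t. 0 \<le> l t"
    "AE t in lebesgue. \<forall>x\<in>K. \<forall>y\<in>K. norm (f t x - f t y) \<le> l t * norm (x - y)"
    "AE t in lebesgue. \<forall>x\<in>K. \<forall>v. norm (jacobian (f t) (at x) *v v) \<le> l t * norm v"
proof -
  obtain m l where ml: "locally_integrable m" "locally_integrable l"
    and AE: "AE t in lebesgue.
              (\<forall>x\<in>K. norm (f t x) \<le> m t) \<and>
              (\<forall>x\<in>K. \<forall>y\<in>K. norm (f t x - f t y) \<le> l t * norm (x - y)) \<and>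
              (\<forall>x\<in>K. onorm ((*v) (jacobian (f t) (at x))) \<le> m t)"
    using f K unfolding admissible_rhs_def by blast
  define L where "L t = \<bar>m t\<bar> + \<bar>l t\<bar>" for t
  show ?thesis
  proof
    show "L absolutely_integrable_on {a..b}" for a b
      using ml unfolding L_def locally_integrable_def
      by (intro set_integral_add(1)) (auto intro: set_integrable_abs)
    show "0 \<le> L t" for t by (simp add: L_def)
    show "AE t in lebesgue. \<forall>x\<in>K. \<forall>y\<in>K. norm (f t x - f t y) \<le> L t * norm (x - y)"
      using AE
    proof eventually_elim
      case (elim t)
      have "l t * norm (x - y) \<le> L t * norm (x - y)" for x y :: "real ^ 'n"
        by (intro mult_right_mono) (auto simp: L_def)
      then show ?case using elim by (meson order_trans)
    qed
    show "AE t in lebesgue. \<forall>x\<in>K. \<forall>v. norm (jacobian (f t) (at x) *v v) \<le> L t * norm v"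
      using AE
    proof eventually_elim
      case (elim t)
      show ?case
      proof (intro ballI allI)
        fix x v assume "x \<in> K"
        then have o: "onorm ((*v) (jacobian (f t) (at x))) \<le> m t" using elim by blast
        have "norm (jacobian (f t) (at x) *v v) \<le> onorm ((*v) (jacobian (f t) (at x))) * norm v"
          by (rule onorm[OF matrix_vector_mul_bounded_linear])
        also have "\<dots> \<le> L t * norm v"
          using o by (intro mult_right_mono) (auto simp: L_def)
        finally show "norm (jacobian (f t) (at x) *v v) \<le> L t * norm v" .
      qed
    qed
  qed
qed

text \<open>The squared norm is \<open>w \<bullet> (A *v (transpose A *v w))\<close>; Cauchy-Schwarz
  and division by the norm finish.\<close>

lemma norm_transpose_le:
  fixes A :: "real ^ 'n ^ 'm"
  assumes "\<And>v. norm (A *v v) \<le> c * norm v"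
  shows "norm (transpose A *v w) \<le> c * norm w"
proof (cases "transpose A *v w = 0")
  case True
  \<comment> \<open>Testing the hypothesis on a unit vector shows \<open>0 \<le> c\<close>, which
    settles the case where no division is possible.\<close>
  have "0 \<le> c * norm (axis undefined 1 :: real ^ 'n)"
    using assms norm_ge_zero order_trans by blast
  then have "0 \<le> c" by simp
  then show ?thesis using True by simp
next
  case False
  have "(norm (transpose A *v w))\<^sup>2 = w \<bullet> (A *v (transpose A *v w))"
    unfolding power2_norm_eq_inner transpose_mult_inner ..
  also have "\<dots> \<le> norm w * norm (A *v (transpose A *v w))" by (rule norm_cauchy_schwarz)
  also have "\<dots> \<le> norm w * (c * norm (transpose A *v w))" by (intro mult_left_mono assms) auto
  finally show ?thesis using False by (simp add: power2_eq_square mult.assoc mult.left_commute)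
qed

lemma bounded_measurable_in_controls:
  fixes \<eta> :: "real \<Rightarrow> real ^ 'n"
  assumes "\<eta> \<in> borel_measurable lebesgue" "\<And>t. norm (\<eta> t) \<le> 1"
  shows "\<eta> \<in> controls UNIV"
proof -
  have "\<eta> \<in> borel_measurable (lebesgue_on UNIV)" using assms(1) by simp
  moreover from this have "(\<lambda>t. ereal (norm (\<eta> t))) \<in> borel_measurable (lebesgue_on UNIV)"
    by measurable
  ultimately show ?thesis
    unfolding controls_def using assms(2) by (auto intro!: esssup_I AE_I2)
qed

text \<open>Values of norm above 1 occur on a null set and are replaced by 0, as are all values off
  the interval. The result is a control on the whole line, to which global solvability applies, and
  it is bounded at every point.\<close>

lemma controls_representative:
  fixes \<xi> :: "real \<Rightarrow> real ^ 'n"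
  assumes "\<xi> \<in> controls {a..b}"
  obtains \<eta> where "\<eta> \<in> borel_measurable lebesgue" "\<And>t. norm (\<eta> t) \<le> 1"
    "AE t in lebesgue_on {a..b}. \<eta> t = \<xi> t"
proof -
  have meas: "\<xi> \<in> borel_measurable (lebesgue_on {a..b})"
    and le: "esssup (lebesgue_on {a..b}) (\<lambda>t. ereal (norm (\<xi> t))) \<le> 1"
    using assms by (auto simp: controls_def)
  have AE: "AE t in lebesgue_on {a..b}. norm (\<xi> t) \<le> 1"
    using esssup_AE[of "\<lambda>t. ereal (norm (\<xi> t))" "lebesgue_on {a..b}"]
    by eventually_elim (use le in \<open>auto simp: one_ereal_def dest: order_trans\<close>)
  define g where "g v = (if norm v \<le> 1 then v else 0)" for v :: "real ^ 'n"
  have g: "g \<in> borel_measurable borel" unfolding g_def[abs_def] by measurable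
  define \<eta> where "\<eta> t = (if t \<in> {a..b} then g (\<xi> t) else 0)" for t
  have "(\<lambda>t. g (\<xi> t)) \<in> borel_measurable (lebesgue_on {a..b})"
    using measurable_compose[OF meas g] .
  then have "\<eta> \<in> borel_measurable lebesgue"
    unfolding \<eta>_def[abs_def] by (intro borel_measurable_if_I) auto
  moreover have "norm (\<eta> t) \<le> 1" for t by (simp add: \<eta>_def g_def)
  moreover have "AE t in lebesgue_on {a..b}. t \<in> {a..b}"
    using AE_space[of "lebesgue_on {a..b}"] by simp
  with AE have "AE t in lebesgue_on {a..b}. \<eta> t = \<xi> t"
    by eventually_elim (simp add: \<eta>_def g_def)
  ultimately show ?thesis by (rule that)
qed

lemma is_trajectory_on_interval:
  fixes f :: "real \<Rightarrow> real ^ 'n \<Rightarrow> real ^ 'n"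
  assumes x: "is_trajectory f \<rho> I s y \<xi> x" and I: "I \<in> sets lebesgue" "{a..b} \<subseteq> I" and ab: "a \<le> b"
  shows "abs_continuous_on_interval a b x"
    and "AE t in lebesgue_on {a..b}. (x has_vector_derivative f t (x t) + \<rho> *\<^sub>R \<xi> t) (at t within {a..b})"
proof -
  show "abs_continuous_on_interval a b x"
    using x I ab unfolding is_trajectory_def caratheodory_solution_def locally_abs_continuous_on_def by blast
  have "AE t in lebesgue_on I. (x has_vector_derivative f t (x t) + \<rho> *\<^sub>R \<xi> t) (at t within I)"
    using x unfolding is_trajectory_def caratheodory_solution_def by blast
  then obtain N where "negligible N"
    "\<forall>t\<in>I - N. (x has_vector_derivative f t (x t) + \<rho> *\<^sub>R \<xi> t) (at t within I)"
    unfolding AE_lebesgue_on_iff_negligible[OF I(1)] by blast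
  moreover from this(2) have "\<forall>t\<in>{a..b} - N. (x has_vector_derivative f t (x t) + \<rho> *\<^sub>R \<xi> t) (at t within {a..b})"
    using has_vector_derivative_within_subset[OF _ I(2)] I(2) by blast
  ultimately show "AE t in lebesgue_on {a..b}. (x has_vector_derivative f t (x t) + \<rho> *\<^sub>R \<xi> t) (at t within {a..b})"
    unfolding AE_interval_iff_negligible by blast
qed

lemma trajectory_difference_derivative:
  fixes f :: "real \<Rightarrow> real ^ 'n \<Rightarrow> real ^ 'n"
  assumes x: "AE t in lebesgue_on {a..b}. (x has_vector_derivative f t (x t) + \<rho> *\<^sub>R \<xi> t) (at t within {a..b})"
    and y: "AE t in lebesgue_on {a..b}. (y has_vector_derivative f t (y t) + \<rho> *\<^sub>R \<eta> t) (at t within {a..b})"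
    and K: "\<And>t. t \<in> {a..b} \<Longrightarrow> x t \<in> K" "\<And>t. t \<in> {a..b} \<Longrightarrow> y t \<in> K"
    and lip: "AE t in lebesgue. \<forall>x\<in>K. \<forall>y\<in>K. norm (f t x - f t y) \<le> l t * norm (x - y)"
    and c: "AE t in lebesgue_on {a..b}. norm (\<xi> t - \<eta> t) \<le> c" and \<rho>: "0 \<le> \<rho>"
  shows "AE t in lebesgue_on {a..b}. \<exists>d. ((\<lambda>t. x t - y t) has_vector_derivative d) (at t within {a..b}) \<and>
      norm d \<le> l t * norm (x t - y t) + \<rho> * c"
proof -
  have "AE t in lebesgue_on {a..b}. t \<in> {a..b}"
    using AE_space[of "lebesgue_on {a..b}"] by simp
  with x y AE_lebesgue_imp_on[OF lip] c show ?thesis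
  proof eventually_elim
    case (elim t)
    have "norm ((f t (x t) + \<rho> *\<^sub>R \<xi> t) - (f t (y t) + \<rho> *\<^sub>R \<eta> t))
        = norm ((f t (x t) - f t (y t)) + \<rho> *\<^sub>R (\<xi> t - \<eta> t))"
      by (simp add: algebra_simps)
    also have "\<dots> \<le> l t * norm (x t - y t) + \<rho> * c"
    proof (rule order_trans[OF norm_triangle_ineq add_mono])
      show "norm (f t (x t) - f t (y t)) \<le> l t * norm (x t - y t)" using elim K by blast
      show "norm (\<rho> *\<^sub>R (\<xi> t - \<eta> t)) \<le> \<rho> * c" using elim \<rho> by (simp add: mult_left_mono)
    qed
    finally show ?case using has_vector_derivative_diff[OF elim(1,2)] by blast
  qed
qed

text \<open>The difference satisfies a homogeneous linear differential inequality, so one common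
  value suffices, whether earlier or later than \<open>t\<close>. Lipschitz bounds being local, they
  are taken on the compact union of the two images.\<close>

lemma trajectory_unique:
  fixes f :: "real \<Rightarrow> real ^ 'n \<Rightarrow> real ^ 'n"
  assumes f: "admissible_rhs f" and "0 \<le> \<rho>"
    and x: "abs_continuous_on_interval a b x"
      "AE t in lebesgue_on {a..b}. (x has_vector_derivative f t (x t) + \<rho> *\<^sub>R \<xi> t) (at t within {a..b})"
    and y: "abs_continuous_on_interval a b y"
      "AE t in lebesgue_on {a..b}. (y has_vector_derivative f t (y t) + \<rho> *\<^sub>R \<eta> t) (at t within {a..b})"
    and "AE t in lebesgue_on {a..b}. \<xi> t = \<eta> t"
    and s: "s \<in> {a..b}" "x s = y s" and t: "t \<in> {a..b}"
  shows "x t = y t"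
proof -
  define K where "K = x ` {a..b} \<union> y ` {a..b}"
  have K: "compact K"
    unfolding K_def
    by (intro compact_Un compact_continuous_image abs_continuous_on_interval_imp_continuous_on x y compact_Icc)
  obtain l where l: "\<And>a b. l absolutely_integrable_on {a..b}" "\<And>t. 0 \<le> l t"
    "AE t in lebesgue. \<forall>x\<in>K. \<forall>y\<in>K. norm (f t x - f t y) \<le> l t * norm (x - y)"
    by (rule admissible_rhs_bounds[OF f K]) (rule that)
  have "AE t in lebesgue_on {a..b}. norm (\<xi> t - \<eta> t) \<le> 0"
    using assms(7) by eventually_elim simp
  from trajectory_difference_derivative[OF x(2) y(2) _ _ l(3) this \<open>0 \<le> \<rho>\<close>]
  have D: "AE t in lebesgue_on {a..b}. \<exists>d. ((\<lambda>t. x t - y t) has_vector_derivative d) (at t within {a..b}) \<and>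
      norm d \<le> l t * norm (x t - y t)"
    by (simp add: K_def)
  have "x t - y t = 0"
    by (rule abs_continuous_zero[OF abs_continuous_diff[OF x(1) y(1)] l(1,2) D s(1) _ t]) (use s in simp)
  then show ?thesis by simp
qed

text \<open>Evaluates the definite description: a compact interval inside \<open>I\<close>
  containing both times reduces it to uniqueness there. This serves the compact time interval as
  well as the whole line.\<close>

lemma trajectory_eq:
  fixes f :: "real \<Rightarrow> real ^ 'n \<Rightarrow> real ^ 'n"
  assumes f: "admissible_rhs f" and "0 \<le> \<rho>"
    and I: "I \<in> sets lebesgue" "{a..b} \<subseteq> I" "s \<in> {a..b}" "t \<in> {a..b}"
    and x: "is_trajectory f \<rho> I s y \<xi> x"
  shows "trajectory f \<rho> I s y \<xi> t = x t"
  unfolding trajectory_def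
proof (rule the_equality)
  show "\<exists>x'. is_trajectory f \<rho> I s y \<xi> x' \<and> x' t = x t" using x by blast
next
  fix z assume "\<exists>x'. is_trajectory f \<rho> I s y \<xi> x' \<and> x' t = z"
  then obtain x' where x': "is_trajectory f \<rho> I s y \<xi> x'" "x' t = z" by blast
  have ab: "a \<le> b" using I by simp
  note 1 = is_trajectory_on_interval[OF x I(1,2) ab] and 2 = is_trajectory_on_interval[OF x'(1) I(1,2) ab]
  have "x' t = x t"
    by (rule trajectory_unique[OF f \<open>0 \<le> \<rho>\<close> 2 1 _ I(3) _ I(4)]) (use x x' in \<open>auto simp: is_trajectory_def\<close>)
  then show "z = x t" using x' by simp
qed

section \<open>Perturbation of a trajectory\<close>

text \<open>Gronwall with forcing \<open>\<rho> * c\<close> and equal initial values. The factor of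
  \<open>c\<close> involves the whole interval and not \<open>T\<close>, so it can be fixed before
  an exit time is known, while membership in \<open>K\<close> is asked only up to
  \<open>T\<close>.\<close>

lemma trajectory_difference_bound:
  fixes f :: "real \<Rightarrow> real ^ 'n \<Rightarrow> real ^ 'n"
  assumes "0 \<le> \<rho>" "0 \<le> c" and T: "T \<in> {a..b}"
    and l: "\<And>a b. l absolutely_integrable_on {a..b}" "\<And>t. 0 \<le> l t"
    and lip: "AE t in lebesgue. \<forall>x\<in>K. \<forall>y\<in>K. norm (f t x - f t y) \<le> l t * norm (x - y)"
    and x: "abs_continuous_on_interval a b x"
      "AE t in lebesgue_on {a..b}. (x has_vector_derivative f t (x t) + \<rho> *\<^sub>R \<xi> t) (at t within {a..b})"
    and y: "abs_continuous_on_interval a b y"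
      "AE t in lebesgue_on {a..b}. (y has_vector_derivative f t (y t) + \<rho> *\<^sub>R \<eta> t) (at t within {a..b})"
    and K: "\<And>t. t \<in> {a..T} \<Longrightarrow> x t \<in> K" "\<And>t. t \<in> {a..T} \<Longrightarrow> y t \<in> K"
    and c: "AE t in lebesgue_on {a..b}. norm (\<xi> t - \<eta> t) \<le> c"
    and a: "x a = y a"
  shows "norm (x T - y T) \<le> \<rho> * sqrt (exp (2 * (integral {a..b} l + (b - a))) * (b - a)) * c"
proof -
  have sub: "{a..T} \<subseteq> {a..b}" and aT: "a \<le> T" "T \<le> b" using T by auto
  have x': "AE t in lebesgue_on {a..T}. (x has_vector_derivative f t (x t) + \<rho> *\<^sub>R \<xi> t) (at t within {a..T})"
    using AE_subinterval[OF x(2) order_refl aT(2)]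
    by eventually_elim (rule has_vector_derivative_within_subset[OF _ sub])
  have y': "AE t in lebesgue_on {a..T}. (y has_vector_derivative f t (y t) + \<rho> *\<^sub>R \<eta> t) (at t within {a..T})"
    using AE_subinterval[OF y(2) order_refl aT(2)]
    by eventually_elim (rule has_vector_derivative_within_subset[OF _ sub])
  note D = trajectory_difference_derivative[OF x' y' K lip AE_subinterval[OF c order_refl aT(2)] \<open>0 \<le> \<rho>\<close>]
  have ac: "abs_continuous_on_interval a T (\<lambda>t. x t - y t)"
    by (intro abs_continuous_diff abs_continuous_on_subinterval[OF x(1) order_refl aT(2)]
        abs_continuous_on_subinterval[OF y(1) order_refl aT(2)])
  have li: "l integrable_on {a..d}" for d using l(1) by (rule set_lebesgue_integral_eq_integral(1))
  have "(norm (x T - y T))\<^sup>2 \<le> exp (2 * (integral {a..T} l + (T - a))) * ((norm (x a - y a))\<^sup>2 + (\<rho> * c)\<^sup>2 * (T - a))"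
    by (rule gronwall_forward[OF ac aT(1) l D])
  also have "\<dots> = exp (2 * (integral {a..T} l + (T - a))) * ((\<rho> * c)\<^sup>2 * (T - a))" using a by simp
  also have "\<dots> \<le> exp (2 * (integral {a..b} l + (b - a))) * ((\<rho> * c)\<^sup>2 * (b - a))"
  proof (intro mult_mono)
    have "integral {a..T} l \<le> integral {a..b} l"
      by (rule integral_subset_le[OF sub li li]) (use l in auto)
    then show "exp (2 * (integral {a..T} l + (T - a))) \<le> exp (2 * (integral {a..b} l + (b - a)))"
      using aT by simp
  qed (use aT in auto)
  also have "\<dots> = (\<rho> * sqrt (exp (2 * (integral {a..b} l + (b - a))) * (b - a)) * c)\<^sup>2"
    using aT by (simp add: power_mult_distrib)
  finally show ?thesis
    by (rule power2_le_imp_le) (use \<open>0 \<le> \<rho>\<close> \<open>0 \<le> c\<close> aT in simp)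
qed

text \<open>A trajectory with a nearby control cannot be the first to leave the unit tube around \<open>x\<close>,
  because up to the exit time the Gronwall estimate keeps it in the tube of radius \<open>1/2\<close>.\<close>

lemma trajectory_tube:
  fixes f :: "real \<Rightarrow> real ^ 'n \<Rightarrow> real ^ 'n"
  assumes "0 \<le> \<rho>" "0 \<le> c" and t: "t \<in> {a..b}"
    and l: "\<And>a b. l absolutely_integrable_on {a..b}" "\<And>t. 0 \<le> l t"
    and lip: "AE t in lebesgue. \<forall>x\<in>cball 0 (B + 1). \<forall>y\<in>cball 0 (B + 1). norm (f t x - f t y) \<le> l t * norm (x - y)"
    and x: "abs_continuous_on_interval a b x"
      "AE t in lebesgue_on {a..b}. (x has_vector_derivative f t (x t) + \<rho> *\<^sub>R \<xi> t) (at t within {a..b})"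
    and y: "abs_continuous_on_interval a b y"
      "AE t in lebesgue_on {a..b}. (y has_vector_derivative f t (y t) + \<rho> *\<^sub>R \<eta> t) (at t within {a..b})"
    and B: "\<And>t. t \<in> {a..b} \<Longrightarrow> norm (x t) \<le> B"
    and c: "AE t in lebesgue_on {a..b}. norm (\<xi> t - \<eta> t) \<le> c"
    and small: "\<rho> * sqrt (exp (2 * (integral {a..b} l + (b - a))) * (b - a)) * c \<le> 1 / 2"
    and a: "x a = y a"
  shows "norm (x t - y t) \<le> 1"
proof (rule ccontr)
  assume "\<not> norm (x t - y t) \<le> 1"
  define S where "S = {s \<in> {a..b}. 1 \<le> norm (x s - y s)}"
  have cont: "continuous_on {a..b} (\<lambda>s. x s - y s)"
    by (intro continuous_on_diff abs_continuous_on_interval_imp_continuous_on x y)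
  have "closed S"
  proof -
    have "closed ({a..b} \<inter> (\<lambda>s. norm (x s - y s)) -` {1..})"
      by (intro continuous_closed_preimage continuous_on_norm cont closed_atLeastAtMost closed_atLeast)
    moreover have "S = {a..b} \<inter> (\<lambda>s. norm (x s - y s)) -` {1..}" by (auto simp: S_def)
    ultimately show ?thesis by simp
  qed
  have "t \<in> S" using t \<open>\<not> norm (x t - y t) \<le> 1\<close> by (simp add: S_def)
  \<comment> \<open>The first time at distance at least 1; it belongs to \<open>S\<close> because
    \<open>S\<close> is closed.\<close>
  define T where "T = Inf S"
  have bdd: "bdd_below S" by (rule bdd_belowI[of _ a]) (simp add: S_def)
  have "T \<in> S"
    unfolding T_def using \<open>t \<in> S\<close> by (intro closed_contains_Inf bdd \<open>closed S\<close>) auto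
  then have T: "T \<in> {a..b}" "1 \<le> norm (x T - y T)" by (auto simp: S_def)
  then have "a < T" using a by (cases "a = T") auto
  have less: "norm (x s - y s) \<le> 1" if "s \<in> {a..<T}" for s
  proof (rule ccontr)
    assume "\<not> norm (x s - y s) \<le> 1"
    then have "s \<in> S" using that T by (simp add: S_def)
    then have "T \<le> s" unfolding T_def by (intro cInf_lower bdd)
    then show False using that by simp
  qed
  \<comment> \<open>Continuity carries the bound to \<open>T\<close>, so on the closed interval both
    curves stay in the ball of radius \<open>B + 1\<close>, where the Lipschitz bound is
    available.\<close>
  have le: "norm (x s - y s) \<le> 1" if "s \<in> {a..T}" for s
  proof (rule continuous_on_closure_norm_le[where f = "\<lambda>s. x s - y s" and s = "{a..<T}"])
    show "continuous_on (closure {a..<T}) (\<lambda>s. x s - y s)"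
      using \<open>a < T\<close> T by (intro continuous_on_subset[OF cont]) auto
  qed (use less that \<open>a < T\<close> in auto)
  have "norm (x T - y T) \<le> \<rho> * sqrt (exp (2 * (integral {a..b} l + (b - a))) * (b - a)) * c"
  proof (rule trajectory_difference_bound[OF \<open>0 \<le> \<rho>\<close> \<open>0 \<le> c\<close> T(1) l lip x y _ _ c a])
    fix s assume s: "s \<in> {a..T}"
    then have xs: "norm (x s) \<le> B" using T by (intro B) auto
    then show "x s \<in> cball 0 (B + 1)" by simp
    have "norm (y s) \<le> norm (x s) + norm (x s - y s)"
      by (metis norm_minus_commute norm_triangle_sub)
    then show "y s \<in> cball 0 (B + 1)" using xs le[OF s] by simp
  qed
  then show False using small T by simp
qed

text \<open>The scale \<open>c k\<close> takes the place of \<open>norm (y k - x)\<close>, which may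
  be 0; the linear bound on \<open>y k - x\<close> lets the usual little-o estimate be divided by
  it.\<close>

lemma has_derivative_remainder_tendsto:
  fixes F :: "'a::real_normed_vector \<Rightarrow> 'b::real_normed_vector"
  assumes D: "(F has_derivative F') (at x)" and z: "\<And>k. norm (y k - x) \<le> C * c k"
    and c: "\<And>k. 0 < c k" "c \<longlonglongrightarrow> 0"
  shows "(\<lambda>k. norm (F (y k) - F x - F' (y k - x)) / c k) \<longlonglongrightarrow> 0"
proof (rule LIMSEQ_I)
  fix e :: real assume "0 < e"
  have "0 \<le> C * c 0" using z[of 0] norm_ge_zero order_trans by blast
  then have C: "0 \<le> C" using c(1)[of 0] by (simp add: zero_le_mult_iff)
  define e' where "e' = e / (C + 1)"
  have "0 < e'" using C \<open>0 < e\<close> by (simp add: e'_def)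
  then obtain d where "d > 0"
    and d: "\<And>y. norm (y - x) < d \<Longrightarrow> norm (F y - F x - F' (y - x)) \<le> e' * norm (y - x)"
    using D unfolding has_derivative_at_alt by blast
  have "0 < d / (C + 1)" using \<open>d > 0\<close> C by simp
  from LIMSEQ_D[OF c(2) this] obtain k0 where k0: "\<And>k. k \<ge> k0 \<Longrightarrow> c k < d / (C + 1)"
    using c(1) by fastforce
  show "\<exists>k0. \<forall>k\<ge>k0. norm (norm (F (y k) - F x - F' (y k - x)) / c k - 0) < e"
  proof (intro exI allI impI)
    fix k assume "k0 \<le> k"
    have ck: "0 < c k" by (rule c)
    have "norm (y k - x) \<le> (C + 1) * c k" using z[of k] ck by (simp add: algebra_simps)
    also have "\<dots> < d" using k0[OF \<open>k0 \<le> k\<close>] C by (simp add: field_simps)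
    finally have "norm (F (y k) - F x - F' (y k - x)) \<le> e' * norm (y k - x)" by (rule d)
    also have "\<dots> \<le> e' * (C * c k)" using z[of k] \<open>0 < e'\<close> by (intro mult_left_mono) auto
    also have "\<dots> < e' * ((C + 1) * c k)" using ck \<open>0 < e'\<close> by simp
    also have "\<dots> = e * c k" using C by (simp add: e'_def)
    finally show "norm (norm (F (y k) - F x - F' (y k - x)) / c k - 0) < e"
      using ck by (simp add: pos_divide_less_eq)
  qed
qed

lemma inner_control_integrable:
  fixes p :: "real \<Rightarrow> 'a::euclidean_space"
  assumes p: "continuous_on {a..b} p" and \<eta>: "\<eta> \<in> borel_measurable lebesgue" "\<And>t. norm (\<eta> t) \<le> 1"
  shows "(\<lambda>t. p t \<bullet> \<eta> t) absolutely_integrable_on {a..b}"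
proof -
  have "bounded (p ` {a..b})" by (intro compact_imp_bounded compact_continuous_image p compact_Icc)
  then obtain K where K: "\<And>s. s \<in> {a..b} \<Longrightarrow> norm (p s) \<le> K" unfolding bounded_iff by blast
  show ?thesis
  proof (rule measurable_bounded_by_integrable_imp_absolutely_integrable)
    show "(\<lambda>t. p t \<bullet> \<eta> t) \<in> borel_measurable (lebesgue_on {a..b})"
      using p \<eta>(1)
      by (intro borel_measurable_inner continuous_imp_measurable_on_sets_lebesgue measurable_restrict_space1) auto
    fix t assume t: "t \<in> {a..b}"
    have "\<bar>p t \<bullet> \<eta> t\<bar> \<le> norm (p t) * norm (\<eta> t)" by (rule Cauchy_Schwarz_ineq2)
    also have "\<dots> \<le> norm (p t) * 1" by (intro mult_left_mono \<eta>(2)) simp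
    also have "\<dots> \<le> K" using K[OF t] by simp
    finally show "norm (p t \<bullet> \<eta> t) \<le> K" by simp
  qed (auto intro: integrable_const_ivl)
qed

text \<open>Integrate the derivative of \<open>p t \<bullet> (y k t - x t)\<close>. Once the
  Jacobian terms have cancelled and the control terms are moved to the left, only the Taylor
  remainder of \<open>f t\<close> paired with \<open>p t\<close> is left. Divided by
  \<open>c k\<close> it tends to 0 pointwise and is dominated by a multiple of
  \<open>l\<close>.\<close>

lemma adjoint_first_order_expansion:
  fixes f :: "real \<Rightarrow> real ^ 'n \<Rightarrow> real ^ 'n"
  assumes f: "admissible_rhs f" and ab: "a \<le> b"
    and l: "l absolutely_integrable_on {a..b}" "\<And>t. 0 \<le> l t"
    and lip: "AE t in lebesgue. \<forall>x\<in>K. \<forall>y\<in>K. norm (f t x - f t y) \<le> l t * norm (x - y)"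
    and jac: "AE t in lebesgue. \<forall>x\<in>K. \<forall>v. norm (jacobian (f t) (at x) *v v) \<le> l t * norm v"
    and x: "abs_continuous_on_interval a b x"
      "AE t in lebesgue_on {a..b}. (x has_vector_derivative f t (x t) + \<rho> *\<^sub>R \<xi> t) (at t within {a..b})"
    and y: "\<And>k. abs_continuous_on_interval a b (y k)"
      "\<And>k. AE t in lebesgue_on {a..b}. (y k has_vector_derivative f t (y k t) + \<rho> *\<^sub>R \<eta> k t) (at t within {a..b})"
    and p: "abs_continuous_on_interval a b p"
      "AE t in lebesgue_on {a..b}. (p has_vector_derivative - (transpose (jacobian (f t) (at (x t))) *v p t)) (at t within {a..b})"
    and \<xi>: "\<xi> \<in> borel_measurable lebesgue" "\<And>t. norm (\<xi> t) \<le> 1"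
    and \<eta>: "\<And>k. \<eta> k \<in> borel_measurable lebesgue" "\<And>k t. norm (\<eta> k t) \<le> 1"
    and K: "\<And>t. t \<in> {a..b} \<Longrightarrow> x t \<in> K" "\<And>k t. t \<in> {a..b} \<Longrightarrow> y k t \<in> K"
    and z: "\<And>k t. t \<in> {a..b} \<Longrightarrow> norm (y k t - x t) \<le> C * c k"
    and c: "\<And>k. 0 < c k" "c \<longlonglongrightarrow> 0"
    and a: "\<And>k. y k a = x a"
  shows "(\<lambda>k. (p b \<bullet> (y k b - x b)
    - \<rho> * (integral {a..b} (\<lambda>t. p t \<bullet> \<eta> k t) - integral {a..b} (\<lambda>t. p t \<bullet> \<xi> t))) / c k) \<longlonglongrightarrow> 0"
proof -
  obtain Pb where Pb: "Pb > 0" "\<And>t. t \<in> {a..b} \<Longrightarrow> norm (p t) \<le> Pb"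
    by (rule abs_continuous_bounded[OF p(1)]) (rule that)
  have pc: "continuous_on {a..b} p" by (rule abs_continuous_on_interval_imp_continuous_on[OF p(1)])
  define A where "A t = jacobian (f t) (at (x t))" for t
  define g where "g k t = p t \<bullet> (f t (y k t) - f t (x t) - A t *v (y k t - x t))" for k t
  define R where "R k = p b \<bullet> (y k b - x b)
    - \<rho> * (integral {a..b} (\<lambda>t. p t \<bullet> \<eta> k t) - integral {a..b} (\<lambda>t. p t \<bullet> \<xi> t))" for k
  have int\<xi>: "(\<lambda>t. p t \<bullet> \<xi> t) integrable_on {a..b}"
    by (rule set_lebesgue_integral_eq_integral(1)[OF inner_control_integrable[OF pc \<xi>]])
  have int\<eta>: "(\<lambda>t. p t \<bullet> \<eta> k t) integrable_on {a..b}" for k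
    by (rule set_lebesgue_integral_eq_integral(1)[OF inner_control_integrable[OF pc \<eta>]])
  have gR: "(g k has_integral R k) {a..b}" for k
  proof -
    have ac: "abs_continuous_on_interval a b (\<lambda>t. p t \<bullet> (y k t - x t))"
      by (intro abs_continuous_inner p(1) abs_continuous_diff y(1) x(1))
    have "AE t in lebesgue_on {a..b}. ((\<lambda>t. p t \<bullet> (y k t - x t)) has_vector_derivative
        g k t + \<rho> * (p t \<bullet> \<eta> k t - p t \<bullet> \<xi> t)) (at t within {a..b})"
      using x(2) y(2)[of k] p(2)
    proof eventually_elim
      case (elim t)
      note d = bounded_bilinear.has_vector_derivative[OF bounded_bilinear_inner elim(3)
          has_vector_derivative_diff[OF elim(2,1)]]
      have "p t \<bullet> (f t (y k t) + \<rho> *\<^sub>R \<eta> k t - (f t (x t) + \<rho> *\<^sub>R \<xi> t)) +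
          - (transpose (jacobian (f t) (at (x t))) *v p t) \<bullet> (y k t - x t)
        = g k t + \<rho> * (p t \<bullet> \<eta> k t - p t \<bullet> \<xi> t)"
        unfolding g_def A_def inner_minus_left transpose_mult_inner
        by (simp add: inner_diff_right inner_add_right algebra_simps)
      with d show ?case by simp
    qed
    from abs_continuous_has_integral[OF ac ab this]
    have 1: "((\<lambda>t. g k t + \<rho> * (p t \<bullet> \<eta> k t - p t \<bullet> \<xi> t)) has_integral p b \<bullet> (y k b - x b)) {a..b}"
      using a by simp
    have 2: "((\<lambda>t. \<rho> * (p t \<bullet> \<eta> k t - p t \<bullet> \<xi> t)) has_integral
        \<rho> * (integral {a..b} (\<lambda>t. p t \<bullet> \<eta> k t) - integral {a..b} (\<lambda>t. p t \<bullet> \<xi> t))) {a..b}"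
      by (intro has_integral_mult_right has_integral_diff integrable_integral int\<xi> int\<eta>)
    show ?thesis
      using has_integral_diff[OF 1 2] unfolding R_def by simp
  qed
  have "AE t in lebesgue. \<forall>x. f t differentiable (at x)"
    using f unfolding admissible_rhs_def by (auto elim: eventually_mono)
  then have "AE t in lebesgue. (\<forall>x\<in>K. \<forall>y\<in>K. norm (f t x - f t y) \<le> l t * norm (x - y)) \<and>
      (\<forall>x\<in>K. \<forall>v. norm (jacobian (f t) (at x) *v v) \<le> l t * norm v) \<and> (\<forall>x. f t differentiable (at x))"
    using lip jac by eventually_elim blast
  then obtain N where N: "negligible N" and good: "\<And>t. t \<notin> N \<Longrightarrow>
      (\<forall>x\<in>K. \<forall>y\<in>K. norm (f t x - f t y) \<le> l t * norm (x - y)) \<and>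
      (\<forall>x\<in>K. \<forall>v. norm (jacobian (f t) (at x) *v v) \<le> l t * norm v) \<and> (\<forall>x. f t differentiable (at x))"
    by (rule AE_lebesgueE) (rule that)
  have lipN: "norm (f t x - f t y) \<le> l t * norm (x - y)" if "t \<notin> N" "x \<in> K" "y \<in> K" for t x y
    using good that by simp
  have jacN: "norm (jacobian (f t) (at x) *v v) \<le> l t * norm v" if "t \<notin> N" "x \<in> K" for t x v
    using good that by simp
  have diffN: "f t differentiable (at x)" if "t \<notin> N" for t x
    using good that by simp
  \<comment> \<open>Zero on \<open>N\<close>, so that domination and convergence hold at every
    point.\<close>
  define h where "h k t = (if t \<in> N then 0 else g k t / c k)" for k t
  have hR: "(h k has_integral R k / c k) {a..b}" for k
  proof -
    have "((\<lambda>t. g k t / c k) has_integral R k / c k) {a..b}"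
      using gR by (rule has_integral_divide)
    then show ?thesis
      by (rule has_integral_spike[OF N, rotated]) (auto simp: h_def)
  qed
  have "(\<lambda>k. integral {a..b} (h k)) \<longlonglongrightarrow> integral {a..b} (\<lambda>t. 0)"
  proof (rule dominated_convergence(2))
    show "h k integrable_on {a..b}" for k using hR by blast
    show "(\<lambda>t. Pb * (2 * C) * l t) integrable_on {a..b}"
      using set_lebesgue_integral_eq_integral(1)[OF l(1)] by (rule integrable_on_mult_right)
    show "norm (h k t) \<le> Pb * (2 * C) * l t" if t: "t \<in> {a..b}" for k t
    proof (cases "t \<in> N")
      case True
      have "0 \<le> C * c k" using z[OF t, of k] norm_ge_zero order_trans by blast
      then have "0 \<le> C" using c(1)[of k] by (simp add: zero_le_mult_iff)
      then show ?thesis using True l(2)[of t] Pb(1) by (simp add: h_def)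
    next
      case False
      \<comment> \<open>The Lipschitz and the Jacobian bound contribute one \<open>l t\<close> each,
        whence the factor 2 in the dominating function.\<close>
      have "norm (f t (y k t) - f t (x t) - A t *v (y k t - x t)) \<le>
          l t * norm (y k t - x t) + l t * norm (y k t - x t)"
        unfolding A_def
        by (intro order_trans[OF norm_triangle_ineq4] add_mono lipN jacN K t False)
      also have "\<dots> \<le> l t * (C * c k) + l t * (C * c k)"
        by (intro add_mono mult_left_mono z t l(2))
      finally have 1: "norm (f t (y k t) - f t (x t) - A t *v (y k t - x t)) \<le> 2 * C * l t * c k" by (simp add: mult_ac)
      have "\<bar>g k t\<bar> \<le> norm (p t) * norm (f t (y k t) - f t (x t) - A t *v (y k t - x t))"
        unfolding g_def by (rule Cauchy_Schwarz_ineq2)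
      also have "\<dots> \<le> Pb * (2 * C * l t * c k)"
        using Pb by (intro mult_mono Pb(2) t 1) auto
      finally have "\<bar>g k t\<bar> / c k \<le> Pb * (2 * C) * l t"
        using c(1)[of k] by (simp add: pos_divide_le_eq mult_ac)
      then show ?thesis using False c(1)[of k] by (simp add: h_def)
    qed
    show "(\<lambda>k. h k t) \<longlonglongrightarrow> 0" if t: "t \<in> {a..b}" for t
    proof (cases "t \<in> N")
      case True
      then show ?thesis by (simp add: h_def)
    next
      case False
      have "(f t has_derivative (*v) (A t)) (at (x t))"
        unfolding A_def using diffN[OF False] jacobian_works by blast
      note rem = has_derivative_remainder_tendsto[OF this z[OF t] c]
      show ?thesis
      proof (rule Lim_null_comparison)
        show "(\<lambda>k. Pb * (norm (f t (y k t) - f t (x t) - A t *v (y k t - x t)) / c k)) \<longlonglongrightarrow> 0"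
          using tendsto_mult_right_zero[OF rem] .
        show "\<forall>\<^sub>F k in sequentially. norm (h k t) \<le> Pb * (norm (f t (y k t) - f t (x t) - A t *v (y k t - x t)) / c k)"
        proof (rule always_eventually, rule allI)
          fix k
          have "\<bar>g k t\<bar> \<le> norm (p t) * norm (f t (y k t) - f t (x t) - A t *v (y k t - x t))"
            unfolding g_def by (rule Cauchy_Schwarz_ineq2)
          also have "\<dots> \<le> Pb * norm (f t (y k t) - f t (x t) - A t *v (y k t - x t))"
            by (intro mult_right_mono Pb(2) t) simp
          finally show "norm (h k t) \<le> Pb * (norm (f t (y k t) - f t (x t) - A t *v (y k t - x t)) / c k)"
            using False c(1)[of k] by (simp add: h_def divide_right_mono)
        qed
      qed
    qed
  qed
  then have "(\<lambda>k. R k / c k) \<longlonglongrightarrow> 0" using integral_unique[OF hR] by simp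
  then show ?thesis unfolding R_def .
qed

section \<open>The adjoint equation\<close>

text \<open>The operator is set to 0 at exceptional times, so that the norm bound holds at every
  time, as the existence theorem demands; almost everywhere nothing changes.\<close>

lemma adjoint_exists:
  fixes f :: "real \<Rightarrow> real ^ 'n \<Rightarrow> real ^ 'n"
  assumes f: "admissible_rhs f" and ab: "a \<le> b"
    and x: "x \<in> borel_measurable lebesgue" "\<And>t. t \<in> {a..b} \<Longrightarrow> x t \<in> K"
    and l: "l absolutely_integrable_on {a..b}" "\<And>t. 0 \<le> l t"
    and jac: "AE t in lebesgue. \<forall>x\<in>K. \<forall>v. norm (jacobian (f t) (at x) *v v) \<le> l t * norm v"
  obtains p where "abs_continuous_on_interval a b p" "p b = q"
    "AE t in lebesgue_on {a..b}. (p has_vector_derivative - (transpose (jacobian (f t) (at (x t))) *v p t)) (at t within {a..b})"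
proof -
  obtain N where N: "negligible N"
    and jacN: "\<And>t x v. t \<notin> N \<Longrightarrow> x \<in> K \<Longrightarrow> norm (jacobian (f t) (at x) *v v) \<le> l t * norm v"
    using jac unfolding eventually_ae_filter_negligible by blast
  have AEN: "AE t in lebesgue. t \<notin> N"
    unfolding eventually_ae_filter_negligible using N by blast
  define B where "B t v = (if t \<in> N then 0 else - (transpose (jacobian (f t) (at (x t))) *v v))" for t v
  have 2: "linear (B t)" for t
    unfolding B_def by (cases "t \<in> N") (auto intro!: linearI simp: matrix_vector_right_distrib matrix_vector_mult_scaleR
        simp del: transpose_matrix_vector)
  have 3: "norm (B t v) \<le> l t * norm v" if "t \<in> {a..b}" for t v
    unfolding B_def using l(2)[of t] norm_transpose_le[OF jacN[OF _ x(2)[OF that]]] by auto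
  have 4: "(\<lambda>t. B t (q t)) \<in> borel_measurable (lebesgue_on {a..b})" if q: "continuous_on {a..b} q" for q
  proof -
    define q' where "q' t = (if t \<in> {a..b} then q t else 0)" for t
    have "q' \<in> borel_measurable lebesgue"
      unfolding q'_def[abs_def]
      by (intro borel_measurable_if_I continuous_imp_measurable_on_sets_lebesgue q) auto
    then have "(\<lambda>t. - (transpose (jacobian (f t) (at (x t))) *v q' t)) \<in> borel_measurable lebesgue"
      by (intro borel_measurable_uminus borel_measurable_jacobian_transpose f x)
    then have "(\<lambda>t. B t (q' t)) \<in> borel_measurable lebesgue"
      by (rule borel_measurable_AE) (use AEN in \<open>eventually_elim, simp add: B_def\<close>)
    then have "(\<lambda>t. B t (q' t)) \<in> borel_measurable (lebesgue_on {a..b})"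
      by (rule measurable_restrict_space1)
    then show ?thesis by (rule measurable_cong[THEN iffD1, rotated]) (simp add: q'_def)
  qed
  obtain p where p: "abs_continuous_on_interval a b p" "p b = q"
    "AE t in lebesgue_on {a..b}. (p has_vector_derivative B t (p t)) (at t within {a..b})"
    by (rule linear_caratheodory_terminal_value[where ?p0.0 = q, OF ab l(1) l(2) 2 3 4]) (assumption | rule that)+
  have "AE t in lebesgue_on {a..b}. (p has_vector_derivative - (transpose (jacobian (f t) (at (x t))) *v p t)) (at t within {a..b})"
    using p(3) AE_lebesgue_imp_on[OF AEN] by eventually_elim (simp add: B_def)
  with p(1,2) show ?thesis by (rule that)
qed

text \<open>A zero would spread over the interval, because the transpose obeys the same norm bound
  as the Jacobian.\<close>

lemma adjoint_nonzero:
  fixes f :: "real \<Rightarrow> real ^ 'n \<Rightarrow> real ^ 'n"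
  assumes x: "\<And>t. t \<in> {a..b} \<Longrightarrow> x t \<in> K"
    and l: "l absolutely_integrable_on {a..b}" "\<And>t. 0 \<le> l t"
    and jac: "AE t in lebesgue. \<forall>x\<in>K. \<forall>v. norm (jacobian (f t) (at x) *v v) \<le> l t * norm v"
    and p: "abs_continuous_on_interval a b p"
      "AE t in lebesgue_on {a..b}. (p has_vector_derivative - (transpose (jacobian (f t) (at (x t))) *v p t)) (at t within {a..b})"
    and s: "s \<in> {a..b}" "p s \<noteq> 0" and t: "t \<in> {a..b}"
  shows "p t \<noteq> 0"
proof
  assume "p t = 0"
  have "AE t in lebesgue_on {a..b}. t \<in> {a..b}"
    using AE_space[of "lebesgue_on {a..b}"] by simp
  with p(2) AE_lebesgue_imp_on[OF jac]
  have D: "AE t in lebesgue_on {a..b}. \<exists>d. (p has_vector_derivative d) (at t within {a..b}) \<and>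
      norm d \<le> l t * norm (p t)"
  proof eventually_elim
    case (elim t)
    have "norm (- (transpose (jacobian (f t) (at (x t))) *v p t)) \<le> l t * norm (p t)"
      unfolding norm_minus_cancel using elim x by (intro norm_transpose_le) blast
    with elim(1) show ?case by blast
  qed
  have "p s = 0"
    by (rule abs_continuous_zero[OF p(1) l(1) l(2) D t \<open>p t = 0\<close> s(1)])
  then show False using s by simp
qed

section \<open>Maximum principle for boundary trajectories\<close>

text \<open>Bounded at every point, in contrast to \<open>controls\<close>: affine combinations and
  pointwise comparisons then involve no null sets.\<close>

definition unit_controls :: "(real \<Rightarrow> 'a::euclidean_space) set" where
  "unit_controls = {\<eta> \<in> borel_measurable lebesgue. \<forall>t. norm (\<eta> t) \<le> 1}"

text \<open>A convex combination in which \<open>\<xi>\<close> has the weight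
  \<open>1 - sum \<alpha> I\<close>. Written around \<open>\<xi>\<close>, it reduces to
  \<open>\<xi>\<close> when all weights are 0.\<close>

lemma norm_affine_combination_le:
  fixes \<zeta> :: "'i \<Rightarrow> 'a::real_normed_vector"
  assumes "finite I" "norm \<xi> \<le> 1" "\<And>i. i \<in> I \<Longrightarrow> norm (\<zeta> i) \<le> 1" "\<And>i. i \<in> I \<Longrightarrow> 0 \<le> \<alpha> i" "sum \<alpha> I \<le> 1"
  shows "norm (\<xi> + (\<Sum>i\<in>I. \<alpha> i *\<^sub>R (\<zeta> i - \<xi>))) \<le> 1"
proof -
  have "\<xi> + (\<Sum>i\<in>I. \<alpha> i *\<^sub>R (\<zeta> i - \<xi>)) = (1 - sum \<alpha> I) *\<^sub>R \<xi> + (\<Sum>i\<in>I. \<alpha> i *\<^sub>R \<zeta> i)"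
    by (simp add: scaleR_right_diff_distrib sum_subtractf scaleR_left.sum[symmetric] scaleR_left_diff_distrib)
  also have "norm \<dots> \<le> norm ((1 - sum \<alpha> I) *\<^sub>R \<xi>) + (\<Sum>i\<in>I. norm (\<alpha> i *\<^sub>R \<zeta> i))"
    by (rule order_trans[OF norm_triangle_ineq add_left_mono[OF norm_sum]])
  also have "\<dots> \<le> (1 - sum \<alpha> I) * 1 + (\<Sum>i\<in>I. \<alpha> i * 1)"
  proof (rule add_mono)
    show "norm ((1 - sum \<alpha> I) *\<^sub>R \<xi>) \<le> (1 - sum \<alpha> I) * 1"
      using assms by (simp add: mult_left_le)
    show "(\<Sum>i\<in>I. norm (\<alpha> i *\<^sub>R \<zeta> i)) \<le> (\<Sum>i\<in>I. \<alpha> i * 1)"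
    proof (rule sum_mono)
      fix i assume "i \<in> I"
      then show "norm (\<alpha> i *\<^sub>R \<zeta> i) \<le> \<alpha> i * 1"
        using assms(3,4)[of i] by (simp add: mult_left_le)
    qed
  qed
  also have "\<dots> = 1" by simp
  finally show ?thesis .
qed

lemma unit_controls_affine_combination:
  assumes "finite I" "\<xi> \<in> unit_controls" "\<And>i. i \<in> I \<Longrightarrow> \<zeta> i \<in> unit_controls"
    "\<And>i. i \<in> I \<Longrightarrow> 0 \<le> \<alpha> i" "sum \<alpha> I \<le> 1"
  shows "(\<lambda>t. \<xi> t + (\<Sum>i\<in>I. \<alpha> i *\<^sub>R (\<zeta> i t - \<xi> t))) \<in> unit_controls"
proof -
  have "(\<lambda>t. \<xi> t + (\<Sum>i\<in>I. \<alpha> i *\<^sub>R (\<zeta> i t - \<xi> t))) \<in> borel_measurable lebesgue"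
    using assms(2,3)
    by (intro borel_measurable_add borel_measurable_sum borel_measurable_scaleR borel_measurable_diff
        borel_measurable_const) (auto simp: unit_controls_def)
  moreover have "norm (\<xi> t + (\<Sum>i\<in>I. \<alpha> i *\<^sub>R (\<zeta> i t - \<xi> t))) \<le> 1" for t
    using assms by (intro norm_affine_combination_le) (auto simp: unit_controls_def)
  ultimately show ?thesis by (simp add: unit_controls_def)
qed

section \<open>Integral functionals of controls and their maximisers\<close>

lemma inner_unit_control_integrable:
  assumes "continuous_on {a..b} p" "\<eta> \<in> unit_controls"
  shows "(\<lambda>t. p t \<bullet> \<eta> t) absolutely_integrable_on {a..b}" "(\<lambda>t. p t \<bullet> \<eta> t) integrable_on {a..b}"
proof -
  show 1: "(\<lambda>t. p t \<bullet> \<eta> t) absolutely_integrable_on {a..b}"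
    using assms by (intro inner_control_integrable) (auto simp: unit_controls_def)
  show "(\<lambda>t. p t \<bullet> \<eta> t) integrable_on {a..b}"
    using 1 by (rule set_lebesgue_integral_eq_integral(1))
qed

lemma integral_inner_affine_combination:
  fixes p :: "real \<Rightarrow> 'a::euclidean_space"
  assumes p: "continuous_on {a..b} p" and "finite I" and \<xi>: "\<xi> \<in> unit_controls"
    and \<zeta>: "\<And>i. i \<in> I \<Longrightarrow> \<zeta> i \<in> unit_controls"
  shows "integral {a..b} (\<lambda>t. p t \<bullet> (\<xi> t + (\<Sum>i\<in>I. \<alpha> i *\<^sub>R (\<zeta> i t - \<xi> t)))) =
    integral {a..b} (\<lambda>t. p t \<bullet> \<xi> t) +
    (\<Sum>i\<in>I. \<alpha> i * (integral {a..b} (\<lambda>t. p t \<bullet> \<zeta> i t) - integral {a..b} (\<lambda>t. p t \<bullet> \<xi> t)))"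
proof -
  have "((\<lambda>t. p t \<bullet> \<xi> t + (\<Sum>i\<in>I. \<alpha> i * (p t \<bullet> \<zeta> i t - p t \<bullet> \<xi> t))) has_integral
    integral {a..b} (\<lambda>t. p t \<bullet> \<xi> t) +
    (\<Sum>i\<in>I. \<alpha> i * (integral {a..b} (\<lambda>t. p t \<bullet> \<zeta> i t) - integral {a..b} (\<lambda>t. p t \<bullet> \<xi> t)))) {a..b}"
    by (intro has_integral_add has_integral_sum has_integral_mult_right has_integral_diff
        integrable_integral inner_unit_control_integrable p \<xi> \<zeta> \<open>finite I\<close>)
  moreover have "(\<lambda>t. p t \<bullet> \<xi> t + (\<Sum>i\<in>I. \<alpha> i * (p t \<bullet> \<zeta> i t - p t \<bullet> \<xi> t))) =
      (\<lambda>t. p t \<bullet> (\<xi> t + (\<Sum>i\<in>I. \<alpha> i *\<^sub>R (\<zeta> i t - \<xi> t))))"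
    by (simp add: inner_add_right inner_sum_right inner_diff_right)
  ultimately show ?thesis by (simp add: integral_unique)
qed

text \<open>As 0 belongs to \<open>R\<close>, it is separated from the interior only; a convex set
  with interior points lies in the closure of its interior, which extends the inequality to
  \<open>R\<close>. Without interior points \<open>R\<close> lies in a hyperplane, which passes
  through 0.\<close>

lemma separating_direction:
  fixes R :: "'a::euclidean_space set"
  assumes "convex R" "0 \<in> R" "0 \<notin> interior R"
  obtains q where "q \<noteq> 0" "\<And>r. r \<in> R \<Longrightarrow> q \<bullet> r \<le> 0"
proof (cases "interior R = {}")
  case True
  then obtain q c where q: "q \<noteq> 0" "R \<subseteq> {x. q \<bullet> x = c}"
    using empty_interior_subset_hyperplane[OF assms(1)] by metis
  then have "c = 0" using assms(2) by auto
  show ?thesis by (rule that[OF q(1)]) (use q \<open>c = 0\<close> in auto)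
next
  case False
  have "convex (interior R)" using assms(1) by (rule convex_interior)
  then obtain q c where q: "q \<noteq> 0" "\<And>x. x \<in> interior R \<Longrightarrow> q \<bullet> x \<le> c" "c \<le> 0"
    using separating_hyperplane_sets[of "interior R" "{0}"] False assms(3) by auto
  have "closure (interior R) \<subseteq> {x. q \<bullet> x \<le> c}"
    by (rule closure_minimal) (use q(2) in \<open>auto simp: closed_halfspace_le\<close>)
  then have "R \<subseteq> {x. q \<bullet> x \<le> c}"
    using convex_closure_interior[OF assms(1) False] closure_subset by blast
  then show ?thesis using q(1,3) by (intro that[of q]) auto
qed

text \<open>Compared with the competitor \<open>sgn (p t)\<close>, the deficit in the integrand is
  nonnegative and has integral at most 0, hence vanishes almost everywhere. Equality in
  Cauchy-Schwarz then identifies \<open>\<xi> t\<close>.\<close>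

lemma maximizing_control_eq_direction:
  fixes p :: "real \<Rightarrow> 'a::euclidean_space"
  assumes p: "continuous_on {a..b} p" "\<And>t. t \<in> {a..b} \<Longrightarrow> p t \<noteq> 0" and \<xi>: "\<xi> \<in> unit_controls"
    and max: "\<And>\<eta>. \<eta> \<in> unit_controls \<Longrightarrow>
      integral {a..b} (\<lambda>t. p t \<bullet> \<eta> t) \<le> integral {a..b} (\<lambda>t. p t \<bullet> \<xi> t)"
  shows "AE t in lebesgue_on {a..b}. \<xi> t = sgn (p t)"
proof -
  define \<eta> where "\<eta> t = (if t \<in> {a..b} then sgn (p t) else 0)" for t
  have "continuous_on {a..b} (\<lambda>t. sgn (p t))"
    unfolding sgn_div_norm using p by (intro continuous_intros) auto
  then have "\<eta> \<in> borel_measurable lebesgue"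
    unfolding \<eta>_def[abs_def]
    by (intro borel_measurable_if_I continuous_imp_measurable_on_sets_lebesgue) auto
  then have \<eta>: "\<eta> \<in> unit_controls" by (auto simp: unit_controls_def \<eta>_def norm_sgn)
  define g where "g t = p t \<bullet> \<eta> t - p t \<bullet> \<xi> t" for t
  have g0: "0 \<le> g t" if "t \<in> {a..b}" for t
  proof -
    have "p t \<bullet> \<xi> t \<le> norm (p t) * norm (\<xi> t)" by (rule norm_cauchy_schwarz)
    also have "\<dots> \<le> norm (p t) * 1" using \<xi> by (intro mult_left_mono) (auto simp: unit_controls_def)
    also have "\<dots> = p t \<bullet> \<eta> t"
      using that p(2)[OF that] by (simp add: \<eta>_def sgn_div_norm dot_square_norm power2_eq_square)
    finally show ?thesis by (simp add: g_def)
  qed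
  have ga: "g absolutely_integrable_on {a..b}"
    unfolding g_def by (intro set_integral_diff(1) inner_unit_control_integrable p \<xi> \<eta>)
  have "integral {a..b} g = integral {a..b} (\<lambda>t. p t \<bullet> \<eta> t) - integral {a..b} (\<lambda>t. p t \<bullet> \<xi> t)"
    unfolding g_def by (intro Henstock_Kurzweil_Integration.integral_diff inner_unit_control_integrable p \<xi> \<eta>)
  then have "integral {a..b} g \<le> 0" using max[OF \<eta>] by simp
  moreover have "0 \<le> integral {a..b} g"
    using ga g0 by (intro integral_nonneg set_lebesgue_integral_eq_integral(1))
  ultimately have "(g has_integral 0) {a..b}"
    using ga by (metis antisym integrable_integral set_lebesgue_integral_eq_integral(1))
  then have "integral\<^sup>L (lebesgue_on {a..b}) g = 0"
    using ga by (simp add: lebesgue_integral_eq_integral absolutely_integrable_imp_integrable integral_unique)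
  moreover have "AE t in lebesgue_on {a..b}. 0 \<le> g t"
    using AE_space[of "lebesgue_on {a..b}"] by eventually_elim (use g0 in simp)
  moreover have "integrable (lebesgue_on {a..b}) g"
    using ga by (intro absolutely_integrable_imp_integrable) auto
  ultimately have "AE t in lebesgue_on {a..b}. g t = 0"
    using integral_nonneg_eq_0_iff_AE by blast
  moreover have "AE t in lebesgue_on {a..b}. t \<in> {a..b}"
    using AE_space[of "lebesgue_on {a..b}"] by simp
  ultimately show ?thesis
  proof eventually_elim
    case (elim t)
    have n: "norm (p t) > 0" using p(2) elim by simp
    have \<xi>1: "\<xi> t \<bullet> \<xi> t \<le> 1"
    proof -
      have "norm (\<xi> t) \<le> 1" using \<xi> by (simp add: unit_controls_def)
      then have "(norm (\<xi> t))\<^sup>2 \<le> 1" by (simp add: power_le_one)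
      then show ?thesis by (simp add: dot_square_norm)
    qed
    have s: "p t = norm (p t) *\<^sub>R sgn (p t)" using n by (simp add: sgn_div_norm)
    have ss: "sgn (p t) \<bullet> sgn (p t) = 1" using n by (simp add: dot_square_norm norm_sgn)
    have "p t \<bullet> sgn (p t) = p t \<bullet> \<xi> t" using elim by (simp add: g_def \<eta>_def)
    then have "norm (p t) * (sgn (p t) \<bullet> sgn (p t)) = norm (p t) * (sgn (p t) \<bullet> \<xi> t)"
      by (metis s inner_scaleR_left)
    then have "sgn (p t) \<bullet> \<xi> t = 1" using n ss by simp
    \<comment> \<open>The square expands to \<open>\<xi> t \<bullet> \<xi> t - 2 + 1\<close>, and
      the first term is at most 1.\<close>
    then have "(\<xi> t - sgn (p t)) \<bullet> (\<xi> t - sgn (p t)) \<le> 0"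
      using \<xi>1 ss by (simp add: inner_diff_left inner_diff_right inner_commute)
    then have "\<xi> t - sgn (p t) = 0" by (metis inner_eq_zero_iff inner_ge_zero order_antisym)
    then show ?case by simp
  qed
qed

lemma abs_continuous_sum_scaleR:
  assumes "finite I" "\<And>i. i \<in> I \<Longrightarrow> abs_continuous_on_interval a b (P i)"
  shows "abs_continuous_on_interval a b (\<lambda>t. \<Sum>i\<in>I. c i *\<^sub>R P i t)"
  using assms
proof (induction I rule: finite_induct)
  case empty
  show ?case unfolding abs_continuous_on_interval_def by (intro allI impI exI[of _ 1]) simp
next
  case (insert i I)
  have *: "(c i *\<^sub>R pv + sv) - (c i *\<^sub>R pu + su) = c i *\<^sub>R (pv - pu) + (sv - su)" for pv pu sv su :: 'b
    by (simp add: algebra_simps)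
  have "norm (c i *\<^sub>R p + s) \<le> (\<bar>c i\<bar> + 1) * (norm p + norm s)" for p s :: 'b
  proof -
    have "norm (c i *\<^sub>R p + s) \<le> \<bar>c i\<bar> * norm p + norm s"
      using norm_triangle_ineq[of "c i *\<^sub>R p" s] by simp
    also have "\<dots> \<le> (\<bar>c i\<bar> + 1) * (norm p + norm s)" by (simp add: algebra_simps)
    finally show ?thesis .
  qed
  note le = this
  have Pi: "abs_continuous_on_interval a b (P i)" by (rule insert.prems) simp
  have IH: "abs_continuous_on_interval a b (\<lambda>t. \<Sum>i\<in>I. c i *\<^sub>R P i t)"
    by (rule insert.IH) (rule insert.prems, simp)
  show ?case
    unfolding sum.insert[OF insert.hyps]
    by (rule abs_continuous_on_interval_dominated[OF Pi IH]) (simp only: *, rule le)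
qed

text \<open>Positive and negative parts of each coordinate, told apart by \<open>snd z\<close>, give
  \<open>h\<close> as a combination with nonnegative weights, the only ones allowed in a convex
  combination of controls.\<close>

lemma axis_coordinate_decomposition:
  fixes h :: "real ^ 'n" and r :: real
  assumes "r \<noteq> 0"
  shows "(\<Sum>z\<in>UNIV. (max ((if snd z then 1 else - 1) * h $ fst z) 0 / r) *\<^sub>R
    (((if snd z then 1 else - 1) * r) *\<^sub>R axis (fst z) 1)) = h"
proof -
  have "(\<Sum>z\<in>UNIV. (max ((if snd z then 1 else - 1) * h $ fst z) 0 / r) *\<^sub>R
      (((if snd z then 1 else - 1) * r) *\<^sub>R axis (fst z) (1::real)))
    = (\<Sum>i\<in>UNIV. \<Sum>\<sigma>\<in>UNIV. (max ((if \<sigma> then 1 else - 1) * h $ i) 0 / r) *\<^sub>R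
      (((if \<sigma> then 1 else - 1) * r) *\<^sub>R axis i 1))"
    by (simp add: sum.cartesian_product UNIV_Times_UNIV[symmetric] split_def del: UNIV_Times_UNIV)
  also have "\<dots> = (\<Sum>i\<in>UNIV. h $ i *\<^sub>R axis i 1)"
  proof (rule sum.cong[OF refl])
    fix i
    have "(\<Sum>\<sigma>\<in>UNIV. (max ((if \<sigma> then 1 else - 1) * h $ i) 0 / r) *\<^sub>R (((if \<sigma> then 1 else - 1) * r) *\<^sub>R axis i (1::real)))
      = (max (h $ i) 0 - max (- h $ i) 0) *\<^sub>R axis i 1"
      using assms by (simp add: UNIV_bool scaleR_left_diff_distrib)
    also have "max (h $ i) 0 - max (- h $ i) 0 = h $ i" by simp
    finally show "(\<Sum>\<sigma>\<in>UNIV. (max ((if \<sigma> then 1 else - 1) * h $ i) 0 / r) *\<^sub>R (((if \<sigma> then 1 else - 1) * r) *\<^sub>R axis i (1::real)))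
      = h $ i *\<^sub>R axis i 1" .
  qed
  also have "\<dots> = h"
    using basis_expansion[of h] by (simp add: scalar_mult_eq_scaleR)
  finally show ?thesis .
qed

text \<open>If the linearised end-point map covers a ball, positive and negative parts of the
  coordinates of \<open>h\<close> weight finitely many controls so that the end point, as a function of \<open>h\<close>,
  has derivative \<open>\<rho> h\<close> at 0; Sussmann's open mapping theorem applies.\<close>

theorem reachable_interior:
  fixes f :: "real \<Rightarrow> real ^ 'n \<Rightarrow> real ^ 'n"
  assumes f: "admissible_rhs f" and \<rho>: "0 < \<rho>" and ab: "a \<le> b"
    and l: "\<And>a b. l absolutely_integrable_on {a..b}" "\<And>t. 0 \<le> l t"
    and lip: "AE t in lebesgue. \<forall>x\<in>cball 0 (B + 1). \<forall>y\<in>cball 0 (B + 1). norm (f t x - f t y) \<le> l t * norm (x - y)"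
    and jac: "AE t in lebesgue. \<forall>x\<in>cball 0 (B + 1). \<forall>v. norm (jacobian (f t) (at x) *v v) \<le> l t * norm v"
    and B: "\<And>t. t \<in> {a..b} \<Longrightarrow> norm (x t) \<le> B"
    and x: "abs_continuous_on_interval a b x"
      "AE t in lebesgue_on {a..b}. (x has_vector_derivative f t (x t) + \<rho> *\<^sub>R \<xi> t) (at t within {a..b})"
    and \<xi>: "\<xi> \<in> unit_controls"
    and S: "\<And>\<eta>. \<eta> \<in> unit_controls \<Longrightarrow> \<exists>y. abs_continuous_on_interval a b y \<and>
      (AE t in lebesgue_on {a..b}. (y has_vector_derivative f t (y t) + \<rho> *\<^sub>R \<eta> t) (at t within {a..b})) \<and>
      y a = x a \<and> y b \<in> S"
    and P: "\<And>i. abs_continuous_on_interval a b (P i)" "\<And>i. P i b = axis i 1"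
      "\<And>i. AE t in lebesgue_on {a..b}.
        (P i has_vector_derivative - (transpose (jacobian (f t) (at (x t))) *v P i t)) (at t within {a..b})"
    and r: "0 < r" and cover: "\<And>v. norm v \<le> r \<Longrightarrow> \<exists>\<eta>\<in>unit_controls. \<forall>i.
      integral {a..b} (\<lambda>t. P i t \<bullet> \<eta> t) - integral {a..b} (\<lambda>t. P i t \<bullet> \<xi> t) = v $ i"
  shows "x b \<in> interior S"
proof -
  define e :: "'n \<times> bool \<Rightarrow> real ^ 'n" where
    "e z = ((if snd z then 1 else - 1) * r) *\<^sub>R axis (fst z) 1" for z
  have "\<exists>\<eta>\<in>unit_controls. \<forall>i.
      integral {a..b} (\<lambda>t. P i t \<bullet> \<eta> t) - integral {a..b} (\<lambda>t. P i t \<bullet> \<xi> t) = e z $ i" for z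
    by (rule cover) (use r in \<open>simp add: e_def\<close>)
  then obtain \<zeta> where \<zeta>: "\<And>z. \<zeta> z \<in> unit_controls"
    and \<zeta>e: "\<And>z i. integral {a..b} (\<lambda>t. P i t \<bullet> \<zeta> z t) - integral {a..b} (\<lambda>t. P i t \<bullet> \<xi> t) = e z $ i"
    by metis
  define \<alpha> :: "real ^ 'n \<Rightarrow> 'n \<times> bool \<Rightarrow> real" where
    "\<alpha> h z = max ((if snd z then 1 else - 1) * h $ fst z) 0 / r" for h z
  define \<Xi> where "\<Xi> h t = \<xi> t + (\<Sum>z\<in>UNIV. \<alpha> h z *\<^sub>R (\<zeta> z t - \<xi> t))" for h t
  define N where "N = real (card (UNIV :: ('n \<times> bool) set))"
  have N: "0 < N" unfolding N_def by (simp add: card_gt_0_iff)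
  have \<alpha>0: "0 \<le> \<alpha> h z" for h z using r by (simp add: \<alpha>_def)
  have \<alpha>0z: "\<alpha> 0 z = 0" for z by (simp add: \<alpha>_def)
  have \<alpha>diff: "\<bar>\<alpha> h z - \<alpha> k z\<bar> \<le> norm (h - k) / r" for h k z
  proof -
    have m: "\<bar>max p 0 - max q 0\<bar> \<le> \<bar>p - q\<bar>" for p q :: real by (simp add: max_def)
    have "\<bar>\<alpha> h z - \<alpha> k z\<bar> = \<bar>max ((if snd z then 1 else - 1) * h $ fst z) 0 - max ((if snd z then 1 else - 1) * k $ fst z) 0\<bar> / r"
      using r by (simp add: \<alpha>_def diff_divide_distrib[symmetric])
    also have "\<dots> \<le> \<bar>(h - k) $ fst z\<bar> / r"
    proof (rule divide_right_mono)
      show "\<bar>max ((if snd z then 1 else - 1) * h $ fst z) 0 - max ((if snd z then 1 else - 1) * k $ fst z) 0\<bar> \<le> \<bar>(h - k) $ fst z\<bar>"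
        using m[of "h $ fst z" "k $ fst z"] m[of "- h $ fst z" "- k $ fst z"]
        by (cases "snd z") (simp_all add: abs_minus_commute)
    qed (use r in simp)
    also have "\<dots> \<le> norm (h - k) / r"
      using r by (intro divide_right_mono component_le_norm_cart) auto
    finally show ?thesis .
  qed
  have \<alpha>sum: "sum (\<alpha> h) UNIV \<le> N * norm h / r" for h
  proof -
    have "sum (\<alpha> h) UNIV \<le> (\<Sum>z\<in>(UNIV :: ('n \<times> bool) set). norm h / r)"
      using \<alpha>diff[of h _ 0] \<alpha>0z by (intro sum_mono) (metis abs_le_D1 diff_zero)
    then show ?thesis by (simp add: N_def)
  qed
  \<comment> \<open>There are \<open>N\<close> weights, each changing by at most
    \<open>norm (h - k) / r\<close>, and two unit controls differ by at most 2.\<close>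
  define M where "M = 2 * N / r"
  have M: "0 < M" using N r by (simp add: M_def)
  have \<Xi>diff: "norm (\<Xi> h t - \<Xi> k t) \<le> M * norm (h - k)" for h k t
  proof -
    have "\<Xi> h t - \<Xi> k t = (\<Sum>z\<in>UNIV. (\<alpha> h z - \<alpha> k z) *\<^sub>R (\<zeta> z t - \<xi> t))"
      by (simp add: \<Xi>_def sum_subtractf scaleR_left_diff_distrib)
    also have "norm \<dots> \<le> (\<Sum>z\<in>UNIV. norm ((\<alpha> h z - \<alpha> k z) *\<^sub>R (\<zeta> z t - \<xi> t)))" by (rule norm_sum)
    also have "\<dots> \<le> (\<Sum>z\<in>(UNIV :: ('n \<times> bool) set). norm (h - k) / r * 2)"
    proof (rule sum_mono)
      fix z
      have "norm (\<zeta> z t - \<xi> t) \<le> norm (\<zeta> z t) + norm (\<xi> t)" by (rule norm_triangle_ineq4)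
      also have "\<dots> \<le> 2" 
        using \<zeta>[of z] \<xi> add_mono[of "norm (\<zeta> z t)" 1 "norm (\<xi> t)" 1] by (simp add: unit_controls_def)
      finally show "norm ((\<alpha> h z - \<alpha> k z) *\<^sub>R (\<zeta> z t - \<xi> t)) \<le> norm (h - k) / r * 2"
        using \<alpha>diff[of h z k] r by (simp del: times_divide_eq_left add: mult_mono)
    qed
    also have "\<dots> = M * norm (h - k)" by (simp add: M_def N_def)
    finally show ?thesis .
  qed
  have \<Xi>0: "\<Xi> 0 = \<xi>" by (simp add: \<Xi>_def[abs_def] \<alpha>0z)
  \<comment> \<open>The linearised response to \<open>\<Xi> h\<close> equals \<open>h\<close>
    exactly, although the weights involve \<open>max\<close> and are not differentiable at 0. This
    is what makes the end point differentiable there.\<close>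
  have \<Xi>int: "integral {a..b} (\<lambda>t. P i t \<bullet> \<Xi> h t) - integral {a..b} (\<lambda>t. P i t \<bullet> \<xi> t) = h $ i" for h i
  proof -
    have "integral {a..b} (\<lambda>t. P i t \<bullet> \<Xi> h t) - integral {a..b} (\<lambda>t. P i t \<bullet> \<xi> t) = (\<Sum>z\<in>UNIV. \<alpha> h z * e z $ i)"
      unfolding \<Xi>_def
      by (subst integral_inner_affine_combination)
        (auto simp: \<zeta>e \<xi> \<zeta> intro: abs_continuous_on_interval_imp_continuous_on P(1))
    also have "\<dots> = (\<Sum>z\<in>UNIV. \<alpha> h z *\<^sub>R e z) $ i" by (simp add: sum_component)
    also have "(\<Sum>z\<in>UNIV. \<alpha> h z *\<^sub>R e z) = h"
      unfolding \<alpha>_def e_def using r by (intro axis_coordinate_decomposition) simp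
    finally show ?thesis .
  qed
  define C where "C = \<rho> * sqrt (exp (2 * (integral {a..b} l + (b - a))) * (b - a))"
  have C: "0 \<le> C" using \<rho> ab by (simp add: C_def)
  \<comment> \<open>The bound \<open>r / N\<close> keeps the sum of the weights at most 1; the other
    keeps the Gronwall distance at most 1/2, as the tube argument asks. The added 1 prevents a zero
    denominator when \<open>a = b\<close>, where \<open>C = 0\<close>.\<close>
  define \<delta> where "\<delta> = min (r / N) (1 / (2 * (C * M + 1)))"
  have CM: "0 < 2 * (C * M + 1)" using C M by (simp add: add_nonneg_pos)
  have \<delta>: "0 < \<delta>" using r N CM by (simp add: \<delta>_def)
  have \<delta>1: "N * norm h / r \<le> 1" if "h \<in> ball 0 \<delta>" for h :: "real ^ 'n"
  proof -
    have "norm h \<le> r / N" using that by (simp add: \<delta>_def)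
    then show ?thesis using N r by (simp add: field_simps)
  qed
  have \<delta>2: "C * (M * norm h) \<le> 1 / 2" if "h \<in> ball 0 \<delta>" for h :: "real ^ 'n"
  proof -
    have "norm h \<le> 1 / (2 * (C * M + 1))" using that by (simp add: \<delta>_def)
    then have "norm h * (2 * (C * M + 1)) \<le> 1" using CM by (simp only: pos_le_divide_eq)
    moreover have "norm h * (2 * (C * M + 1)) = 2 * (C * (M * norm h)) + 2 * norm h"
      by (simp add: algebra_simps)
    ultimately show ?thesis using norm_ge_zero[of h] by linarith
  qed
  have \<Xi>U: "\<Xi> h \<in> unit_controls" if "h \<in> ball 0 \<delta>" for h
    unfolding \<Xi>_def[abs_def]
    using \<alpha>sum[of h] \<delta>1[OF that] by (intro unit_controls_affine_combination \<xi> \<zeta> \<alpha>0) auto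
  have "\<forall>h\<in>ball 0 \<delta>. \<exists>y. abs_continuous_on_interval a b y \<and>
      (AE t in lebesgue_on {a..b}. (y has_vector_derivative f t (y t) + \<rho> *\<^sub>R \<Xi> h t) (at t within {a..b})) \<and>
      y a = x a \<and> y b \<in> S"
    by (intro ballI S \<Xi>U)
  from bchoice[OF this] obtain Y where Y: "\<forall>h\<in>ball 0 \<delta>. abs_continuous_on_interval a b (Y h) \<and>
      (AE t in lebesgue_on {a..b}. (Y h has_vector_derivative f t (Y h t) + \<rho> *\<^sub>R \<Xi> h t) (at t within {a..b})) \<and>
      Y h a = x a \<and> Y h b \<in> S" ..
  have Yac: "abs_continuous_on_interval a b (Y h)"
    and YD: "AE t in lebesgue_on {a..b}. (Y h has_vector_derivative f t (Y h t) + \<rho> *\<^sub>R \<Xi> h t) (at t within {a..b})"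
    and Ya: "Y h a = x a" and Yb: "Y h b \<in> S" if "h \<in> ball 0 \<delta>" for h
    using Y that by simp_all
  have xK: "x t \<in> cball 0 (B + 1)" if "t \<in> {a..b}" for t
    using B[OF that] by simp
  have YK: "Y h t \<in> cball 0 (B + 1)" if h: "h \<in> ball 0 \<delta>" and t: "t \<in> {a..b}" for h t
  proof -
    have "norm (x t - Y h t) \<le> 1"
    proof (rule trajectory_tube[OF _ _ t l lip x Yac[OF h] YD[OF h] B])
      show "AE t in lebesgue_on {a..b}. norm (\<xi> t - \<Xi> h t) \<le> M * norm h"
        using \<Xi>diff[of 0 _ h] by (simp add: \<Xi>0)
      show "\<rho> * sqrt (exp (2 * (integral {a..b} l + (b - a))) * (b - a)) * (M * norm h) \<le> 1 / 2"
        using \<delta>2[OF h] unfolding C_def .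
    qed (use Ya[OF h] M \<rho> in simp_all)
    moreover have "norm (Y h t) \<le> norm (x t) + norm (x t - Y h t)"
      by (metis norm_minus_commute norm_triangle_sub)
    ultimately show ?thesis using B[OF t] by simp
  qed
  have Ydiff: "norm (Y h t - Y k t) \<le> C * (M * norm (h - k))"
    if h: "h \<in> ball 0 \<delta>" and k: "k \<in> ball 0 \<delta>" and t: "t \<in> {a..b}" for h k t
    unfolding C_def
  proof (rule trajectory_difference_bound[OF _ _ t l lip Yac[OF h] YD[OF h] Yac[OF k] YD[OF k]])
    show "AE t in lebesgue_on {a..b}. norm (\<Xi> h t - \<Xi> k t) \<le> M * norm (h - k)"
      using \<Xi>diff by simp
    show "Y h s \<in> cball 0 (B + 1)" "Y k s \<in> cball 0 (B + 1)" if "s \<in> {a..t}" for s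
    proof -
      have s: "s \<in> {a..b}" using that t by auto
      show "Y h s \<in> cball 0 (B + 1)" "Y k s \<in> cball 0 (B + 1)"
        by (rule YK[OF h s], rule YK[OF k s])
    qed
  qed (use Ya[OF h] Ya[OF k] M \<rho> in simp_all)
  have xdiff: "norm (Y h t - x t) \<le> C * (M * norm h)"
    if h: "h \<in> ball 0 \<delta>" and t: "t \<in> {a..b}" for h t
    unfolding C_def
  proof (rule trajectory_difference_bound[OF _ _ t l lip Yac[OF h] YD[OF h] x])
    show "AE t in lebesgue_on {a..b}. norm (\<Xi> h t - \<xi> t) \<le> M * norm h"
      using \<Xi>diff[of h _ 0] by (simp add: \<Xi>0)
    show "Y h s \<in> cball 0 (B + 1)" "x s \<in> cball 0 (B + 1)" if "s \<in> {a..t}" for s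
    proof -
      have s: "s \<in> {a..b}" using that t by auto
      show "Y h s \<in> cball 0 (B + 1)" "x s \<in> cball 0 (B + 1)"
        by (rule YK[OF h s], rule xK[OF s])
    qed
  qed (use Ya[OF h] M \<rho> in simp_all)
  define F where "F h = Y h b" for h
  have b: "b \<in> {a..b}" using ab by simp
  have zero: "0 \<in> ball (0 :: real ^ 'n) \<delta>" using \<delta> by simp
  have F0: "F 0 = x b" using xdiff[OF zero b] by (simp add: F_def)
  have "continuous_on (ball 0 \<delta>) F"
  proof (rule lipschitz_on_continuous_on)
    show "(C * M)-lipschitz_on (ball 0 \<delta>) F"
      using C M Ydiff[OF _ _ b] by (intro lipschitz_onI) (auto simp: F_def dist_norm mult.assoc)
  qed
  moreover have "(F has_derivative (\<lambda>h. \<rho> *\<^sub>R h)) (at 0)"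
  proof -
    have "(F has_derivative (\<lambda>h. \<rho> *\<^sub>R h)) (at 0 within ball 0 \<delta>)"
      \<comment> \<open>The expansion is stated for sequences, by dominated convergence;
        \<open>norm (X k)\<close> serves as the scale.\<close>
      unfolding has_derivative_within tendsto_at_iff_sequentially
    proof (intro conjI allI impI bounded_linear_scaleR_right)
      fix X :: "nat \<Rightarrow> real ^ 'n"
      assume X: "\<forall>k. X k \<in> ball 0 \<delta> - {0}" and lim: "X \<longlonglongrightarrow> 0"
      have Xb: "X k \<in> ball 0 \<delta>" and Xn: "0 < norm (X k)" for k using X by auto
      have "(\<lambda>k. (1 / norm (X k)) *\<^sub>R (F (X k) - (F 0 + \<rho> *\<^sub>R X k))) \<longlonglongrightarrow> 0"
      proof (rule vec_tendstoI)
        fix i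
        \<comment> \<open>As \<open>P i b\<close> is the axis vector of index \<open>i\<close>, the
          pairing at \<open>b\<close> reads off that coordinate of the end point.\<close>
        have "(\<lambda>k. (P i b \<bullet> (Y (X k) b - x b)
            - \<rho> * (integral {a..b} (\<lambda>t. P i t \<bullet> \<Xi> (X k) t) - integral {a..b} (\<lambda>t. P i t \<bullet> \<xi> t))) / norm (X k)) \<longlonglongrightarrow> 0"
        proof (rule adjoint_first_order_expansion[OF f ab l lip jac x Yac[OF Xb] YD[OF Xb] P(1,3)])
          show "\<xi> \<in> borel_measurable lebesgue" "\<And>t. norm (\<xi> t) \<le> 1"
            using \<xi> by (auto simp: unit_controls_def)
          show "\<And>k. \<Xi> (X k) \<in> borel_measurable lebesgue" "\<And>k t. norm (\<Xi> (X k) t) \<le> 1"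
            using \<Xi>U[OF Xb] by (auto simp: unit_controls_def)
          show "norm (Y (X k) t - x t) \<le> (C * M) * norm (X k)" if "t \<in> {a..b}" for k t
            using xdiff[OF Xb that] by (simp add: mult.assoc)
          show "(\<lambda>k. norm (X k)) \<longlonglongrightarrow> 0" using lim by (rule tendsto_norm_zero)
        qed (use Xn xK YK[OF Xb] Ya[OF Xb] in auto)
        then show "(\<lambda>k. ((1 / norm (X k)) *\<^sub>R (F (X k) - (F 0 + \<rho> *\<^sub>R X k))) $ i) \<longlonglongrightarrow> 0 $ i"
          unfolding P(2) \<Xi>int F0 by (simp add: F_def inner_axis' divide_inverse mult.commute algebra_simps)
      qed
      then show "((\<lambda>y. (1 / norm (y - 0)) *\<^sub>R (F y - (F 0 + \<rho> *\<^sub>R (y - 0)))) \<circ> X) \<longlonglongrightarrow> 0"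
        by (simp add: comp_def)
    qed
    then show ?thesis using at_within_open[OF zero open_ball] by simp
  qed
  \<comment> \<open>The derivative at 0 has the right inverse
    \<open>\<lambda>h. (1 / \<rho>) *\<^sub>R h\<close>, since \<rho> > 0.\<close>
  ultimately have "F 0 \<in> interior (F ` ball 0 \<delta>)"
    using \<rho> zero
    by (intro sussmann_open_mapping[where S = "ball 0 \<delta>" and g' = "\<lambda>h. (1 / \<rho>) *\<^sub>R h" and f' = "\<lambda>h. \<rho> *\<^sub>R h"])
      (auto intro!: bounded_linear_scaleR_right simp: fun_eq_iff)
  moreover have "F ` ball 0 \<delta> \<subseteq> S" unfolding F_def using Yb by blast
  ultimately show ?thesis unfolding F0 using interior_mono by blast
qed

theorem boundary_maximum_principle:
  fixes f :: "real \<Rightarrow> real ^ 'n \<Rightarrow> real ^ 'n"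
  assumes f: "admissible_rhs f" and \<rho>: "0 < \<rho>" and ab: "a \<le> b"
    and x: "abs_continuous_on_interval a b x"
      "AE t in lebesgue_on {a..b}. (x has_vector_derivative f t (x t) + \<rho> *\<^sub>R \<xi> t) (at t within {a..b})"
    and xm: "x \<in> borel_measurable lebesgue" and \<xi>: "\<xi> \<in> unit_controls"
    and S: "\<And>\<eta>. \<eta> \<in> unit_controls \<Longrightarrow> \<exists>y. abs_continuous_on_interval a b y \<and>
      (AE t in lebesgue_on {a..b}. (y has_vector_derivative f t (y t) + \<rho> *\<^sub>R \<eta> t) (at t within {a..b})) \<and>
      y a = x a \<and> y b \<in> S"
    and xb: "x b \<notin> interior S"
  obtains p where "abs_continuous_on_interval a b p" "\<And>t. t \<in> {a..b} \<Longrightarrow> p t \<noteq> 0"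
    "AE t in lebesgue_on {a..b}. (p has_vector_derivative - (transpose (jacobian (f t) (at (x t))) *v p t)) (at t within {a..b})"
    "AE t in lebesgue_on {a..b}. \<xi> t = sgn (p t)"
proof -
  obtain B where B: "B > 0" "\<And>t. t \<in> {a..b} \<Longrightarrow> norm (x t) \<le> B"
    by (rule abs_continuous_bounded[OF x(1)]) (rule that)
  obtain l where l: "\<And>a b. l absolutely_integrable_on {a..b}" "\<And>t. 0 \<le> l t"
    and lip: "AE t in lebesgue. \<forall>x\<in>cball 0 (B + 1). \<forall>y\<in>cball 0 (B + 1). norm (f t x - f t y) \<le> l t * norm (x - y)"
    and jac: "AE t in lebesgue. \<forall>x\<in>cball 0 (B + 1). \<forall>v. norm (jacobian (f t) (at x) *v v) \<le> l t * norm v"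
    by (rule admissible_rhs_bounds[OF f compact_cball]) (rule that)
  have xK: "x t \<in> cball 0 (B + 1)" if "t \<in> {a..b}" for t
    using B(2)[OF that] by simp
  have "\<exists>p. abs_continuous_on_interval a b p \<and> p b = axis i 1 \<and>
      (AE t in lebesgue_on {a..b}. (p has_vector_derivative - (transpose (jacobian (f t) (at (x t))) *v p t)) (at t within {a..b}))" for i
    by (rule adjoint_exists[OF f ab xm xK l(1) l(2) jac, where q = "axis i 1"]) blast+
  then obtain P where "\<forall>i. abs_continuous_on_interval a b (P i) \<and> P i b = axis i 1 \<and>
      (AE t in lebesgue_on {a..b}. (P i has_vector_derivative - (transpose (jacobian (f t) (at (x t))) *v P i t)) (at t within {a..b}))"
    using choice[of "\<lambda>i p. abs_continuous_on_interval a b p \<and> p b = axis i 1 \<and>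
      (AE t in lebesgue_on {a..b}. (p has_vector_derivative - (transpose (jacobian (f t) (at (x t))) *v p t)) (at t within {a..b}))"]
    by blast
  then have P: "abs_continuous_on_interval a b (P i)" "P i b = axis i 1"
    "AE t in lebesgue_on {a..b}. (P i has_vector_derivative - (transpose (jacobian (f t) (at (x t))) *v P i t)) (at t within {a..b})" for i
    by simp_all
  have Pc: "continuous_on {a..b} (P i)" for i
    by (rule abs_continuous_on_interval_imp_continuous_on[OF P(1)])
  \<comment> \<open>Each component pairs the control with the adjoint solution ending in an axis
    vector, so that \<open>\<rho> *\<^sub>R (L \<eta> - L \<xi>)\<close> is the end point of the
    linearised system.\<close>
  define L where "L \<eta> = (\<chi> i. integral {a..b} (\<lambda>t. P i t \<bullet> \<eta> t))" for \<eta>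
  define R where "R = (\<lambda>\<eta>. L \<eta> - L \<xi>) ` unit_controls"
  have "0 \<in> R" unfolding R_def using \<xi> by (intro image_eqI[of _ _ \<xi>]) auto
  have "convex R"
    unfolding convex_alt
  proof (intro ballI allI impI)
    fix v w u assume "v \<in> R" "w \<in> R" and u: "0 \<le> u \<and> u \<le> (1::real)"
    then obtain \<eta>1 \<eta>2 where \<eta>: "\<eta>1 \<in> unit_controls" "\<eta>2 \<in> unit_controls"
      and vw: "v = L \<eta>1 - L \<xi>" "w = L \<eta>2 - L \<xi>"
      unfolding R_def by blast
    \<comment> \<open>An affine combination around \<open>\<eta>1\<close> with the single weight
      \<open>u\<close>.\<close>
    define \<eta> where "\<eta> t = \<eta>1 t + (\<Sum>i\<in>{()}. u *\<^sub>R (\<eta>2 t - \<eta>1 t))" for t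
    have "\<eta> \<in> unit_controls"
      unfolding \<eta>_def[abs_def] using \<eta> u by (intro unit_controls_affine_combination) auto
    moreover have "L \<eta> = L \<eta>1 + u *\<^sub>R (L \<eta>2 - L \<eta>1)"
      unfolding L_def \<eta>_def vec_eq_iff
      by (subst integral_inner_affine_combination) (auto intro: Pc \<eta>)
    then have "(1 - u) *\<^sub>R v + u *\<^sub>R w = L \<eta> - L \<xi>"
      unfolding vw by (simp add: algebra_simps)
    ultimately show "(1 - u) *\<^sub>R v + u *\<^sub>R w \<in> R" unfolding R_def by blast
  qed
  have "0 \<notin> interior R"
  proof
    assume "0 \<in> interior R"
    then obtain r where r: "0 < r" "cball 0 r \<subseteq> R" unfolding mem_interior_cball by blast
    have "x b \<in> interior S"
    proof (rule reachable_interior[OF f \<rho> ab l lip jac B(2) x \<xi> S P r(1)])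
      fix v :: "real ^ 'n" assume "norm v \<le> r"
      then have "v \<in> R" using r(2) by (auto simp: subset_iff)
      then obtain \<eta> where "\<eta> \<in> unit_controls" "v = L \<eta> - L \<xi>" unfolding R_def by blast
      then show "\<exists>\<eta>\<in>unit_controls. \<forall>i.
          integral {a..b} (\<lambda>t. P i t \<bullet> \<eta> t) - integral {a..b} (\<lambda>t. P i t \<bullet> \<xi> t) = v $ i"
        by (intro bexI[of _ \<eta>]) (simp_all add: L_def)
    qed
    then show False using xb by simp
  qed
  then obtain q where q: "q \<noteq> 0" "\<And>v. v \<in> R \<Longrightarrow> q \<bullet> v \<le> 0"
    using separating_direction[OF \<open>convex R\<close> \<open>0 \<in> R\<close>] by blast
  \<comment> \<open>By linearity this is the adjoint solution with terminal value \<open>q\<close>,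
    and pairing it with a control gives \<open>q \<bullet> L \<eta>\<close>.\<close>
  define p where "p t = (\<Sum>i\<in>UNIV. q $ i *\<^sub>R P i t)" for t
  have p1: "abs_continuous_on_interval a b p"
    unfolding p_def[abs_def] by (rule abs_continuous_sum_scaleR) (auto intro: P)
  have "AE t in lebesgue_on {a..b}. \<forall>i\<in>UNIV.
      (P i has_vector_derivative - (transpose (jacobian (f t) (at (x t))) *v P i t)) (at t within {a..b})"
    by (rule AE_finite_allI[OF finite P(3)])
  then have p2: "AE t in lebesgue_on {a..b}.
      (p has_vector_derivative - (transpose (jacobian (f t) (at (x t))) *v p t)) (at t within {a..b})"
  proof eventually_elim
    case (elim t)
    define A where "A = transpose (jacobian (f t) (at (x t)))"
    have "(p has_vector_derivative (\<Sum>i\<in>UNIV. q $ i *\<^sub>R (- (A *v P i t)))) (at t within {a..b})"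
      unfolding p_def[abs_def] A_def
    proof (rule has_vector_derivative_sum)
      fix i
      show "((\<lambda>s. q $ i *\<^sub>R P i s) has_vector_derivative
          q $ i *\<^sub>R - (transpose (jacobian (f t) (at (x t))) *v P i t)) (at t within {a..b})"
        using elim by (intro bounded_linear.has_vector_derivative[OF bounded_linear_scaleR_right]) blast
    qed
    also have "(\<Sum>i\<in>UNIV. q $ i *\<^sub>R (- (A *v P i t))) = - (A *v p t)"
      unfolding p_def
      by (simp add: linear_sum[OF matrix_vector_mul_linear] matrix_vector_mult_scaleR sum_negf)
    finally show ?case unfolding A_def .
  qed
  have pb: "p b = q"
    unfolding p_def P(2) using basis_expansion[of q] by (simp add: scalar_mult_eq_scaleR)
  have p3: "p t \<noteq> 0" if "t \<in> {a..b}" for t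
    by (rule adjoint_nonzero[OF xK l(1) l(2) jac p1 p2, where s = b]) (use ab q pb that in auto)
  have pL: "integral {a..b} (\<lambda>t. p t \<bullet> \<eta> t) = q \<bullet> L \<eta>" if "\<eta> \<in> unit_controls" for \<eta>
  proof -
    have "((\<lambda>t. \<Sum>i\<in>UNIV. q $ i * (P i t \<bullet> \<eta> t)) has_integral
        (\<Sum>i\<in>UNIV. q $ i * integral {a..b} (\<lambda>t. P i t \<bullet> \<eta> t))) {a..b}"
      by (intro has_integral_sum has_integral_mult_right integrable_integral inner_unit_control_integrable Pc that finite)
    moreover have "(\<lambda>t. \<Sum>i\<in>UNIV. q $ i * (P i t \<bullet> \<eta> t)) = (\<lambda>t. p t \<bullet> \<eta> t)"
      by (simp add: p_def inner_sum_left)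
    moreover have "(\<Sum>i\<in>UNIV. q $ i * integral {a..b} (\<lambda>t. P i t \<bullet> \<eta> t)) = q \<bullet> L \<eta>"
      by (simp only: inner_vec_def[of q] L_def vec_lambda_beta inner_real_def)
    ultimately show ?thesis by (simp add: integral_unique)
  qed
  have "AE t in lebesgue_on {a..b}. \<xi> t = sgn (p t)"
  proof (rule maximizing_control_eq_direction[OF abs_continuous_on_interval_imp_continuous_on[OF p1] p3 \<xi>])
    fix \<eta> :: "real \<Rightarrow> real ^ 'n" assume \<eta>: "\<eta> \<in> unit_controls"
    then have "q \<bullet> (L \<eta> - L \<xi>) \<le> 0" by (intro q(2)) (simp add: R_def)
    then show "integral {a..b} (\<lambda>t. p t \<bullet> \<eta> t) \<le> integral {a..b} (\<lambda>t. p t \<bullet> \<xi> t)"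
      by (simp add: pL \<eta> \<xi> inner_diff_right)
  qed
  with p1 p3 p2 show ?thesis by (rule that)
qed

section \<open>The normalised adjoint\<close>

text \<open>Away from a ball around 0 the map \<open>sgn\<close> is Lipschitz, and the minimum of
  \<open>norm (p t)\<close> over a nonempty compact interval is positive.\<close>

lemma abs_continuous_sgn:
  fixes p :: "real \<Rightarrow> 'a::euclidean_space"
  assumes p: "abs_continuous_on_interval a b p" "\<And>t. t \<in> {a..b} \<Longrightarrow> p t \<noteq> 0"
  shows "abs_continuous_on_interval a b (\<lambda>t. sgn (p t))"
proof (cases "{a..b} = {}")
  case True
  then show ?thesis
    by (intro abs_continuous_lipschitz_compose[OF p(1), where L = 1]) auto
next
  case False
  obtain s where s: "s \<in> {a..b}" "\<And>t. t \<in> {a..b} \<Longrightarrow> norm (p s) \<le> norm (p t)"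
    using continuous_attains_inf[OF compact_Icc False
        continuous_on_norm[OF abs_continuous_on_interval_imp_continuous_on[OF p(1)]]] by blast
  have m: "norm (p s) > 0" using p(2)[OF s(1)] by simp
  show ?thesis
  proof (rule abs_continuous_lipschitz_compose[OF p(1), where L = "2 / norm (p s)"])
    fix u v assume uv: "u \<in> {a..b}" "v \<in> {a..b}"
    have n: "norm (p u) > 0" "norm (p v) > 0" using p(2) uv by auto
    \<comment> \<open>Both terms on the right have norm at most \<open>norm (p v - p u)\<close>,
      whence the 2 in the constant.\<close>
    have "norm (p u) *\<^sub>R (sgn (p v) - sgn (p u)) = (norm (p u) - norm (p v)) *\<^sub>R sgn (p v) + (p v - p u)"
      using n by (simp add: sgn_div_norm algebra_simps)
    then have "norm (p u) * norm (sgn (p v) - sgn (p u)) = norm ((norm (p u) - norm (p v)) *\<^sub>R sgn (p v) + (p v - p u))"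
      by (metis norm_scaleR abs_norm_cancel)
    also have "\<dots> \<le> norm ((norm (p u) - norm (p v)) *\<^sub>R sgn (p v)) + norm (p v - p u)"
      by (rule norm_triangle_ineq)
    also have "\<dots> \<le> 2 * norm (p v - p u)"
      using n norm_triangle_ineq3[of "p u" "p v"] by (simp add: norm_sgn norm_minus_commute)
    finally have "norm (p u) * norm (sgn (p v) - sgn (p u)) \<le> 2 * norm (p v - p u)" .
    moreover have "norm (p s) * norm (sgn (p v) - sgn (p u)) \<le> norm (p u) * norm (sgn (p v) - sgn (p u))"
      using s(2)[OF uv(1)] by (intro mult_right_mono) auto
    ultimately show "norm (sgn (p v) - sgn (p u)) \<le> 2 / norm (p s) * norm (p v - p u)"
      using m by (simp add: pos_le_divide_eq mult.commute)
  qed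
qed

text \<open>Only the component of \<open>d\<close> orthogonal to \<open>p t\<close> turns the
  direction; the radial one changes the length.\<close>

lemma has_vector_derivative_sgn:
  fixes p :: "real \<Rightarrow> 'a::real_inner"
  assumes p: "(p has_vector_derivative d) (at t within S)" and "p t \<noteq> 0"
  shows "((\<lambda>t. sgn (p t)) has_vector_derivative
    (1 / norm (p t)) *\<^sub>R (d - (sgn (p t) \<bullet> d) *\<^sub>R sgn (p t))) (at t within S)"
proof -
  have "((\<lambda>s. norm (p s)) has_derivative (\<lambda>h. (h *\<^sub>R d) \<bullet> sgn (p t))) (at t within S)"
    using has_derivative_compose[OF p[unfolded has_vector_derivative_def] has_derivative_norm[OF assms(2)]] .
  then have "((\<lambda>s. norm (p s)) has_field_derivative (sgn (p t) \<bullet> d)) (at t within S)"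
    by (simp add: has_field_derivative_def inner_commute mult_commute_abs)
  then have "((\<lambda>s. inverse (norm (p s))) has_field_derivative
      - (inverse (norm (p t)) * (sgn (p t) \<bullet> d) * inverse (norm (p t)))) (at t within S)"
    using assms(2) by (intro DERIV_inverse') auto
  from has_vector_derivative_scaleR[OF this p]
  show ?thesis
    unfolding sgn_div_norm by (simp add: divide_inverse algebra_simps)
qed

text \<open>The origin of the equation for \<open>u\<close>: by linearity the factor
  \<open>1 / norm (p t)\<close> moves inside and turns \<open>p t\<close> into its direction, and
  the quadratic term removes the radial component.\<close>

lemma has_vector_derivative_normalised_adjoint:
  fixes p :: "real \<Rightarrow> real ^ 'n"
  assumes "(p has_vector_derivative - (transpose A *v p t)) (at t within S)" and "p t \<noteq> 0"
  defines "w \<equiv> transpose A *v sgn (p t)"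
  shows "((\<lambda>t. sgn (p t)) has_vector_derivative - w + (sgn (p t) \<bullet> w) *\<^sub>R sgn (p t)) (at t within S)"
proof -
  have "w = (1 / norm (p t)) *\<^sub>R (transpose A *v p t)"
    unfolding w_def sgn_div_norm by (simp only: matrix_vector_mult_scaleR divide_inverse mult_1)
  then have "(1 / norm (p t)) *\<^sub>R (- (transpose A *v p t) - (sgn (p t) \<bullet> - (transpose A *v p t)) *\<^sub>R sgn (p t))
      = - w + (sgn (p t) \<bullet> w) *\<^sub>R sgn (p t)"
    by (simp add: scaleR_right_diff_distrib scaleR_add_right del: transpose_matrix_vector)
  then show ?thesis using has_vector_derivative_sgn[OF assms(1,2)] by simp
qed

section \<open>Caratheodory solutions on compact intervals, and the conclusion for invariant
  sets\<close>

lemma caratheodory_solution_Icc: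
  assumes "abs_continuous_on_interval a b x"
    and "AE t in lebesgue_on {a..b}. (x has_vector_derivative g t (x t)) (at t within {a..b})"
  shows "caratheodory_solution {a..b} g x"
proof -
  have "abs_continuous_on_interval c d x" if "c \<le> d" "{c..d} \<subseteq> {a..b}" for c d
    using that by (intro abs_continuous_on_subinterval[OF assms(1)]) auto
  then show ?thesis
    using assms(2) unfolding caratheodory_solution_def locally_abs_continuous_on_def by blast
qed

text \<open>Derivatives are taken within the interval, so values outside it are immaterial. This
  moves a statement from a concrete solution on the line to \<open>trajectory\<close>, which agrees
  with it only on the interval.\<close>

lemma caratheodory_solution_Icc_cong:
  assumes x: "caratheodory_solution {a..b} g x" and eq: "\<And>t. t \<in> {a..b} \<Longrightarrow> y t = x t" and "a \<le> b"
  shows "caratheodory_solution {a..b} g y"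
proof (rule caratheodory_solution_Icc)
  have ac: "abs_continuous_on_interval a b x"
    and D: "AE t in lebesgue_on {a..b}. (x has_vector_derivative g t (x t)) (at t within {a..b})"
    using x \<open>a \<le> b\<close> unfolding caratheodory_solution_def locally_abs_continuous_on_def by auto
  show "abs_continuous_on_interval a b y"
    by (rule abs_continuous_lipschitz_compose[OF ac, where L = 1]) (simp add: eq)
  have "AE t in lebesgue_on {a..b}. t \<in> {a..b}"
    using AE_space[of "lebesgue_on {a..b}"] by simp
  with D show "AE t in lebesgue_on {a..b}. (y has_vector_derivative g t (y t)) (at t within {a..b})"
  proof eventually_elim
    case (elim t)
    show ?case
      unfolding eq[OF elim(2)]
      by (rule has_vector_derivative_transform[OF elim(2) eq elim(1)])
  qed
qed

lemma caratheodory_solution_UNIV_measurable: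
  fixes x :: "real \<Rightarrow> 'a::euclidean_space"
  assumes "caratheodory_solution UNIV g x"
  shows "x \<in> borel_measurable lebesgue"
proof -
  have "continuous_on UNIV x"
  proof (rule continuous_at_imp_continuous_on, rule ballI)
    fix t :: real
    have "abs_continuous_on_interval (t - 1) (t + 1) x"
      using assms unfolding caratheodory_solution_def locally_abs_continuous_on_def by simp
    then have "continuous_on {t - 1..t + 1} x" by (rule abs_continuous_on_interval_imp_continuous_on)
    then show "continuous (at t) x"
      by (rule continuous_on_interior) simp
  qed
  then have "x \<in> borel_measurable (lebesgue_on UNIV)"
    by (intro continuous_imp_measurable_on_sets_lebesgue) auto
  then show ?thesis by simp
qed

lemma running_cost_frontier:
  assumes "x \<in> frontier (M t)"
  shows "running_cost M t x = 0"
  unfolding running_cost_def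
proof (rule antisym)
  have "bdd_below ((\<lambda>p. (norm (x - p))\<^sup>2) ` frontier (M t))"
    by (rule bdd_belowI[of _ 0]) auto
  from cINF_lower[OF this assms] show "(INF p\<in>frontier (M t). (norm (x - p))\<^sup>2) \<le> 0" by simp
  show "0 \<le> (INF p\<in>frontier (M t). (norm (x - p))\<^sup>2)"
    using assms by (intro cINF_greatest) auto
qed

theorem proposition3p1:
  fixes f :: "real \<Rightarrow> real ^ 'n \<Rightarrow> real ^ 'n"
    and \<rho> \<tau>1 \<tau>2 t0 :: real
    and M :: "real \<Rightarrow> (real ^ 'n) set"
    and x0 :: "real ^ 'n"
    and \<xi>s xs :: "real \<Rightarrow> real ^ 'n"
  assumes "CARD('n) \<ge> 2"
    and "\<rho> > 0"
    and "admissible_rhs f"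
    and "globally_solvable f \<rho>"
    and "invariant_set f \<rho> M"
    and "\<tau>1 < t0" and "t0 < \<tau>2"
    and "x0 \<in> frontier (M t0)"
    and "\<xi>s \<in> controls {\<tau>1..\<tau>2}"
    and xs_def: "xs = trajectory f \<rho> {\<tau>1..\<tau>2} t0 x0 \<xi>s"
    and "\<And>t. t \<in> {\<tau>1..\<tau>2} \<Longrightarrow> xs t \<in> frontier (M t)"
  shows "(\<forall>\<xi>\<in>controls {\<tau>1..\<tau>2}. cost f \<rho> M t0 x0 \<xi>s \<tau>1 \<tau>2 \<le> cost f \<rho> M t0 x0 \<xi> \<tau>1 \<tau>2) \<and>
    (\<exists>u. (AE t in lebesgue_on {\<tau>1..\<tau>2}. u t = \<xi>s t) \<and>
         caratheodory_solution {\<tau>1..\<tau>2} (extremal_field f \<rho>) (\<lambda>t. (xs t, u t)))"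
proof
  have \<tau>: "\<tau>1 < \<tau>2" and t0: "t0 \<in> {\<tau>1..\<tau>2}" using assms(6,7) by auto
  have \<rho>: "0 \<le> \<rho>" using \<open>\<rho> > 0\<close> by simp
  note f = \<open>admissible_rhs f\<close>
  have "cost f \<rho> M t0 x0 \<xi>s \<tau>1 \<tau>2 = (\<integral>\<^sup>+ t. 0 \<partial>lebesgue_on {\<tau>1..\<tau>2})"
    unfolding cost_def xs_def[symmetric]
    by (rule nn_integral_cong) (simp add: running_cost_frontier assms(11))
  then show "\<forall>\<xi>\<in>controls {\<tau>1..\<tau>2}. cost f \<rho> M t0 x0 \<xi>s \<tau>1 \<tau>2 \<le> cost f \<rho> M t0 x0 \<xi> \<tau>1 \<tau>2"
    by simp
  obtain \<eta> where \<eta>m: "\<eta> \<in> borel_measurable lebesgue" "\<And>t. norm (\<eta> t) \<le> 1"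
    and \<eta>\<xi>: "AE t in lebesgue_on {\<tau>1..\<tau>2}. \<eta> t = \<xi>s t"
    using controls_representative[OF assms(9)] by blast
  have \<eta>: "\<eta> \<in> unit_controls" using \<eta>m by (simp add: unit_controls_def)
  have "\<eta> \<in> controls UNIV" by (rule bounded_measurable_in_controls[OF \<eta>m])
  \<comment> \<open>Solving on the whole line with the bounded representative gives a concrete
    measurable curve, with which the definite description \<open>xs\<close> agrees on the
    interval.\<close>
  then obtain X where X: "is_trajectory f \<rho> UNIV t0 x0 \<eta> X"
    using \<open>globally_solvable f \<rho>\<close> unfolding globally_solvable_def by blast
  have Xsol: "caratheodory_solution UNIV (\<lambda>t y. f t y + \<rho> *\<^sub>R \<eta> t) X" and X0: "X t0 = x0"
    using X by (auto simp: is_trajectory_def)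
  have Xac: "abs_continuous_on_interval \<tau>1 \<tau>2 X"
    and XD: "AE t in lebesgue_on {\<tau>1..\<tau>2}. (X has_vector_derivative f t (X t) + \<rho> *\<^sub>R \<eta> t) (at t within {\<tau>1..\<tau>2})"
    using is_trajectory_on_interval[OF X, of \<tau>1 \<tau>2] \<tau> by simp_all
  have "is_trajectory f \<rho> {\<tau>1..\<tau>2} t0 x0 \<xi>s X"
    unfolding is_trajectory_def
  proof (intro conjI X0 caratheodory_solution_Icc Xac)
    show "AE t in lebesgue_on {\<tau>1..\<tau>2}. (X has_vector_derivative f t (X t) + \<rho> *\<^sub>R \<xi>s t) (at t within {\<tau>1..\<tau>2})"
      using XD \<eta>\<xi> by eventually_elim simp
  qed
  then have xsX: "xs t = X t" if "t \<in> {\<tau>1..\<tau>2}" for t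
    unfolding xs_def using t0 that by (intro trajectory_eq[OF f \<rho>, where a = \<tau>1 and b = \<tau>2]) auto
  have cl: "closed (M t)" for t
    using assms(5) by (simp add: invariant_set_def compact_imp_closed)
  have XM: "X \<tau>1 \<in> M \<tau>1"
    using assms(11)[of \<tau>1] xsX[of \<tau>1] frontier_subset_closed[OF cl[of \<tau>1]] \<tau> by auto
  \<comment> \<open>By invariance all end points of trajectories started at \<open>X \<tau>1\<close>
    lie in \<open>M \<tau>2\<close>, which becomes the set \<open>S\<close> of the maximum
    principle.\<close>
  have reach: "reach f \<rho> \<tau>2 \<tau>1 (X \<tau>1) \<subseteq> M \<tau>2"
    using assms(5) \<tau> XM unfolding invariant_set_def by blast
  obtain p where p: "abs_continuous_on_interval \<tau>1 \<tau>2 p" "\<And>t. t \<in> {\<tau>1..\<tau>2} \<Longrightarrow> p t \<noteq> 0"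
    and pD: "AE t in lebesgue_on {\<tau>1..\<tau>2}.
      (p has_vector_derivative - (transpose (jacobian (f t) (at (X t))) *v p t)) (at t within {\<tau>1..\<tau>2})"
    and p\<eta>: "AE t in lebesgue_on {\<tau>1..\<tau>2}. \<eta> t = sgn (p t)"
  proof (rule boundary_maximum_principle[OF f \<open>\<rho> > 0\<close> less_imp_le[OF \<tau>] Xac XD
        caratheodory_solution_UNIV_measurable[OF Xsol] \<eta>])
    fix \<zeta> :: "real \<Rightarrow> real ^ 'n" assume "\<zeta> \<in> unit_controls"
    then have \<zeta>: "\<zeta> \<in> controls UNIV"
      by (intro bounded_measurable_in_controls) (auto simp: unit_controls_def)
    then obtain y where y: "is_trajectory f \<rho> UNIV \<tau>1 (X \<tau>1) \<zeta> y"
      using \<open>globally_solvable f \<rho>\<close> unfolding globally_solvable_def by blast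
    have "trajectory f \<rho> UNIV \<tau>1 (X \<tau>1) \<zeta> \<tau>2 = y \<tau>2"
      using \<tau> by (intro trajectory_eq[OF f \<rho>, where a = \<tau>1 and b = \<tau>2] y) auto
    then have "y \<tau>2 \<in> M \<tau>2" using reach \<zeta> unfolding reach_def by force
    then show "\<exists>y. abs_continuous_on_interval \<tau>1 \<tau>2 y \<and>
      (AE t in lebesgue_on {\<tau>1..\<tau>2}. (y has_vector_derivative f t (y t) + \<rho> *\<^sub>R \<zeta> t) (at t within {\<tau>1..\<tau>2})) \<and>
      y \<tau>1 = X \<tau>1 \<and> y \<tau>2 \<in> M \<tau>2"
      using is_trajectory_on_interval[OF y, of \<tau>1 \<tau>2] \<tau> y by (auto simp: is_trajectory_def)
  next
    show "X \<tau>2 \<notin> interior (M \<tau>2)"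
      using assms(11)[of \<tau>2] xsX[of \<tau>2] \<tau> by (simp add: frontier_def)
  qed (rule that)
  show "\<exists>u. (AE t in lebesgue_on {\<tau>1..\<tau>2}. u t = \<xi>s t) \<and>
         caratheodory_solution {\<tau>1..\<tau>2} (extremal_field f \<rho>) (\<lambda>t. (xs t, u t))"
  proof (intro exI conjI)
    \<comment> \<open>The modification on a null set is the absolutely continuous function
      \<open>sgn (p t)\<close>.\<close>
    show "AE t in lebesgue_on {\<tau>1..\<tau>2}. sgn (p t) = \<xi>s t"
      using \<eta>\<xi> p\<eta> by eventually_elim simp
    have "caratheodory_solution {\<tau>1..\<tau>2} (extremal_field f \<rho>) (\<lambda>t. (X t, sgn (p t)))"
    proof (rule caratheodory_solution_Icc)
      show "abs_continuous_on_interval \<tau>1 \<tau>2 (\<lambda>t. (X t, sgn (p t)))"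
        by (intro abs_continuous_Pair Xac abs_continuous_sgn p)
      have "AE t in lebesgue_on {\<tau>1..\<tau>2}. t \<in> {\<tau>1..\<tau>2}"
        using AE_space[of "lebesgue_on {\<tau>1..\<tau>2}"] by simp
      with XD pD p\<eta> show "AE t in lebesgue_on {\<tau>1..\<tau>2}.
        ((\<lambda>t. (X t, sgn (p t))) has_vector_derivative extremal_field f \<rho> t (X t, sgn (p t))) (at t within {\<tau>1..\<tau>2})"
      proof eventually_elim
        case (elim t)
        from has_vector_derivative_Pair[OF elim(1) has_vector_derivative_normalised_adjoint[OF elim(2) p(2)[OF elim(4)]]]
        show ?case unfolding extremal_field_def Let_def prod.case elim(3)[symmetric] .
      qed
    qed
    then show "caratheodory_solution {\<tau>1..\<tau>2} (extremal_field f \<rho>) (\<lambda>t. (xs t, sgn (p t)))"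
      by (rule caratheodory_solution_Icc_cong) (use xsX \<tau> in auto)
  qed
qed

end
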